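(* Let $\nu\in\mathbb{C}\setminus\mathbb{Z}$ with $\Re(\nu)\ge0$, let $\chi_1$ and $\chi_2$ be non-principal even primitive Dirichlet characters modulo $p$ and $q$ respectively, and let $N$ be an integer with $N\ge\lfloor\frac{\Re(\nu)+1}{2}\rfloor$. Then for every $x>0$ with $pqx\notin\mathbb{Z}_{>0}$, \begin{align*} &8\pi x^{\frac{\nu}{2}}\sum_{n=1}^{\infty}\sigma_{-\nu, \bar{\chi}_1,\bar{\chi}_2}(n) n^{\nu/2} K_{\nu}(4\pi\sqrt{nx}) =\frac{ 2 p^{1-\nu}q }{\tau(\chi_1)\tau(\chi_2) \sin\left(\frac{\pi \nu}{2}\right)}\left\{\sum_{j=1}^{N} L(2j,\chi_2)\, L(2j-\nu, \chi_1)(pqx)^{2j-1} \right.\\ &\left. \qquad +(pqx)^{2N+1}\sum_{n=1}^\infty\sigma_{-\nu, \chi_2,\chi_1}(n) \left( \frac{n^{\nu-2N}-(pqx)^{\nu-2N}}{n^2-(pqx)^2} \right) \right\}. \end{align*}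
   Context: For Dirichlet characters $\chi_1,\chi_2$ and $z\in\mathbb{C}$: $\sigma_{z,\chi_1,\chi_2}(n)=\sum_{d\mid n}d^z\chi_1(d)\chi_2(n/d)$. $\tau(\chi)=\sum_{h=1}^q\chi(h)e^{2\pi i h/q}$ is the Gauss sum, $L(s,\chi)$ the Dirichlet $L$-function, and $K_\nu$ the modified Bessel function of the second kind. *)

theory Defs
  imports "HOL-Complex_Analysis.Complex_Analysis" "HOL-Number_Theory.Number_Theory"
begin

definition dirichlet_char :: "nat \<Rightarrow> (nat \<Rightarrow> complex) \<Rightarrow> bool" where
  "dirichlet_char q chi \<longleftrightarrow> q > 0 \<and> (\<forall>n. chi (n + q) = chi n) \<and>
     (\<forall>m n. chi (m * n) = chi m * chi n) \<and> chi 1 = 1 \<and> (\<forall>n. chi n \<noteq> 0 \<longleftrightarrow> coprime n q)"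

definition principal_char :: "nat \<Rightarrow> (nat \<Rightarrow> complex) \<Rightarrow> bool" where
  "principal_char q chi \<longleftrightarrow> (\<forall>n. coprime n q \<longrightarrow> chi n = 1)"

text \<open>chi(-1) = 1, i.e. chi(q-1) = 1.\<close>
definition even_char :: "nat \<Rightarrow> (nat \<Rightarrow> complex) \<Rightarrow> bool" where
  "even_char q chi \<longleftrightarrow> chi (q - 1) = 1"

definition primitive_char :: "nat \<Rightarrow> (nat \<Rightarrow> complex) \<Rightarrow> bool" where
  "primitive_char q chi \<longleftrightarrow> dirichlet_char q chi \<and>
     (\<forall>d. d dvd q \<and> d < q \<longrightarrow> \<not> (\<forall>n. coprime n q \<and> [n = 1] (mod d) \<longrightarrow> chi n = 1))"

definition gauss_sum :: "nat \<Rightarrow> (nat \<Rightarrow> complex) \<Rightarrow> complex" where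
  "gauss_sum q chi = (\<Sum>h=1..q. chi h * exp (2 * pi * \<i> * of_nat h / of_nat q))"

text \<open>Dirichlet L-function: the (unique) entire function agreeing with the Dirichlet series
on Re s > 1 (analytic continuation; exists for non-principal characters).\<close>
definition dirichlet_L :: "(nat \<Rightarrow> complex) \<Rightarrow> complex \<Rightarrow> complex" where
  "dirichlet_L chi = (THE f. f holomorphic_on UNIV \<and>
     (\<forall>s. Re s > 1 \<longrightarrow> f s = (\<Sum>n. chi (Suc n) / of_nat (Suc n) powr s)))"

definition sigma_chi :: "complex \<Rightarrow> (nat \<Rightarrow> complex) \<Rightarrow> (nat \<Rightarrow> complex) \<Rightarrow> nat \<Rightarrow> complex" where
  "sigma_chi z chi1 chi2 n = (\<Sum>d\<in>{d. d dvd n}. of_nat d powr z * chi1 d * chi2 (n div d))"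

definition besselK :: "complex \<Rightarrow> real \<Rightarrow> complex" where
  "besselK \<nu> x = integral {0..} (\<lambda>t::real. of_real (exp (- x * cosh t)) * cosh (\<nu> * of_real t))"

end

theory Submission
  imports Defs "HOL-Real_Asymp.Real_Asymp"
begin

text \<open>
  Writing \<open>F\<^sub>i(u) = \<Sum>n. cnj (\<chi>\<^sub>i n) exp (- 2\<pi>nu)\<close>, the integral representation of \<open>K\<^sub>\<nu>\<close> turns the
  Bessel series into \<open>4\<pi> \<integral> exp (\<nu>w) F\<^sub>1(exp w) F\<^sub>2(x exp (- w)) dw\<close>, an entire function of \<open>\<nu>\<close>.
  Separability of the Gauss sums and the partial fraction expansion of the cotangent give
  \<open>F(u) = q / (\<pi> \<tau>(\<chi>)) \<Sum>m. \<chi>(m) qu / ((qu)\<^sup>2 + m\<^sup>2)\<close> for an even primitive character modulo \<open>q\<close>.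
  For small positive \<open>\<nu>\<close> one may integrate the product of the two expansions term by term; the Beta
  integral evaluates each term, and this is the claim for \<open>N = 0\<close>. Passing from \<open>N\<close> to \<open>N + 1\<close> only
  splits off the absolutely convergent product \<open>L(2N+2, \<chi>\<^sub>2) L(2N+2-\<nu>, \<chi>\<^sub>1)\<close>. Both sides are
  holomorphic in the strip \<open>-1 < Re \<nu> < 2N+1\<close>, so the identity theorem finishes the proof.
\<close>

section \<open>Sums, integrals and holomorphic dependence on parameters\<close>

text \<open>Every sum over \<open>n\<close> is kept as a double series over pairs of positive
  integers until the end: divisor sums are only a regrouping, while absolute convergence, domination
  and holomorphy are visible on pairs. Non-principality gives mean zero over a period, which removes
  the constant left by the geometric series and keeps the antidifferences bounded; evenness pairs
  the residues \<open>h\<close> and \<open>q - h\<close>. The restriction to small order has one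
  cause: termwise integration needs a majorant that is a summable function of the pair times an
  integrable function of \<open>w\<close>, and for \<open>0 < \<nu> < 1/4\<close> one is easy to
  write down. Inside the strip the arguments \<open>2j - \<nu>\<close> leave the half-plane of
  absolute convergence, so the L-functions must really be continued; the splitting is carried out
  only for \<open>-1 < Re \<nu> < 1\<close>, where every series converges absolutely. Since
  \<open>sin (\<pi>\<nu>/2)\<close> has zeros in the strip, the identity theorem is applied after
  multiplying it out. The assumption on \<open>N\<close> says exactly
  \<open>Re \<nu> < 2N + 1\<close>, and the factor \<open>p powr (1 - \<nu>)\<close> stems from
  translating \<open>w\<close> by \<open>ln p\<close>.\<close>

lemma has_sum_integral_dominated:
  fixes f :: "nat \<times> nat \<Rightarrow> real \<Rightarrow> complex" and b :: "real \<Rightarrow> real"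
  assumes meas: "\<And>i. f i \<in> borel_measurable lborel"
    and bound: "\<And>i w. norm (f i w) \<le> a i * b w"
    and a: "a summable_on UNIV" "\<And>i. a i \<ge> 0" and b: "integrable lborel b" "\<And>w. b w \<ge> 0"
  shows "((\<lambda>i. \<integral>w. f i w \<partial>lborel) has_sum (\<integral>w. (\<Sum>\<^sub>\<infinity>i. f i w) \<partial>lborel)) UNIV"
    and "(\<lambda>w. \<Sum>\<^sub>\<infinity>i. f i w) \<in> borel_measurable lborel"
    and "norm (\<Sum>\<^sub>\<infinity>i. f i w) \<le> (\<Sum>\<^sub>\<infinity>i. a i) * b w"
proof -
  \<comment> \<open>Sum and integral are interchanged along an enumeration of the pairs; the
    unordered sum is then recovered from the absolute summability of the integrals.\<close>
  let ?e = "prod_decode"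
  have bij: "bij_betw ?e UNIV UNIV" by (rule bij_prod_decode)
  have int: "integrable lborel (f i)" for i
    by (rule Bochner_Integration.integrable_bound[OF integrable_mult_right[OF b(1), of "a i"] meas])
       (use bound a b in \<open>auto simp: abs_mult\<close>)
  have asum: "summable (\<lambda>n. a (?e n))"
    using summable_on_imp_summable[of "\<lambda>n. a (?e n)"] summable_on_reindex_bij_betw[OF bij, of a] a(1) by auto
  have abs: "(\<lambda>i. norm (f i w)) summable_on UNIV" for w
    using summable_on_comparison_test[OF summable_on_cmult_left[OF a(1), of "b w"]] bound by fastforce
  have nsum: "summable (\<lambda>n. norm (f (?e n) w))" for w
    by (rule summable_comparison_test'[OF summable_mult2[OF asum, of "b w"], of 0]) (use bound in auto)
  have nint: "norm (\<integral>w. norm (f i w) \<partial>lborel) \<le> a i * (\<integral>w. b w \<partial>lborel)" for i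
  proof -
    have "(\<integral>w. norm (f i w) \<partial>lborel) \<le> (\<integral>w. a i * b w \<partial>lborel)"
      by (intro integral_mono int integrable_norm integrable_mult_right b bound)
    thus ?thesis by simp
  qed
  have nint_sum: "summable (\<lambda>n. \<integral>w. norm (f (?e n) w) \<partial>lborel)"
    by (rule summable_comparison_test'[OF summable_mult2[OF asum, of "\<integral>w. b w \<partial>lborel"], of 0]) (use nint in auto)
  have inf_eq: "(\<Sum>\<^sub>\<infinity>i. f i w) = (\<Sum>n. f (?e n) w)" for w
  proof -
    have "((\<lambda>i. f i w) has_sum (\<Sum>\<^sub>\<infinity>i. f i w)) UNIV"
      by (rule has_sum_infsum[OF abs_summable_summable[OF abs]])
    hence "((\<lambda>n. f (?e n) w) has_sum (\<Sum>\<^sub>\<infinity>i. f i w)) UNIV"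
      using has_sum_reindex_bij_betw[OF bij, of "\<lambda>i. f i w"] by simp
    thus ?thesis using has_sum_imp_sums sums_unique by blast
  qed
  have eq: "(\<integral>w. (\<Sum>\<^sub>\<infinity>i. f i w) \<partial>lborel) = (\<Sum>n. \<integral>w. f (?e n) w \<partial>lborel)"
    unfolding inf_eq by (rule integral_suminf[OF int _ nint_sum]) (use nsum in auto)
  have abs2: "(\<lambda>i. norm (\<integral>w. f i w \<partial>lborel)) summable_on UNIV"
  proof (rule summable_on_comparison_test[OF summable_on_cmult_left[OF a(1), of "\<integral>w. b w \<partial>lborel"]])
    show "norm (\<integral>w. f i w \<partial>lborel) \<le> a i * (\<integral>w. b w \<partial>lborel)" for i
      using order.trans[OF integral_norm_bound[of lborel "f i"]] nint[of i] by simp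
  qed auto
  have "((\<lambda>i. \<integral>w. f i w \<partial>lborel) has_sum (\<Sum>\<^sub>\<infinity>i. \<integral>w. f i w \<partial>lborel)) UNIV"
    by (rule has_sum_infsum[OF abs_summable_summable[OF abs2]])
  moreover have "((\<lambda>n. \<integral>w. f (?e n) w \<partial>lborel) has_sum (\<Sum>\<^sub>\<infinity>i. \<integral>w. f i w \<partial>lborel)) UNIV"
    using calculation has_sum_reindex_bij_betw[OF bij, of "\<lambda>i. \<integral>w. f i w \<partial>lborel"] by simp
  ultimately show "((\<lambda>i. \<integral>w. f i w \<partial>lborel) has_sum (\<integral>w. (\<Sum>\<^sub>\<infinity>i. f i w) \<partial>lborel)) UNIV"
    using eq has_sum_imp_sums sums_unique by metis
  show "(\<lambda>w. \<Sum>\<^sub>\<infinity>i. f i w) \<in> borel_measurable lborel"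
    unfolding inf_eq using meas by (intro borel_measurable_suminf) auto
  show "norm (\<Sum>\<^sub>\<infinity>i. f i w) \<le> (\<Sum>\<^sub>\<infinity>i. a i) * b w"
  proof -
    have "norm (\<Sum>\<^sub>\<infinity>i. f i w) \<le> (\<Sum>\<^sub>\<infinity>i. norm (f i w))" by (rule norm_infsum_bound[OF abs])
    also have "\<dots> \<le> (\<Sum>\<^sub>\<infinity>i. a i * b w)"
      by (intro infsum_mono abs summable_on_cmult_left a bound)
    finally show ?thesis by (simp add: infsum_cmult_left a)
  qed
qed

text \<open>Pairs of positive integers are regrouped by their product, which unconditional
  convergence permits. It serves both the Bessel series and the series on the right-hand
  side.\<close>

lemma has_sum_pairs_imp_divisor_sums:
  fixes g :: "nat \<Rightarrow> nat \<Rightarrow> complex"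
  assumes "((\<lambda>(a,b). g (Suc a) (Suc b)) has_sum S) UNIV"
  shows "(\<lambda>n. \<Sum>d\<in>{d. d dvd Suc n}. g d (Suc n div d)) sums S"
proof -
  let ?D = "SIGMA n:UNIV. {d. d dvd Suc n}"
  have "((\<lambda>(n,d). g d (Suc n div d)) has_sum S) ?D \<longleftrightarrow> ((\<lambda>(a,b). g (Suc a) (Suc b)) has_sum S) UNIV"
  \<comment> \<open>All indices start at 0, so (a + 1)(b + 1) = n + 1 reads n = a + b + ab.\<close>
  proof (rule has_sum_reindex_bij_witness[of _ "\<lambda>(a,b). (a + b + a * b, Suc a)" "\<lambda>(n,d). (d - 1, Suc n div d - 1)"], goal_cases)
    case (1 nd)
    then obtain n d where nd: "nd = (n, d)" "d dvd Suc n" by auto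
    then obtain k where k: "Suc n = d * k" by auto
    have "d \<noteq> 0" "k \<noteq> 0" using k by (auto intro!: Nat.gr0I)
    then obtain a b where ab: "d = Suc a" "k = Suc b" by (meson not0_implies_Suc)
    have "Suc n div d = k" unfolding k using ab by (simp del: mult_Suc mult_Suc_right)
    thus ?case using nd k ab by simp
  next
    case (3 ab)
    have "Suc (a + b + a * b) = Suc a * Suc b" for a b by simp
    hence "Suc (a + b + a * b) div Suc a = Suc b" for a b by (simp only: nonzero_mult_div_cancel_left nat.distinct not_False_eq_True)
    thus ?case by (auto split: prod.splits)
  next
    case (4 ab)
    have "Suc (a + b + a * b) = Suc a * Suc b" for a b by simp
    hence "Suc a dvd Suc (a + b + a * b)" for a b by (simp only: dvd_triv_left)
    thus ?case by (auto split: prod.splits)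
  next
    case (5 nd)
    then obtain n d where nd: "nd = (n, d)" "d dvd Suc n" by auto
    then obtain k where k: "Suc n = d * k" by auto
    have "d \<noteq> 0" "k \<noteq> 0" using k by (auto intro!: Nat.gr0I)
    then obtain a b where ab: "d = Suc a" "k = Suc b" by (meson not0_implies_Suc)
    have "Suc n div d = k" unfolding k using ab by (simp del: mult_Suc mult_Suc_right)
    thus ?case using nd k ab by simp
  qed auto
  hence "((\<lambda>(n,d). g d (Suc n div d)) has_sum S) ?D" using assms by simp
  hence "((\<lambda>n. \<Sum>d\<in>{d. d dvd Suc n}. g d (Suc n div d)) has_sum S) UNIV"
    by (rule has_sum_SigmaD) (auto intro!: has_sum_finite)
  thus ?thesis by (rule has_sum_imp_sums)
qed

text \<open>Weierstrass's theorem for unordered sums: a summable majorant on a disc gives uniform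
  convergence along the net of finite subsets, and holomorphy is a local matter.\<close>

lemma holomorphic_on_infsum:
  fixes f :: "'i \<Rightarrow> complex \<Rightarrow> complex"
  assumes S: "open S" and hol: "\<And>i. i \<in> I \<Longrightarrow> f i holomorphic_on S"
    and loc: "\<And>z. z \<in> S \<Longrightarrow> \<exists>r>0. \<exists>M. cball z r \<subseteq> S \<and> M summable_on I \<and>
                 (\<forall>i\<in>I. \<forall>w\<in>cball z r. norm (f i w) \<le> M i)"
  shows "(\<lambda>z. \<Sum>\<^sub>\<infinity>i\<in>I. f i z) holomorphic_on S"
proof -
  have "\<exists>f'. ((\<lambda>z. \<Sum>\<^sub>\<infinity>i\<in>I. f i z) has_field_derivative f') (at z)" if z: "z \<in> S" for z
  proof -
    obtain r M where r: "r > 0" "cball z r \<subseteq> S" and M: "M summable_on I"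
      and b: "\<And>i w. i \<in> I \<Longrightarrow> w \<in> cball z r \<Longrightarrow> norm (f i w) \<le> M i"
      using loc[OF z] by blast
    have ul: "uniform_limit (cball z r) (\<lambda>X w. \<Sum>i\<in>X. f i w) (\<lambda>w. \<Sum>\<^sub>\<infinity>i\<in>I. f i w) (finite_subsets_at_top I)"
      by (rule Weierstrass_m_test_general[OF b M])
    have hX: "(\<lambda>w. \<Sum>i\<in>X. f i w) holomorphic_on S" if "X \<subseteq> I" for X
      using hol that by (intro holomorphic_on_sum) auto
    have ev: "eventually (\<lambda>X. continuous_on (cball z r) (\<lambda>w. \<Sum>i\<in>X. f i w) \<and> (\<lambda>w. \<Sum>i\<in>X. f i w) holomorphic_on ball z r)
            (finite_subsets_at_top I)"
    proof (rule eventually_finite_subsets_at_top_weakI)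
      fix X assume "finite X" "X \<subseteq> I"
      thus "continuous_on (cball z r) (\<lambda>w. \<Sum>i\<in>X. f i w) \<and> (\<lambda>w. \<Sum>i\<in>X. f i w) holomorphic_on ball z r"
        using hX[of X] r by (meson ball_subset_cball holomorphic_on_imp_continuous_on holomorphic_on_subset)
    qed
    have "(\<lambda>w. \<Sum>\<^sub>\<infinity>i\<in>I. f i w) holomorphic_on ball z r"
      by (rule holomorphic_uniform_limit[OF ev ul]) auto
    thus ?thesis using r by (auto simp: holomorphic_on_open)
  qed
  thus ?thesis using S by (simp add: holomorphic_on_open)
qed

text \<open>Expanding the exponential under the integral gives a power series in
  \<open>\<nu>\<close> whose coefficients are the moments of \<open>h\<close> divided by factorials;
  integrability against every \<open>exp (R * \<bar>w\<bar>)\<close> makes it converge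
  everywhere.\<close>

lemma entire_exp_integral:
  fixes h :: "real \<Rightarrow> complex"
  assumes meas: "h \<in> borel_measurable lborel"
    and int: "\<And>R. R > 0 \<Longrightarrow> integrable lborel (\<lambda>w. exp (R * \<bar>w\<bar>) * norm (h w))"
  shows "(\<lambda>\<nu>. \<integral>w. exp (\<nu> * of_real w) * h w \<partial>lborel) holomorphic_on UNIV"
proof -
  define c where "c n = (\<integral>w. (of_real w ^ n / fact n) * h w \<partial>lborel)" for n :: nat
  have sums: "(\<lambda>n. c n * (\<nu> - 0) ^ n) sums (\<integral>w. exp (\<nu> * of_real w) * h w \<partial>lborel)" for \<nu>
  proof -
    \<comment> \<open>Any \<open>R\<close> exceeding \<open>norm \<nu>\<close> works: each term of
      the exponential series at \<open>R * \<bar>w\<bar>\<close> is at most its sum, and the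
      geometric factor \<open>(norm \<nu> / R) ^ n\<close> is left over for summability.\<close>
    define R where "R = norm \<nu> + 1"
    have R: "R > 0" by (auto simp: R_def add_nonneg_pos)
    let ?g = "\<lambda>n w. (\<nu> * of_real w) ^ n / fact n * h w"
    have e: "(\<lambda>n. (R * \<bar>w\<bar>) ^ n / fact n) sums exp (R * \<bar>w\<bar>)" for w
      using exp_converges[of "R * \<bar>w\<bar>"] by (simp add: field_simps scaleR_conv_of_real)
    have term_le: "(R * \<bar>w\<bar>) ^ n / fact n \<le> exp (R * \<bar>w\<bar>)" for w n
      using sum_le_suminf[OF sums_summable[OF e[of w]], of "{n}"] sums_unique[OF e[of w]] R by auto
    have ng: "norm (?g n w) \<le> (norm \<nu> / R) ^ n * (exp (R * \<bar>w\<bar>) * norm (h w))" for n w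
    proof -
      have "norm (?g n w) = (norm \<nu> / R) ^ n * ((R * \<bar>w\<bar>) ^ n / fact n * norm (h w))"
        using R by (simp add: norm_mult norm_divide norm_power power_mult_distrib power_divide)
      also have "\<dots> \<le> (norm \<nu> / R) ^ n * (exp (R * \<bar>w\<bar>) * norm (h w))"
        using R by (intro mult_left_mono mult_right_mono term_le) auto
      finally show ?thesis .
    qed
    have intg: "integrable lborel (?g n)" for n
      by (rule Bochner_Integration.integrable_bound[OF integrable_mult_right[OF int[OF R], of "(norm \<nu> / R) ^ n"]])
         (use meas in measurable, intro AE_I2 order.trans[OF ng] order.trans[OF _ abs_ge_self], simp)
    have geo: "summable (\<lambda>n. (norm \<nu> / R) ^ n)"
      using R by (intro summable_geometric) (auto simp: R_def)
    have s1: "summable (\<lambda>n. norm (?g n w))" for w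
      by (rule summable_comparison_test'[OF summable_mult2[OF geo], of 0]) (use ng in auto)
    have nint: "norm (\<integral>w. norm (?g n w) \<partial>lborel) \<le> (norm \<nu> / R) ^ n * (\<integral>w. exp (R * \<bar>w\<bar>) * norm (h w) \<partial>lborel)" for n
    proof -
      have "(\<integral>w. norm (?g n w) \<partial>lborel) \<le> (\<integral>w. (norm \<nu> / R) ^ n * (exp (R * \<bar>w\<bar>) * norm (h w)) \<partial>lborel)"
        by (intro integral_mono intg integrable_norm integrable_mult_right int R ng)
      thus ?thesis by simp
    qed
    have s2: "summable (\<lambda>n. \<integral>w. norm (?g n w) \<partial>lborel)"
      by (rule summable_comparison_test'[OF summable_mult2[OF geo], of 0]) (use nint in auto)
    have "(\<lambda>n. \<integral>w. ?g n w \<partial>lborel) sums (\<integral>w. (\<Sum>n. ?g n w) \<partial>lborel)"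
      by (rule sums_integral[OF intg _ s2]) (use s1 in auto)
    moreover have "(\<Sum>n. ?g n w) = exp (\<nu> * of_real w) * h w" for w
    proof -
      have "(\<lambda>n. (\<nu> * of_real w) ^ n / fact n * h w) sums (exp (\<nu> * of_real w) * h w)"
        using exp_converges[of "\<nu> * of_real w"]
        by (intro sums_mult2) (simp add: field_simps scaleR_conv_of_real)
      thus ?thesis by (rule sums_unique[symmetric])
    qed
    moreover have "(\<integral>w. ?g n w \<partial>lborel) = c n * (\<nu> - 0) ^ n" for n
    proof -
      have "(\<integral>w. ?g n w \<partial>lborel) = (\<integral>w. \<nu> ^ n * ((of_real w ^ n / fact n) * h w) \<partial>lborel)"
        by (simp add: power_mult_distrib algebra_simps)
      thus ?thesis by (simp add: c_def mult.commute)
    qed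
    ultimately show ?thesis by simp
  qed
  have "(\<lambda>\<nu>. \<integral>w. exp (\<nu> * of_real w) * h w \<partial>lborel) holomorphic_on ball 0 r" for r
    by (rule power_series_holomorphic[of 0 r c]) (use sums in auto)
  hence "(\<lambda>\<nu>. \<integral>w. exp (\<nu> * of_real w) * h w \<partial>lborel) field_differentiable at z" for z
    using holomorphic_on_imp_differentiable_at[of _ "ball 0 (norm z + 1)" z] by simp
  thus ?thesis by (auto simp: holomorphic_on_def field_differentiable_at_within)
qed

section \<open>Dirichlet characters and Gauss sums\<close>

lemma dirichlet_char_periodic: "dirichlet_char q chi \<Longrightarrow> chi (n + k * q) = chi n"
  by (induction k) (auto simp: dirichlet_char_def add.assoc[symmetric], metis add.assoc add.commute)

lemma dirichlet_char_mod: "dirichlet_char q chi \<Longrightarrow> chi (n mod q) = chi n"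
  using dirichlet_char_periodic[of q chi "n mod q" "n div q"] by simp

lemma dirichlet_char_cong: "dirichlet_char q chi \<Longrightarrow> [m = n] (mod q) \<Longrightarrow> chi m = chi n"
  using dirichlet_char_mod[of q chi m] dirichlet_char_mod[of q chi n] by (simp add: cong_def)

lemma dirichlet_char_mult: "dirichlet_char q chi \<Longrightarrow> chi (m * n) = chi m * chi n"
  by (simp add: dirichlet_char_def)

lemma dirichlet_char_eq_0_iff: "dirichlet_char q chi \<Longrightarrow> chi n = 0 \<longleftrightarrow> \<not> coprime n q"
  by (auto simp: dirichlet_char_def)

lemma dirichlet_char_power: "dirichlet_char q chi \<Longrightarrow> chi (n ^ k) = chi n ^ k"
  by (induction k) (auto simp: dirichlet_char_def)

lemma norm_dirichlet_char:
  assumes "dirichlet_char q chi" "coprime n q" shows "norm (chi n) = 1"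
proof -
  have q: "q > 0" using assms by (simp add: dirichlet_char_def)
  have "chi n ^ totient q = chi (n ^ totient q)" using assms by (simp add: dirichlet_char_power)
  also have "\<dots> = chi 1"
    by (rule dirichlet_char_cong[OF assms(1) euler_theorem[OF assms(2)]])
  also have "\<dots> = 1" using assms by (simp add: dirichlet_char_def)
  finally have "norm (chi n) ^ totient q = 1" by (metis norm_one norm_power)
  thus ?thesis using power_eq_1_iff[of "norm (chi n)" "totient q"] q by auto
qed

lemma norm_dirichlet_char_le: "dirichlet_char q chi \<Longrightarrow> norm (chi n) \<le> 1"
  using norm_dirichlet_char[of q chi n] dirichlet_char_eq_0_iff[of q chi n] by (cases "coprime n q") auto

lemma nonprincipal_modulus_gt_1:
  assumes "dirichlet_char q chi" "\<not> principal_char q chi" shows "q > 1"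
proof (rule ccontr)
  assume "\<not> q > 1"
  hence q: "q = 1" using assms by (auto simp: dirichlet_char_def)
  have "chi n = chi 1" for n by (rule dirichlet_char_cong[OF assms(1)]) (simp add: q)
  thus False using assms by (auto simp: dirichlet_char_def principal_char_def)
qed

lemma even_char_reflect:
  assumes "dirichlet_char q chi" "even_char q chi" "h \<le> q"
  shows "chi (q - h) = chi h"
proof -
  have q: "q > 0" using assms by (simp add: dirichlet_char_def)
  have "(q - 1) * h + q = q - h + h * q"
    using assms q by (cases q) (auto simp: algebra_simps)
  hence "[(q - 1) * h = q - h] (mod q)"
    by (metis cong_add_rcancel_0_nat cong_def mod_add_self2 mod_mult_self1 mult.commute)
  hence "chi (q - h) = chi ((q - 1) * h)" using dirichlet_char_cong[OF assms(1)] by metis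
  thus ?thesis using assms by (simp add: dirichlet_char_mult even_char_def)
qed

lemma sum_coprime_reindex:
  fixes f :: "nat \<Rightarrow> 'a :: comm_monoid_add"
  assumes "coprime a q" "q > 0"
  shows "(\<Sum>h<q. f (a * h mod q)) = (\<Sum>h<q. f h)"
proof -
  have inj: "inj_on (\<lambda>h. a * h mod q) {..<q}"
    using assms by (auto simp: inj_on_def cong_def[symmetric] cong_mult_lcancel_nat intro: cong_less_modulus_unique_nat)
  moreover have "(\<lambda>h. a * h mod q) ` {..<q} = {..<q}"
    by (rule endo_inj_surj) (use inj assms in auto)
  ultimately have "bij_betw (\<lambda>h. a * h mod q) {..<q} {..<q}" by (simp add: bij_betw_def)
  thus ?thesis by (rule sum.reindex_bij_betw)
qed

section \<open>Separability and non-vanishing of Gauss sums\<close>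

abbreviation root_e :: "nat \<Rightarrow> nat \<Rightarrow> complex" where
  "root_e q n \<equiv> exp (2 * pi * \<i> * of_nat n / of_nat q)"

lemma root_e_eq_iff: "q > 0 \<Longrightarrow> root_e q m = root_e q n \<longleftrightarrow> [m = n] (mod q)"
  using complex_root_unity_eq[of q m n] by (simp add: cong_def)

lemma sum_atLeast1_atMost_periodic:
  fixes f :: "nat \<Rightarrow> 'a :: comm_monoid_add"
  assumes "f q = f 0" shows "(\<Sum>h=1..q. f h) = (\<Sum>h<q. f h)"
proof (cases "q = 0")
  case False
  have "{1..q} = insert q {1..<q}" "{..<q} = insert 0 {1..<q}" using False by auto
  thus ?thesis using assms by simp
qed auto

text \<open>If \<open>n\<close> is coprime to \<open>q\<close>, the substitution of
  \<open>n * h\<close> for \<open>h\<close> pulls out the character value. Otherwise the right side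
  is 0, and primitivity supplies a symmetry that forces the left side to vanish too.\<close>

lemma gauss_sum_separable:
  assumes prim: "primitive_char q chi" and q1: "q > 1"
  shows "(\<Sum>h<q. chi h * root_e q (h * n)) = cnj (chi n) * gauss_sum q chi"
proof -
  have chi: "dirichlet_char q chi" using prim by (simp add: primitive_char_def)
  have q: "q > 0" using q1 by simp
  define G where "G m = (\<Sum>h<q. chi h * root_e q (h * m))" for m
  have gs: "gauss_sum q chi = (\<Sum>h<q. chi h * root_e q h)"
    unfolding gauss_sum_def
  proof (rule sum_atLeast1_atMost_periodic)
    show "chi q * root_e q q = chi 0 * root_e q 0"
      using dirichlet_char_cong[OF chi, of q 0] root_e_eq_iff[OF q, of q 0] by (simp add: cong_def)
  qed
  have shift: "(\<Sum>h<q. chi (a * h) * root_e q (a * h * m)) = G m" if "coprime a q" for a m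
  proof -
    have "(\<Sum>h<q. chi (a * h) * root_e q (a * h * m)) =
          (\<Sum>h<q. chi (a * h mod q) * root_e q ((a * h mod q) * m))"
    proof (intro sum.cong refl arg_cong2[where f = "(*)"])
      fix h show "root_e q (a * h * m) = root_e q ((a * h mod q) * m)"
        using root_e_eq_iff[OF q, of "a * h * m" "(a * h mod q) * m"] by (simp add: cong_def mod_mult_left_eq)
    qed (simp add: dirichlet_char_mod[OF chi])
    also have "\<dots> = G m" unfolding G_def by (rule sum_coprime_reindex[OF that q])
    finally show ?thesis .
  qed
  show ?thesis
  proof (cases "coprime n q")
    case True
    have "chi n * G n = (\<Sum>h<q. chi (n * h) * root_e q (n * h * 1))"
      unfolding G_def by (auto simp: sum_distrib_left dirichlet_char_mult[OF chi] algebra_simps intro!: sum.cong)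
    also have "\<dots> = G 1" by (rule shift[OF True])
    finally have *: "chi n * G n = gauss_sum q chi" by (simp add: G_def gs)
    have "cnj (chi n) * chi n = 1"
      using norm_dirichlet_char[OF chi True] by (metis complex_norm_square mult.commute of_real_1 power_one)
    hence "G n = cnj (chi n) * (chi n * G n)" by (simp add: mult.assoc[symmetric])
    hence "G n = cnj (chi n) * gauss_sum q chi" unfolding * .
    thus ?thesis unfolding G_def .
  next
    case False
    define g where "g = gcd n q"
    define d where "d = q div g"
    have "g \<noteq> 1" using False unfolding g_def coprime_iff_gcd_eq_1 .
    moreover have "g > 0" using q unfolding g_def by simp
    ultimately have g: "g > 1" by simp
    have dg: "q = d * g" by (simp add: d_def g_def)
    have d: "d dvd q" "d < q" using dg g q by auto
    \<comment> \<open>With \<open>d = q / gcd n q\<close>, a unit congruent to 1 modulo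
      \<open>d\<close> fixes \<open>n\<close> modulo \<open>q\<close>. Multiplication by it
      preserves all the exponentials but multiplies the sum by
      \<open>chi a \<noteq> 1\<close>.\<close>
    obtain a where a: "coprime a q" "[a = 1] (mod d)" "chi a \<noteq> 1"
      using prim d unfolding primitive_char_def by blast
    have an: "[a * n = n] (mod q)"
    proof -
      obtain k where k: "n = g * k" unfolding g_def by (meson dvdE gcd_dvd1)
      have "[a * g = 1 * g] (mod d * g)" using a(2) by (simp add: cong_def mult_mod_left)
      hence "[a * g * k = g * k] (mod d * g)" by (metis cong_scalar_right mult_1)
      thus ?thesis by (simp add: k dg mult.assoc)
    qed
    have e: "root_e q (a * h * n) = root_e q (h * n)" for h
      using cong_scalar_left[OF an, of h] root_e_eq_iff[OF q, of "a * h * n" "h * n"]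
      by (simp add: algebra_simps)
    have "chi a * G n = (\<Sum>h<q. chi (a * h) * root_e q (a * h * n))"
      unfolding G_def e by (simp add: sum_distrib_left dirichlet_char_mult[OF chi] algebra_simps)
    also have "\<dots> = G n" by (rule shift[OF a(1)])
    finally have "G n = 0" using a(3) by simp
    thus ?thesis using False dirichlet_char_eq_0_iff[OF chi] by (simp add: G_def)
  qed
qed

text \<open>This is separability at \<open>n = 0\<close>, where the character vanishes because
  \<open>q > 1\<close>.\<close>

lemma sum_primitive_char:
  assumes "primitive_char q chi" "q > 1" shows "(\<Sum>h<q. chi h) = 0"
proof -
  have "chi 0 = 0" using assms dirichlet_char_eq_0_iff[of q chi 0] by (auto simp: primitive_char_def)
  thus ?thesis using gauss_sum_separable[OF assms, of 0] by simp
qed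

text \<open>If the Gauss sum were 0, separability would annihilate the whole finite Fourier
  transform of the character; Fourier inversion at the residue 1 would then give
  \<open>chi 1 * q = 0\<close>.\<close>

lemma gauss_sum_nonzero:
  assumes prim: "primitive_char q chi" and q1: "q > 1"
  shows "gauss_sum q chi \<noteq> 0"
proof
  assume z: "gauss_sum q chi = 0"
  have q: "q > 0" using q1 by simp
  have geo: "(\<Sum>n<q. root_e q (h * n) / root_e q n) = (if h = 1 then of_nat q else 0)" if h: "h < q" for h
  proof -
    define r where "r = root_e q h / root_e q 1"
    have pw: "root_e q (h * n) = root_e q h ^ n" for h n
      by (simp add: exp_of_nat_mult[symmetric] algebra_simps)
    have "(\<Sum>n<q. root_e q (h * n) / root_e q n) = (\<Sum>n<q. r ^ n)"
      using pw[of 1] by (simp add: pw r_def power_divide power_mult del: of_nat_mult)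
    also have "\<dots> = (if h = 1 then of_nat q else 0)"
    proof (cases "h = 1")
      case False
      have "\<not> [h = 1] (mod q)" using False h q1 by (simp add: cong_def)
      hence r: "r \<noteq> 1" using root_e_eq_iff[OF q, of h 1] by (simp add: r_def)
      have "root_e q (h * q) = 1" for h using root_e_eq_iff[OF q, of "h * q" 0] by (simp add: cong_def)
      hence "r ^ q = 1" using pw[of h q] pw[of 1 q] by (metis div_by_1 power_divide r_def)
      thus ?thesis using r False by (simp add: geometric_sum)
    qed (simp add: r_def)
    finally show ?thesis .
  qed
  have "0 = (\<Sum>n<q. (\<Sum>h<q. chi h * root_e q (h * n)) / root_e q n)"
    using gauss_sum_separable[OF assms] z by simp
  also have "\<dots> = (\<Sum>n<q. \<Sum>h<q. chi h * (root_e q (h * n) / root_e q n))"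
    by (simp add: sum_divide_distrib)
  also have "\<dots> = (\<Sum>h<q. \<Sum>n<q. chi h * (root_e q (h * n) / root_e q n))"
    by (rule sum.swap)
  also have "\<dots> = (\<Sum>h<q. chi h * (if h = 1 then of_nat q else 0))"
  proof (intro sum.cong refl)
    fix h assume "h \<in> {..<q}"
    thus "(\<Sum>n<q. chi h * (root_e q (h * n) / root_e q n)) = chi h * (if h = 1 then of_nat q else 0)"
      using geo[of h] by (simp only: sum_distrib_left[symmetric] lessThan_iff)
  qed
  also have "\<dots> = chi 1 * of_nat q"
    using q1 by (simp add: if_distrib cong: if_cong)
  finally show False using prim q by (simp add: primitive_char_def dirichlet_char_def)
qed

section \<open>Partial fractions for even primitive characters\<close>

text \<open>Logarithmic differentiation of the reflection formula for the Gamma function expresses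
  the cotangent by \<open>Digamma (1 - z) - Digamma z\<close>. In the difference of the two Digamma
  series the harmonic terms and Euler's constant cancel.\<close>

lemma cot_partial_fractions:
  fixes z :: complex
  assumes z: "z \<notin> \<int>"
  shows "(\<lambda>k. 1 / (z + of_nat k) - 1 / (of_nat k + 1 - z)) sums (pi * cot (pi * z))"
proof -
  have z1: "1 - z \<notin> \<int>" using z by (metis Ints_1 Ints_diff diff_diff_eq2 add_diff_cancel_left')
  have nz: "z \<notin> \<int>\<^sub>\<le>\<^sub>0" "1 - z \<notin> \<int>\<^sub>\<le>\<^sub>0" using z z1 nonpos_Ints_Int by blast+
  have s: "sin (pi * z) \<noteq> 0" using z by (auto simp: sin_eq_0)
  have D1: "((\<lambda>z. Gamma z * Gamma (1 - z)) has_field_derivative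
              Gamma z * Gamma (1 - z) * (Digamma z - Digamma (1 - z))) (at z)"
    using nz by (auto intro!: derivative_eq_intros simp: algebra_simps)
  have D2: "((\<lambda>z. of_real pi / sin (of_real pi * z)) has_field_derivative
              - (pi / sin (pi * z)) * (pi * cot (pi * z))) (at z)"
    using s by (auto intro!: derivative_eq_intros simp: cot_def field_simps)
  have "(\<lambda>z::complex. Gamma z * Gamma (1 - z)) = (\<lambda>z. of_real pi / sin (of_real pi * z))"
    by (simp add: Gamma_reflection_complex fun_eq_iff)
  with D1 D2 have der: "Gamma z * Gamma (1 - z) * (Digamma z - Digamma (1 - z)) = - (pi / sin (pi * z)) * (pi * cot (pi * z))"
    using DERIV_unique by metis
  have eq: "Digamma (1 - z) - Digamma z = pi * cot (pi * z)"
  proof -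
    define P where "P = of_real pi / sin (of_real pi * z)"
    have "P \<noteq> 0" using s by (simp add: P_def)
    moreover have "P * (Digamma z - Digamma (1 - z)) = P * (- (pi * cot (pi * z)))"
      using der unfolding Gamma_reflection_complex P_def by simp
    ultimately have "Digamma z - Digamma (1 - z) = - (pi * cot (pi * z))"
      by (simp only: mult_cancel_left) simp
    thus ?thesis by (simp add: algebra_simps)
  qed
  have "(\<lambda>n. inverse (of_nat (Suc n)) - inverse (w + of_nat n)) sums (Digamma w + euler_mascheroni)"
    if "w \<notin> \<int>" for w :: complex
    using summable_Digamma[of w] that by (cases "w = 0") (auto simp: Digamma_def summable_sums)
  from sums_diff[OF this[OF z1] this[OF z]] show ?thesis
    by (simp add: eq inverse_eq_divide algebra_simps)
qed

text \<open>With E = exp(i pi a) the cotangent is rational in E squared, and the upper half-plane is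
  where E squared has modulus below 1. This is the exponential counterpart of the partial fraction
  expansion.\<close>

lemma cot_geometric:
  fixes a :: complex
  assumes "Im a > 0"
  shows "(\<lambda>n. exp (2 * pi * \<i> * a) ^ Suc n) sums ((\<i> * cot (pi * a) - 1) / 2)"
proof -
  define E where "E = exp (\<i> * (pi * a))"
  have E2: "exp (2 * pi * \<i> * a) = E ^ 2" by (simp add: E_def exp_double[symmetric] algebra_simps)
  have nE: "norm (E ^ 2) < 1" using assms unfolding E2[symmetric] by simp
  have E0: "E \<noteq> 0" by (simp add: E_def)
  have E1: "E ^ 2 \<noteq> 1" using nE by auto
  have Ei: "exp (- (\<i> * (pi * a))) = 1 / E" by (simp add: E_def exp_minus inverse_eq_divide)
  have "\<i> * cot (pi * a) = (E + 1 / E) / (1 / E - E)"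
  proof -
    have c: "cos (pi * a) = (E + 1 / E) / 2" unfolding cos_exp_eq using Ei by (simp add: E_def)
    have s: "sin (pi * a) = \<i> * (1 / E - E) / 2" unfolding sin_exp_eq using Ei by (simp add: E_def field_simps)
    have "1 / E - E \<noteq> 0" using E0 E1 by (simp add: field_simps power2_eq_square)
    hence "\<i> * (A / 2 / (\<i> * (1 / E - E) / 2)) = A / (1 / E - E)" for A by simp
    thus ?thesis unfolding cot_def c s .
  qed
  also have "\<dots> = (1 + E\<^sup>2) / (1 - E\<^sup>2)"
    using E0 E1 by (simp add: field_simps power2_eq_square)
  finally have c: "\<i> * cot (pi * a) = (1 + E\<^sup>2) / (1 - E\<^sup>2)" .
  have "(\<i> * cot (pi * a) - 1) / 2 = E\<^sup>2 * (1 / (1 - E\<^sup>2))"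
    unfolding c using E1 by (simp add: field_simps)
  hence "(\<lambda>n. E\<^sup>2 * E\<^sup>2 ^ n) sums ((\<i> * cot (pi * a) - 1) / 2)"
    using sums_mult[OF geometric_sums[OF nE], of "E^2"] by (simp only:)
  thus ?thesis unfolding E2 by simp
qed

lemma even_char_sum_reflect:
  assumes "dirichlet_char q chi" "even_char q chi" "q > 1"
  shows "(\<Sum>h<q. chi h * g (q - h)) = (\<Sum>h<q. chi h * g h)"
proof -
  have chi0: "chi 0 = 0" using assms dirichlet_char_eq_0_iff[of q chi 0] by auto
  have S: "{..<q} = insert 0 {1..<q}" using assms by auto
  have "(\<Sum>h\<in>{1..<q}. chi h * g (q - h)) = (\<Sum>h\<in>{1..<q}. chi h * g h)"
    by (rule sum.reindex_bij_witness[of _ "\<lambda>h. q - h" "\<lambda>h. q - h"])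
       (auto simp: even_char_reflect[OF assms(1,2)])
  thus ?thesis unfolding S by (simp add: chi0)
qed

lemma summable_inverse_square_shift:
  fixes c :: "nat \<Rightarrow> complex"
  assumes "\<And>n. norm (c n) \<le> 1" "U > 0"
  shows "summable (\<lambda>m. norm (c m * of_real (U / (U\<^sup>2 + real m ^ 2))))"
proof (rule summable_comparison_test'[where N = 1])
  show "summable (\<lambda>m. U * (1 / real m ^ 2))"
    using inverse_power_summable[of 2, where ?'a = real] by (intro summable_mult) (simp add: inverse_eq_divide)
  fix m :: nat assume m: "m \<ge> 1"
  have pos: "U\<^sup>2 + real m ^ 2 > 0" using assms by (simp add: add_pos_nonneg)
  have "norm (c m) * (U / (U\<^sup>2 + real m ^ 2)) \<le> 1 * (U / real m ^ 2)"
    using assms m pos by (intro mult_mono assms frac_le) auto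
  thus "norm (norm (c m * of_real (U / (U\<^sup>2 + real m ^ 2)))) \<le> U * (1 / real m ^ 2)"
    using assms pos unfolding norm_mult norm_of_real by simp
qed

text \<open>Both sides are evaluations of the same finite sum of
  \<open>chi h * cot (pi * a h)\<close> over residues: the geometric series together with
  separability give the left side, partial fractions regrouped into blocks of length
  \<open>q\<close> give the right side.\<close>

theorem even_char_exp_sum:
  assumes prim: "primitive_char q chi" and ev: "even_char q chi" and q1: "q > 1" and u: "u > 0"
  shows "(\<lambda>n. cnj (chi (Suc n)) * of_real (exp (- (2 * pi * real (Suc n) * u)))) sums
           (of_nat q / (pi * gauss_sum q chi) *
             (\<Sum>m. chi (Suc m) * of_real ((q * u) / ((q * u)\<^sup>2 + real (Suc m) ^ 2))))"
proof -
  have chi: "dirichlet_char q chi" using prim by (simp add: primitive_char_def)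
  define U where "U = real q * u"
  have U: "U > 0" using q1 u by (simp add: U_def)
  \<comment> \<open>The real part \<open>h / q\<close> produces the root of unity and the imaginary
    part \<open>u\<close> the damping, so that the \<open>n\<close>-th power of
    \<open>exp (2 * pi * \<i> * a h)\<close> splits into these two factors.\<close>
  define a where "a h = (of_nat h + \<i> * of_real U) / of_nat q" for h :: nat
  have a_Im: "Im (a h) = u" for h using q1 by (simp add: a_def U_def)
  have a_Int: "a h \<notin> \<int>" for h
    using a_Im[of h] u by (auto elim!: Ints_cases)
  define f where "f m = chi m * of_real (U / (U\<^sup>2 + real m ^ 2))" for m
  have chi0: "chi 0 = 0" using q1 dirichlet_char_eq_0_iff[OF chi, of 0] by auto
  have fs: "summable f"
    unfolding f_def by (rule summable_norm_cancel[OF summable_inverse_square_shift])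
       (use norm_dirichlet_char_le[OF chi] U in auto)
  \<comment> \<open>Write m = kq + h. The first fraction equals q / (m + iU); the second, after the
    reflection of \<open>h\<close> to \<open>q - h\<close> allowed by evenness, equals q / (m - iU).
    Their difference is -2iqU / (U^2 + m^2).\<close>
  have block: "(\<Sum>m\<in>{k * q..<k * q + q}. f m) =
          \<i> / (2 * of_nat q) * (\<Sum>h<q. chi h * (1 / (a h + of_nat k) - 1 / (of_nat k + 1 - a h)))" for k
  proof -
    let ?K = "of_nat (k * q) :: complex"
    have nz1: "?K + of_nat h + \<i> * of_real U \<noteq> 0" for h using U by (auto simp: complex_eq_iff)
    have nz2: "?K + of_nat h - \<i> * of_real U \<noteq> 0" for h using U by (auto simp: complex_eq_iff)
    have t1: "1 / (a h + of_nat k) = of_nat q / (?K + of_nat h + \<i> * of_real U)" for h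
      using q1 by (simp add: a_def field_simps)
    have t2: "1 / (of_nat k + 1 - a h) = of_nat q / (?K + of_nat (q - h) - \<i> * of_real U)" if "h < q" for h
      using q1 that by (simp add: a_def field_simps of_nat_diff)
    have "(\<Sum>h<q. chi h * (1 / (a h + of_nat k) - 1 / (of_nat k + 1 - a h))) =
          (\<Sum>h<q. chi h * (of_nat q / (?K + of_nat h + \<i> * of_real U))) -
          (\<Sum>h<q. chi h * (of_nat q / (?K + of_nat (q - h) - \<i> * of_real U)))"
      by (simp add: t1 t2 sum_subtractf[symmetric] right_diff_distrib)
    also have "(\<Sum>h<q. chi h * (of_nat q / (?K + of_nat (q - h) - \<i> * of_real U))) =
          (\<Sum>h<q. chi h * (of_nat q / (?K + of_nat h - \<i> * of_real U)))"
      by (rule even_char_sum_reflect[OF chi ev q1])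
    finally have "(\<Sum>h<q. chi h * (1 / (a h + of_nat k) - 1 / (of_nat k + 1 - a h))) =
       (\<Sum>h<q. chi h * (of_nat q / (?K + of_nat h + \<i> * of_real U) - of_nat q / (?K + of_nat h - \<i> * of_real U)))"
      by (simp add: sum_subtractf[symmetric] right_diff_distrib)
    also have "\<dots> = (\<Sum>h<q. - 2 * \<i> * of_nat q * f (h + k * q))"
    proof (rule sum.cong)
      fix h
      have sq: "of_real (U\<^sup>2 + real (h + k * q) ^ 2) = (?K + of_nat h + \<i> * of_real U) * (?K + of_nat h - \<i> * of_real U)"
        by (simp add: algebra_simps power2_eq_square)
      have "of_nat q / (?K + of_nat h + \<i> * of_real U) - of_nat q / (?K + of_nat h - \<i> * of_real U) =
          - 2 * \<i> * of_nat q * (of_real U / ((?K + of_nat h + \<i> * of_real U) * (?K + of_nat h - \<i> * of_real U)))"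
        using nz1[of h] nz2[of h] by (simp add: divide_simps) (simp add: algebra_simps)
      hence "of_nat q / (?K + of_nat h + \<i> * of_real U) - of_nat q / (?K + of_nat h - \<i> * of_real U) =
          - 2 * \<i> * of_nat q * of_real (U / (U\<^sup>2 + real (h + k * q) ^ 2))"
        unfolding of_real_divide sq .
      thus "chi h * (of_nat q / (?K + of_nat h + \<i> * of_real U) - of_nat q / (?K + of_nat h - \<i> * of_real U)) =
          - 2 * \<i> * of_nat q * f (h + k * q)"
        by (simp add: f_def dirichlet_char_periodic[OF chi])
    qed simp
    also have "\<dots> = - 2 * \<i> * of_nat q * (\<Sum>h<q. f (h + k * q))" by (simp add: sum_distrib_left)
    also have "(\<Sum>h<q. f (h + k * q)) = (\<Sum>m\<in>{k * q..<k * q + q}. f m)"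
      by (rule sum.reindex_bij_witness[of _ "\<lambda>m. m - k * q" "\<lambda>h. h + k * q"]) auto
    finally show ?thesis using q1 by (simp add: field_simps)
  qed
  have "(\<lambda>k. \<Sum>m\<in>{k * q..<k * q + q}. f m) sums suminf f"
    using q1 by (intro sums_group summable_sums fs) auto
  moreover have "(\<lambda>k. \<i> / (2 * of_nat q) * (\<Sum>h<q. chi h * (1 / (a h + of_nat k) - 1 / (of_nat k + 1 - a h)))) sums
        (\<i> / (2 * of_nat q) * (\<Sum>h<q. chi h * (pi * cot (pi * a h))))"
    by (intro sums_mult sums_sum cot_partial_fractions a_Int)
  ultimately have S: "suminf f = \<i> / (2 * of_nat q) * (\<Sum>h<q. chi h * (pi * cot (pi * a h)))"
    unfolding block by (rule sums_unique2)
  have ex: "exp (2 * pi * \<i> * a h) ^ n = root_e q (h * n) * of_real (exp (- (2 * pi * real n * u)))" for h n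
  proof -
    have "of_nat n * (2 * pi * \<i> * a h) = 2 * pi * \<i> * of_nat (h * n) / of_nat q + of_real (- (2 * pi * real n * u))"
      using q1 by (simp add: a_def U_def field_simps)
    thus ?thesis by (simp only: exp_of_nat_mult[symmetric] exp_add exp_of_real[symmetric])
  qed
  have "(\<lambda>n. \<Sum>h<q. chi h * exp (2 * pi * \<i> * a h) ^ Suc n) sums
        (\<Sum>h<q. chi h * ((\<i> * cot (pi * a h) - 1) / 2))"
    by (intro sums_sum sums_mult cot_geometric) (simp add: a_Im u)
  also have "(\<lambda>n. \<Sum>h<q. chi h * exp (2 * pi * \<i> * a h) ^ Suc n) =
       (\<lambda>n. gauss_sum q chi * (cnj (chi (Suc n)) * of_real (exp (- (2 * pi * real (Suc n) * u)))))"
  proof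
    fix n
    have "(\<Sum>h<q. chi h * exp (2 * pi * \<i> * a h) ^ Suc n) =
       (\<Sum>h<q. chi h * root_e q (h * Suc n)) * of_real (exp (- (2 * pi * real (Suc n) * u)))"
      unfolding ex sum_distrib_right by (simp only: mult.assoc)
    thus "(\<Sum>h<q. chi h * exp (2 * pi * \<i> * a h) ^ Suc n) =
      gauss_sum q chi * (cnj (chi (Suc n)) * of_real (exp (- (2 * pi * real (Suc n) * u))))"
      unfolding gauss_sum_separable[OF prim q1] by simp
  qed
  also have "(\<Sum>h<q. chi h * ((\<i> * cot (pi * a h) - 1) / 2)) = of_nat q / pi * suminf f"
  proof -
    have "(\<Sum>h<q. chi h * ((\<i> * cot (pi * a h) - 1) / 2)) =
        (\<Sum>h<q. \<i> / 2 * (chi h * cot (pi * a h)) - chi h / 2)"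
      by (intro sum.cong) (auto simp: field_simps)
    also have "\<dots> = \<i> / 2 * (\<Sum>h<q. chi h * cot (pi * a h)) - (\<Sum>h<q. chi h) / 2"
      by (simp add: sum_subtractf sum_distrib_left sum_divide_distrib)
    \<comment> \<open>The constants -1/2 from the geometric series cancel because the character sums
      to 0 over a period.\<close>
    also have "\<dots> = \<i> / 2 * (\<Sum>h<q. chi h * cot (pi * a h))"
      using sum_primitive_char[OF prim q1] by simp
    also have "\<dots> = of_nat q / pi * suminf f"
    proof -
      have "(\<Sum>h<q. chi h * (pi * cot (pi * a h))) = pi * (\<Sum>h<q. chi h * cot (pi * a h))"
        by (simp add: sum_distrib_left mult.left_commute)
      thus ?thesis unfolding S using q1 by (simp add: field_simps)
    qed
    finally show ?thesis .
  qed
  finally have *: "(\<lambda>n. gauss_sum q chi * (cnj (chi (Suc n)) * of_real (exp (- (2 * pi * real (Suc n) * u))))) sums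
       (of_nat q / pi * suminf f)" .
  have "suminf f = (\<Sum>m. f (Suc m))" using suminf_split_head[OF fs] by (simp add: f_def chi0)
  with sums_mult[OF *, of "1 / gauss_sum q chi"]
  have "(\<lambda>n. 1 / gauss_sum q chi * (gauss_sum q chi * (cnj (chi (Suc n)) * of_real (exp (- (2 * pi * real (Suc n) * u))))))
          sums (1 / gauss_sum q chi * (of_nat q / pi * (\<Sum>m. f (Suc m))))" by (simp only:)
  moreover have "1 / gauss_sum q chi * (gauss_sum q chi * z) = z" for z
    using gauss_sum_nonzero[OF prim q1] by simp
  moreover have "1 / gauss_sum q chi * (of_real (real q / pi) * z) = of_nat q / (pi * gauss_sum q chi) * z" for z
    by simp
  ultimately show ?thesis unfolding f_def U_def by (simp only:)
qed

section \<open>Analytic continuation of Dirichlet L-functions\<close>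

text \<open>
  Repeated summation by parts against periodic antidifferences of mean zero replaces \<open>n\<^bsup>-s\<^esup>\<close> by its
  \<open>k\<close>-th difference, which is \<open>O(n\<^bsup>-Re s-k\<^esup>)\<close>; this continues the Dirichlet series to \<open>Re s > 1 - k\<close>.
\<close>

primrec fdiff :: "nat \<Rightarrow> (complex \<Rightarrow> complex) \<Rightarrow> complex \<Rightarrow> complex" where
  "fdiff 0 f z = f z"
| "fdiff (Suc k) f z = fdiff k (\<lambda>w. f w - f (w + 1)) z"

text \<open>The recursion in the definition differences the argument function, which suits the
  induction on derivatives; summation by parts needs the difference taken on the outside.\<close>

lemma fdiff_Suc_outer: "fdiff (Suc k) f z = fdiff k f z - fdiff k f (z + 1)"
proof (induction k arbitrary: f z)
  case (Suc k)
  let ?g = "\<lambda>w. f w - f (w + 1)"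
  have "fdiff (Suc (Suc k)) f z = fdiff (Suc k) ?g z" by (rule fdiff.simps)
  also have "\<dots> = fdiff k ?g z - fdiff k ?g (z + 1)" by (rule Suc.IH)
  also have "\<dots> = fdiff (Suc k) f z - fdiff (Suc k) f (z + 1)" by (simp only: fdiff.simps)
  finally show ?case .
qed simp

text \<open>\<open>D i\<close> stands for the \<open>i\<close>-th derivative of \<open>D 0\<close>
  along the ray to the right of \<open>z\<close>. Each unit difference costs one derivative by the
  mean value inequality on a segment of length 1, so \<open>k\<close> differences are controlled by
  the \<open>k\<close>-th derivative.\<close>

lemma norm_fdiff_le:
  assumes "\<And>i t. i < k \<Longrightarrow> t \<ge> 0 \<Longrightarrow> (D i has_field_derivative D (Suc i) (z + of_real t)) (at (z + of_real t))"
    and "\<And>t. t \<ge> 0 \<Longrightarrow> norm (D k (z + of_real t)) \<le> B"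
  shows "norm (fdiff k (D 0) z) \<le> B"
  using assms
proof (induction k arbitrary: D)
  case 0
  show ?case using 0(2)[of 0] by simp
next
  case (Suc k)
  \<comment> \<open>Differencing commutes with differentiation, so \<open>E\<close> is the
    derivative chain of the first difference and the induction hypothesis applies to it, its top
    derivative being bounded through \<open>D (Suc k)\<close>.\<close>
  define E where "E i w = D i w - D i (w + 1)" for i w
  have shift: "z + of_real t + 1 = z + of_real (t + 1)" for t by (simp add: add.assoc)
  have "norm (fdiff k (E 0) z) \<le> B"
  proof (rule Suc.IH)
    fix i t assume i: "i < k" and t: "(t::real) \<ge> 0"
    have d1: "(D i has_field_derivative D (Suc i) (z + of_real t)) (at (z + of_real t))"
      using Suc.prems(1)[of i t] i t by simp
    have "(D i has_field_derivative D (Suc i) (z + of_real t + 1)) (at (z + of_real t + 1))"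
      unfolding shift using Suc.prems(1)[of i "t + 1"] i t by simp
    hence "((\<lambda>w. D i (w + 1)) has_field_derivative D (Suc i) (z + of_real t + 1)) (at (z + of_real t))"
      using DERIV_at_within_shift[of "D i" "D (Suc i) (z + of_real t + 1)" 1 "z + of_real t" UNIV]
      by (simp add: add.commute)
    thus "(E i has_field_derivative E (Suc i) (z + of_real t)) (at (z + of_real t))"
      unfolding E_def by (intro DERIV_diff d1)
  next
    fix t :: real assume t: "t \<ge> 0"
    let ?S = "closed_segment (z + of_real t) (z + of_real t + 1)"
    have S: "\<exists>u\<ge>0. w = z + of_real u" if "w \<in> ?S" for w
    proof -
      from that obtain v where "w = (1 - v) *\<^sub>R (z + of_real t) + v *\<^sub>R (z + of_real t + 1)" "0 \<le> v" "v \<le> 1"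
        by (auto simp: closed_segment_def)
      thus ?thesis using t by (intro exI[of _ "t + v"]) (auto simp: scaleR_conv_of_real algebra_simps)
    qed
    have "norm (D k (z + of_real t) - D k (z + of_real t + 1)) \<le> B * norm (z + of_real t - (z + of_real t + 1))"
    proof (rule field_differentiable_bound[of ?S])
      fix w assume "w \<in> ?S"
      then obtain u where u: "u \<ge> 0" "w = z + of_real u" using S by blast
      show "(D k has_field_derivative D (Suc k) w) (at w within ?S)"
        using Suc.prems(1)[of k u] u by (auto intro: DERIV_subset)
      show "norm (D (Suc k) w) \<le> B" using Suc.prems(2)[of u] u by simp
    qed auto
    thus "norm (E k (z + of_real t)) \<le> B" by (simp add: E_def)
  qed
  moreover have "E 0 = (\<lambda>w. D 0 w - D 0 (w + 1))" by (simp add: E_def fun_eq_iff)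
  ultimately show ?case by simp
qed

lemma has_field_derivative_powr_chain:
  assumes "Re z > 0"
  shows "((\<lambda>w. (-1) ^ i * pochhammer s i * w powr (- s - of_nat i)) has_field_derivative
            (-1) ^ Suc i * pochhammer s (Suc i) * z powr (- s - of_nat (Suc i))) (at z)"
proof -
  have "z \<notin> \<real>\<^sub>\<le>\<^sub>0" using assms by (auto simp: complex_nonpos_Reals_iff)
  hence "((\<lambda>w. w powr (- s - of_nat i)) has_field_derivative
      (- s - of_nat i) * z powr (- s - of_nat i - 1)) (at z)"
    by (rule has_field_derivative_powr)
  from DERIV_cmult[OF this, of "(-1) ^ i * pochhammer s i"] show ?thesis
    by (simp add: pochhammer_Suc algebra_simps)
qed

lemma norm_fdiff_powr_le:
  assumes "Re s + real k \<ge> 0"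
  shows "norm (fdiff k (\<lambda>z. z powr (- s)) (of_nat (Suc n))) \<le>
          norm (pochhammer s k) * real (Suc n) powr (- (Re s + real k))"
proof -
  define D where "D i z = (-1) ^ i * pochhammer s i * z powr (- s - of_nat i)" for i and z :: complex
  have "norm (fdiff k (D 0) (of_nat (Suc n))) \<le> norm (pochhammer s k) * real (Suc n) powr (- (Re s + real k))"
  proof (rule norm_fdiff_le)
    fix i and t :: real assume "t \<ge> 0"
    thus "(D i has_field_derivative D (Suc i) (of_nat (Suc n) + of_real t)) (at (of_nat (Suc n) + of_real t))"
      unfolding D_def by (intro has_field_derivative_powr_chain) auto
  next
    fix t :: real assume t: "t \<ge> 0"
    have eq: "of_nat (Suc n) + of_real t = complex_of_real (real (Suc n) + t)" by simp
    have "norm (D k (of_nat (Suc n) + of_real t)) = norm (pochhammer s k) * (real (Suc n) + t) powr (- (Re s + real k))"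
      unfolding D_def eq norm_mult using t by (subst norm_powr_real_powr) (auto simp: norm_power)
    also have "\<dots> \<le> norm (pochhammer s k) * real (Suc n) powr (- (Re s + real k))"
      using t assms by (intro mult_left_mono powr_mono2') auto
    finally show "norm (D k (of_nat (Suc n) + of_real t)) \<le> norm (pochhammer s k) * real (Suc n) powr (- (Re s + real k))" .
  qed
  moreover have "D 0 = (\<lambda>z. z powr (- s))" by (simp add: D_def fun_eq_iff)
  ultimately show ?thesis by simp
qed

lemma fdiff_tendsto_0:
  assumes "(\<lambda>n. f (of_nat (Suc n))) \<longlonglongrightarrow> 0"
  shows "(\<lambda>n. fdiff k f (of_nat (Suc n))) \<longlonglongrightarrow> 0"
proof (induction k)
  case (Suc k)
  have "(\<lambda>n. fdiff k f (of_nat (Suc n)) - fdiff k f (of_nat (Suc (Suc n)))) \<longlonglongrightarrow> 0 - 0"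
    by (intro tendsto_diff Suc LIMSEQ_Suc[OF Suc])
  thus ?case by (simp add: fdiff_Suc_outer add_ac del: fdiff.simps)
qed (use assms in simp)

lemma holomorphic_on_fdiff:
  assumes "\<And>z. (\<lambda>s. F s z) holomorphic_on S"
  shows "(\<lambda>s. fdiff k (F s) z) holomorphic_on S"
  by (induction k arbitrary: z)
     (use assms in \<open>auto simp: fdiff_Suc_outer simp del: fdiff.simps(2) intro!: holomorphic_intros\<close>)

lemma holomorphic_on_powr_exponent:
  fixes z :: complex assumes "f holomorphic_on S"
  shows "(\<lambda>s. z powr (f s)) holomorphic_on S"
  unfolding powr_def using assms by (cases "z = 0") (auto intro!: holomorphic_intros)

text \<open>Abel summation; the upper boundary term disappears because \<open>B\<close> is bounded
  and \<open>g\<close> tends to 0, and the lower one survives as \<open>B 0 * g 1\<close>.\<close>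

lemma sums_summation_by_parts:
  fixes g B :: "nat \<Rightarrow> complex"
  assumes s: "(\<lambda>n. (B (Suc n) - B n) * g (Suc n)) sums S"
    and g: "g \<longlonglongrightarrow> 0" and B: "\<And>n. norm (B n) \<le> C"
  shows "(\<lambda>n. B (Suc n) * (g (Suc n) - g (Suc (Suc n)))) sums (S + B 0 * g 1)"
proof -
  have eq: "(\<Sum>n<m. B (Suc n) * (g (Suc n) - g (Suc (Suc n)))) =
        (\<Sum>n<m. (B (Suc n) - B n) * g (Suc n)) + B 0 * g 1 - B m * g (Suc m)" for m
    by (induction m) (simp_all add: algebra_simps)
  have "(\<lambda>m. B m * g (Suc m)) \<longlonglongrightarrow> 0"
  proof (rule Lim_null_comparison[where g = "\<lambda>m. C * norm (g (Suc m))"])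
    show "(\<lambda>m. C * norm (g (Suc m))) \<longlonglongrightarrow> 0"
      by (intro tendsto_mult_right_zero tendsto_norm_zero LIMSEQ_Suc[OF g])
  qed (use B in \<open>auto simp: norm_mult intro!: always_eventually mult_right_mono\<close>)
  from tendsto_diff[OF tendsto_add[OF s[unfolded sums_def] tendsto_const[of "B 0 * g 1"]] this]
  show ?thesis unfolding sums_def eq by simp
qed

text \<open>The class of coefficient sequences that is stable under passing to an antidifference:
  mean zero keeps the partial sums periodic, hence bounded.\<close>

definition periodic_mean0 :: "nat \<Rightarrow> (nat \<Rightarrow> complex) \<Rightarrow> bool" where
  "periodic_mean0 q a \<longleftrightarrow> q > 0 \<and> (\<forall>n. a (n + q) = a n) \<and> (\<Sum>j<q. a j) = 0"

lemma periodic_mean0_bounded: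
  assumes "periodic_mean0 q a" shows "norm (a n) \<le> (\<Sum>j<q. norm (a j))"
proof -
  have q: "q > 0" using assms by (simp add: periodic_mean0_def)
  have "a (m + k * q) = a m" for m k
  proof (induction k)
    case (Suc k)
    have "a (m + Suc k * q) = a ((m + k * q) + q)" by (simp add: algebra_simps)
    also have "\<dots> = a (m + k * q)" using assms unfolding periodic_mean0_def by blast
    finally show ?case using Suc by simp
  qed simp
  from this[of "n mod q" "n div q"] have "a n = a (n mod q)" by simp
  moreover have "norm (a (n mod q)) \<le> (\<Sum>j<q. norm (a j))"
    using q by (intro member_le_sum) auto
  ultimately show ?thesis by simp
qed

lemma periodic_mean0_antidifference:
  assumes "periodic_mean0 q a"
  obtains B where "periodic_mean0 q B" "\<And>n. B (Suc n) - B n = a (Suc n)"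
proof -
  have q: "q > 0" and per: "a (n + q) = a n" and mean: "(\<Sum>j<q. a j) = 0" for n
    using assms by (auto simp: periodic_mean0_def)
  define S where "S n = (\<Sum>j<n. a (Suc j))" for n
  have "S q + a 0 = (\<Sum>j<Suc q. a j)" unfolding S_def by (subst sum.lessThan_Suc_shift) simp
  also have "\<dots> = a 0" using per[of 0] mean by simp
  finally have Sq: "S q = 0" by simp
  have Sper: "S (n + q) = S n" for n
  proof (induction n)
    case (Suc n)
    have "S (Suc n + q) = S (n + q) + a (Suc n + q)" by (simp add: S_def)
    thus ?case using Suc per[of "Suc n"] by (simp add: S_def)
  qed (use Sq in \<open>simp add: S_def\<close>)
  \<comment> \<open>Subtracting the average restores mean zero, so that the construction can be
    repeated.\<close>
  define B where "B n = S n - (\<Sum>j<q. S j) / of_nat q" for n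
  have "periodic_mean0 q B"
    using q Sper by (auto simp: periodic_mean0_def B_def sum_subtractf)
  moreover have "B (Suc n) - B n = a (Suc n)" for n by (simp add: B_def S_def)
  ultimately show thesis by (rule that)
qed

lemma powr_minus_tendsto_0:
  assumes "Re s > 0" shows "(\<lambda>n. of_nat (Suc n) powr (- s) :: complex) \<longlonglongrightarrow> 0"
proof (rule tendsto_norm_zero_cancel)
  have "(\<lambda>n. real n powr (- Re s)) \<longlonglongrightarrow> 0"
    using assms by (intro tendsto_neg_powr filterlim_real_sequentially) auto
  hence "(\<lambda>n. real (Suc n) powr (- Re s)) \<longlonglongrightarrow> 0" by (rule LIMSEQ_Suc)
  thus "(\<lambda>n. norm (of_nat (Suc n) powr (- s) :: complex)) \<longlonglongrightarrow> 0"
    using norm_powr_real_powr[of "of_nat (Suc _)" "- s"] by simp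
qed

text \<open>\<open>B\<close> and the boundary coefficients \<open>c\<close> are chosen before
  \<open>s\<close>, so the identity relates functions of \<open>s\<close>: the correction is a
  finite combination of entire functions.\<close>

lemma dirichlet_series_by_parts:
  assumes "periodic_mean0 q a"
  shows "\<exists>B c. periodic_mean0 q B \<and> (\<forall>s. Re s > 1 \<longrightarrow>
           (\<lambda>n. B (Suc n) * fdiff k (\<lambda>z. z powr (- s)) (of_nat (Suc n))) sums
             ((\<Sum>n. a (Suc n) * of_nat (Suc n) powr (- s)) + (\<Sum>j<k. c j * fdiff j (\<lambda>z. z powr (- s)) 1)))"
proof (induction k)
  case 0
  have "(\<lambda>n. a (Suc n) * of_nat (Suc n) powr (- s)) sums (\<Sum>n. a (Suc n) * of_nat (Suc n) powr (- s))"
    if "Re s > 1" for s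
  proof -
    let ?C = "\<Sum>j<q. norm (a j)"
    have "summable (\<lambda>n. real (Suc n) powr (- Re s))"
      using that summable_real_powr_iff[of "- Re s"] summable_Suc_iff[of "\<lambda>n. real n powr (- Re s)"] by auto
    hence sC: "summable (\<lambda>n. ?C * real (Suc n) powr (- Re s))" by (rule summable_mult)
    have "norm (a (Suc n) * of_nat (Suc n) powr (- s)) \<le> ?C * real (Suc n) powr (- Re s)" for n
      unfolding norm_mult using norm_powr_real_powr[of "of_nat (Suc n)" "- s"]
      by (intro mult_mono periodic_mean0_bounded[OF assms]) (auto intro!: sum_nonneg)
    hence "summable (\<lambda>n. a (Suc n) * of_nat (Suc n) powr (- s))"
      by (intro summable_comparison_test'[OF sC, of 0])
    thus ?thesis by (rule summable_sums)
  qed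
  thus ?case using assms by (intro exI[of _ a]) auto
next
  case (Suc k)
  then obtain B c where Bc: "periodic_mean0 q B \<and> (\<forall>s. Re s > 1 \<longrightarrow>
    (\<lambda>n. B (Suc n) * fdiff k (\<lambda>z. z powr (- s)) (of_nat (Suc n))) sums
       ((\<Sum>n. a (Suc n) * of_nat (Suc n) powr (- s)) + (\<Sum>j<k. c j * fdiff j (\<lambda>z. z powr (- s)) 1)))"
    by (elim exE)
  note B = conjunct1[OF Bc] and sums = conjunct2[OF Bc, rule_format]
  obtain A where A: "periodic_mean0 q A" "\<And>n. A (Suc n) - A n = B (Suc n)"
    using periodic_mean0_antidifference[OF B] by blast
  \<comment> \<open>The one new boundary term of this summation by parts has coefficient
    \<open>A 0\<close>; the earlier coefficients stay.\<close>
  have "(\<lambda>n. A (Suc n) * fdiff (Suc k) (\<lambda>z. z powr (- s)) (of_nat (Suc n))) sums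
       ((\<Sum>n. a (Suc n) * of_nat (Suc n) powr (- s)) + (\<Sum>j<Suc k. (c(k := A 0)) j * fdiff j (\<lambda>z. z powr (- s)) 1))"
    if s: "Re s > 1" for s
  proof -
    define g where "g n = fdiff k (\<lambda>z. z powr (- s)) (of_nat n)" for n
    have "(\<lambda>n. g (Suc n)) \<longlonglongrightarrow> 0" unfolding g_def
      by (rule fdiff_tendsto_0[OF powr_minus_tendsto_0]) (use s in simp)
    hence g0: "g \<longlonglongrightarrow> 0" by (rule LIMSEQ_imp_Suc)
    have "(\<lambda>n. (A (Suc n) - A n) * g (Suc n)) sums
       ((\<Sum>n. a (Suc n) * of_nat (Suc n) powr (- s)) + (\<Sum>j<k. c j * fdiff j (\<lambda>z. z powr (- s)) 1))"
      unfolding A(2) g_def by (rule sums[OF s])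
    from sums_summation_by_parts[OF this g0 periodic_mean0_bounded[OF A(1)]]
    show ?thesis unfolding fdiff_Suc_outer by (simp add: g_def add_ac)
  qed
  thus ?case using A(1) by (intro exI[of _ A] exI[of _ "c(k := A 0)"] conjI allI impI)
qed

lemma dirichlet_series_continuation_halfplane:
  assumes "periodic_mean0 q a"
  shows "\<exists>F. F holomorphic_on {s. Re s > 1 - real k} \<and>
           (\<forall>s. Re s > 1 \<longrightarrow> F s = (\<Sum>n. a (Suc n) * of_nat (Suc n) powr (- s)))"
proof -
  obtain B c where B: "periodic_mean0 q B" and
    sums: "\<And>s. Re s > 1 \<Longrightarrow> (\<lambda>n. B (Suc n) * fdiff k (\<lambda>z. z powr (- s)) (of_nat (Suc n))) sums
       ((\<Sum>n. a (Suc n) * of_nat (Suc n) powr (- s)) + (\<Sum>j<k. c j * fdiff j (\<lambda>z. z powr (- s)) 1))"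
    using dirichlet_series_by_parts[OF assms, of k] by blast
  define C where "C = (\<Sum>j<q. norm (B j))"
  have C: "norm (B n) \<le> C" for n unfolding C_def by (rule periodic_mean0_bounded[OF B])
  define T where "T n s = B (Suc n) * fdiff k (\<lambda>z. z powr (- s)) (of_nat (Suc n))" for n s
  define F where "F s = (\<Sum>\<^sub>\<infinity>n. T n s) - (\<Sum>j<k. c j * fdiff j (\<lambda>z. z powr (- s)) 1)" for s
  have hol_fd: "(\<lambda>s. fdiff j (\<lambda>z. z powr (- s)) z) holomorphic_on S" for j z S
    by (intro holomorphic_on_fdiff holomorphic_on_powr_exponent holomorphic_intros)
  have summ: "summable (\<lambda>n. K * real (Suc n) powr (- e))" if "e > 1" for e K
      using that summable_real_powr_iff[of "- e"] summable_Suc_iff[of "\<lambda>n. real n powr (- e)"]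
      by (intro summable_mult) auto
  have bound: "norm (T n s) \<le> C * norm (pochhammer s k) * real (Suc n) powr (- e)"
    if "Re s + real k \<ge> e" "e > 1" for n s e
  proof -
    have "norm (T n s) \<le> C * (norm (pochhammer s k) * real (Suc n) powr (- (Re s + real k)))"
      unfolding T_def norm_mult using that
      by (intro mult_mono C norm_fdiff_powr_le) (auto intro: order.trans[OF norm_ge_zero C])
    also have "\<dots> \<le> C * (norm (pochhammer s k) * real (Suc n) powr (- e))"
      using that by (intro mult_left_mono powr_mono) (auto intro: order.trans[OF norm_ge_zero C])
    finally show ?thesis by simp
  qed
  have "(\<lambda>s. \<Sum>\<^sub>\<infinity>n. T n s) holomorphic_on {s. Re s > 1 - real k}"
  proof (rule holomorphic_on_infsum)
    show "open {s. Re s > 1 - real k}" by (rule open_halfspace_Re_gt)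
    show "T n holomorphic_on {s. Re s > 1 - real k}" for n
      unfolding T_def by (intro holomorphic_intros hol_fd)
    fix s assume "s \<in> {s. Re s > 1 - real k}"
    hence s: "Re s > 1 - real k" by simp
    \<comment> \<open>Half the distance to the boundary line: on the disc the exponent
      \<open>Re w + real k\<close> stays at least \<open>1 + r\<close>, which gives one summable
      power for all \<open>w\<close>.\<close>
    define r where "r = (Re s + real k - 1) / 2"
    have r: "r > 0" using s by (simp add: r_def)
    have Re: "Re w + real k \<ge> 1 + r" if "w \<in> cball s r" for w
      using abs_Re_le_cmod[of "s - w"] that by (auto simp: dist_norm r_def field_simps)
    have "compact ((\<lambda>w. pochhammer w k) ` cball s r)"
      by (intro compact_continuous_image) (auto simp: pochhammer_prod intro!: continuous_intros)
    then obtain P where P: "\<And>w. w \<in> cball s r \<Longrightarrow> norm (pochhammer w k) \<le> P"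
      by (meson bounded_iff compact_imp_bounded imageI)
    show "\<exists>r>0. \<exists>M. cball s r \<subseteq> {s. Re s > 1 - real k} \<and> M summable_on UNIV \<and>
                 (\<forall>n\<in>UNIV. \<forall>w\<in>cball s r. norm (T n w) \<le> M n)"
    proof (intro exI[of _ r] exI[of _ "\<lambda>n. C * P * real (Suc n) powr (- (1 + r))"] conjI ballI)
      show "cball s r \<subseteq> {s. Re s > 1 - real k}" using Re r by force
      have P0: "P \<ge> 0" using P[of s] r by (auto intro: order.trans[OF norm_ge_zero])
      have C0: "C \<ge> 0" using order.trans[OF norm_ge_zero C] .
      show "(\<lambda>n. C * P * real (Suc n) powr (- (1 + r))) summable_on UNIV"
        using summ[of "1 + r" "C * P"] r P0 C0 by (intro summable_nonneg_imp_summable_on) auto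
      fix n w assume w: "w \<in> cball s r"
      have "norm (T n w) \<le> C * norm (pochhammer w k) * real (Suc n) powr (- (1 + r))"
        using bound[of "1 + r" w n] Re[OF w] r by simp
      also have "\<dots> \<le> C * P * real (Suc n) powr (- (1 + r))"
        using P[OF w] C0 by (intro mult_right_mono mult_left_mono) auto
      finally show "norm (T n w) \<le> C * P * real (Suc n) powr (- (1 + r))" .
    qed (use r in auto)
  qed
  hence "F holomorphic_on {s. Re s > 1 - real k}"
    unfolding F_def by (intro holomorphic_intros hol_fd)
  moreover have "F s = (\<Sum>n. a (Suc n) * of_nat (Suc n) powr (- s))" if s: "Re s > 1" for s
  proof -
    have "summable (\<lambda>n. norm (T n s))"
      by (rule summable_comparison_test'[OF summ[of "Re s + real k" "C * norm (pochhammer s k)"], of 0])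
         (use s bound[of "Re s + real k" s] in auto)
    hence "(\<Sum>\<^sub>\<infinity>n. T n s) = (\<Sum>n. T n s)"
      by (metis norm_summable_imp_has_sum summable_norm_cancel summable_sums infsumI)
    also have "\<dots> = (\<Sum>n. a (Suc n) * of_nat (Suc n) powr (- s)) + (\<Sum>j<k. c j * fdiff j (\<lambda>z. z powr (- s)) 1)"
      unfolding T_def by (rule sums_unique[symmetric, OF sums[OF s]])
    finally show ?thesis by (simp add: F_def)
  qed
  ultimately show ?thesis by blast
qed

lemma halfplane_unique_continuation:
  assumes "f holomorphic_on {s. Re s > a}" "g holomorphic_on {s. Re s > a}" "a \<le> 1"
    and "\<And>s. Re s > 1 \<Longrightarrow> f s = g s" "Re s > a"
  shows "f s = g s"
proof (rule analytic_continuation_open[of "{s. Re s > 1}" "{s. Re s > a}" f g])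
  show "{s. Re s > 1} \<noteq> {}" by (rule ex_in_conv[THEN iffD1]) (auto intro: exI[of _ 2])
qed (use assms in \<open>auto intro: open_halfspace_Re_gt convex_connected convex_halfspace_Re_gt\<close>)

text \<open>The half-plane continuations agree wherever two of them are defined, since they agree
  for \<open>Re s > 1\<close>. Hence the function glued by a pointwise choice of half-plane
  coincides near each point with a single one of them.\<close>

lemma dirichlet_series_entire:
  assumes "periodic_mean0 q a"
  shows "\<exists>L. L holomorphic_on UNIV \<and>
           (\<forall>s. Re s > 1 \<longrightarrow> L s = (\<Sum>n. a (Suc n) * of_nat (Suc n) powr (- s)))"
proof -
  obtain F where hol: "\<And>k. F k holomorphic_on {s. Re s > 1 - real k}"
    and eq: "\<And>k s. Re s > 1 \<Longrightarrow> F k s = (\<Sum>n. a (Suc n) * of_nat (Suc n) powr (- s))"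
    using dirichlet_series_continuation_halfplane[OF assms] by metis
  \<comment> \<open>Rounding \<open>2 - Re s\<close> up rather than \<open>1 - Re s\<close> gives
    the strict inequality needed for an open half-plane.\<close>
  define K where "K s = nat \<lceil>2 - Re s\<rceil>" for s
  have K: "Re s > 1 - real (K s)" for s unfolding K_def by linarith
  define L where "L s = F (K s) s" for s
  have agree: "F j s = F k s" if "Re s > 1 - real j" "Re s > 1 - real k" for j k s
  proof (rule halfplane_unique_continuation[of "F j" "max (1 - real j) (1 - real k)" "F k" s])
    show "F j holomorphic_on {s. Re s > max (1 - real j) (1 - real k)}"
      by (rule holomorphic_on_subset[OF hol[of j]]) auto
    show "F k holomorphic_on {s. Re s > max (1 - real j) (1 - real k)}"
      by (rule holomorphic_on_subset[OF hol[of k]]) auto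
  qed (use that eq in auto)
  have "L field_differentiable at s" for s
  proof -
    have "F (K s) field_differentiable at s"
      using holomorphic_on_imp_differentiable_at[OF hol[of "K s"], of s] K[of s]
      by (simp add: open_halfspace_Re_gt)
    moreover have "eventually (\<lambda>w. Re w > 1 - real (K s)) (nhds s)"
      using K[of s] open_halfspace_Re_gt[of "1 - real (K s)"] by (auto simp: eventually_nhds)
    hence "eventually (\<lambda>w. F (K s) w = L w) (nhds s)"
      by (rule eventually_mono) (unfold L_def, rule agree[OF _ K])
    from DERIV_cong_ev[OF refl this refl]
    have "(F (K s) has_field_derivative D) (at s) \<longleftrightarrow> (L has_field_derivative D) (at s)" for D .
    ultimately show ?thesis unfolding field_differentiable_def by simp
  qed
  hence "L holomorphic_on UNIV" by (auto simp: holomorphic_on_def field_differentiable_at_within)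
  thus ?thesis using eq by (auto simp: L_def)
qed

text \<open>\<open>dirichlet_L\<close> is a definite description, so nothing can be said about it
  before existence and uniqueness are established. Uniqueness at \<open>s\<close> follows by
  continuation in a half-plane containing both \<open>s\<close> and the region of
  convergence.\<close>

lemma dirichlet_L_props:
  assumes "periodic_mean0 q chi"
  shows "dirichlet_L chi holomorphic_on UNIV"
    and "Re s > 1 \<Longrightarrow> dirichlet_L chi s = (\<Sum>n. chi (Suc n) * of_nat (Suc n) powr (- s))"
proof -
  let ?P = "\<lambda>f. f holomorphic_on UNIV \<and> (\<forall>s. Re s > 1 \<longrightarrow> f s = (\<Sum>n. chi (Suc n) / of_nat (Suc n) powr s))"
  have D: "(\<Sum>n. chi (Suc n) / of_nat (Suc n) powr s) = (\<Sum>n. chi (Suc n) * of_nat (Suc n) powr (- s))" for s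
    by (simp add: powr_minus_divide)
  obtain L where L: "?P L" using dirichlet_series_entire[OF assms] unfolding D by blast
  have "\<exists>!f. ?P f"
  proof (rule ex1I[of _ L])
    fix f assume f: "?P f"
    show "f = L"
    proof
      fix s
      show "f s = L s"
      proof (rule halfplane_unique_continuation[of f "min 1 (Re s - 1)" L])
        show "f holomorphic_on {s'. Re s' > min 1 (Re s - 1)}" using f holomorphic_on_subset by blast
        show "L holomorphic_on {s'. Re s' > min 1 (Re s - 1)}" using L holomorphic_on_subset by blast
      qed (use f L in auto)
    qed
  qed (rule L)
  hence "?P (dirichlet_L chi)" unfolding dirichlet_L_def by (rule theI')
  hence "dirichlet_L chi holomorphic_on UNIV \<and>
      (\<forall>s. Re s > 1 \<longrightarrow> dirichlet_L chi s = (\<Sum>n. chi (Suc n) * of_nat (Suc n) powr (- s)))"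
    unfolding D .
  thus "dirichlet_L chi holomorphic_on UNIV"
    "Re s > 1 \<Longrightarrow> dirichlet_L chi s = (\<Sum>n. chi (Suc n) * of_nat (Suc n) powr (- s))"
    by blast+
qed

section \<open>Integral representations\<close>

lemma has_sum_product:
  fixes f :: "'a \<Rightarrow> complex" and g :: "'b \<Rightarrow> complex"
  assumes f: "(\<lambda>a. norm (f a)) summable_on UNIV" and g: "(\<lambda>b. norm (g b)) summable_on UNIV"
  shows "((\<lambda>(a,b). f a * g b) has_sum ((\<Sum>\<^sub>\<infinity>a. f a) * (\<Sum>\<^sub>\<infinity>b. g b))) UNIV"
    and "(\<lambda>(a,b). norm (f a) * norm (g b)) summable_on UNIV"
proof -
  have abs: "(\<lambda>x. norm ((\<lambda>(a,b). f a * g b) x)) summable_on (UNIV \<times> UNIV)"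
    by (rule Infinite_Sum.abs_summable_on_Sigma_iff[THEN iffD2])
       (auto simp: norm_mult infsum_cmult_right g abs_mult infsum_nonneg intro!: summable_on_cmult_right summable_on_cmult_left f g)
  hence sm: "(\<lambda>(a,b). f a * g b) summable_on (UNIV \<times> UNIV)"
    by (rule abs_summable_summable)
  have "(\<Sum>\<^sub>\<infinity>(a,b)\<in>UNIV\<times>UNIV. f a * g b) = (\<Sum>\<^sub>\<infinity>a. \<Sum>\<^sub>\<infinity>b. f a * g b)"
    using infsum_Sigma'_banach[OF sm] by simp
  also have "\<dots> = (\<Sum>\<^sub>\<infinity>a. f a) * (\<Sum>\<^sub>\<infinity>b. g b)"
    by (simp add: infsum_cmult_right' infsum_cmult_left')
  finally show "((\<lambda>(a,b). f a * g b) has_sum ((\<Sum>\<^sub>\<infinity>a. f a) * (\<Sum>\<^sub>\<infinity>b. g b))) UNIV"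
    using has_sum_infsum[OF sm] by simp
  show "(\<lambda>(a,b). norm (f a) * norm (g b)) summable_on UNIV"
    using abs by (simp add: case_prod_unfold norm_mult)
qed

lemma integrable_exp_neg_abs:
  assumes "c > 0" shows "integrable lborel (\<lambda>w::real. exp (- (c * \<bar>w\<bar>)))"
proof -
  have "(\<lambda>x. exp (- (c * x))) absolutely_integrable_on {0..}"
    by (rule nonnegative_absolutely_integrable_1)
       (use has_integral_exp_minus_to_infinity[OF assms, of 0] in \<open>auto simp: integrable_on_def\<close>)
  hence "set_integrable lborel {0..} (\<lambda>x. exp (- (c * x)))"
    unfolding set_integrable_def
    by (subst (asm) integrable_completion) auto
  hence "integrable lborel (\<lambda>x. indicator {0..} x *\<^sub>R exp (- (c * \<bar>x\<bar>)))"
    unfolding set_integrable_def by (rule Bochner_Integration.integrable_cong[THEN iffD1, rotated 2]) (auto simp: indicator_def)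
  from has_bochner_integral_even_function[OF has_bochner_integral_integrable[OF this]]
  show ?thesis by (simp add: has_bochner_integral_iff)
qed

section \<open>Two-sided exponential integrals and the Bessel function\<close>

lemma exp_minus_le_fact_div_power:
  fixes u :: real assumes "u > 0" shows "exp (- u) \<le> fact K / u ^ K"
proof -
  have s: "(\<lambda>n. u ^ n / fact n) sums exp u"
    using exp_converges[of u] by (simp add: field_simps)
  have "u ^ K / fact K \<le> exp u"
    using sum_le_suminf[OF sums_summable[OF s], of "{K}"] sums_unique[OF s] assms by auto
  thus ?thesis using assms by (simp add: exp_minus field_simps)
qed

text \<open>For \<open>w \<ge> 0\<close> the second exponential has no decay in \<open>w\<close>,
  and extracting \<open>1 / m\<^sup>2\<close> from it costs a factor \<open>exp (2 * w)\<close>. The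
  first one yields \<open>exp (- (K * w))\<close> for any \<open>K\<close>; the choice
  \<open>K \<ge> R + 3\<close> pays for this factor and for \<open>exp (R * w)\<close> and leaves
  \<open>exp (- w)\<close>.\<close>

lemma exp_two_sided_bound_half:
  fixes \<alpha> \<beta> R :: real
  assumes "\<alpha> > 0" "\<beta> > 0" "R \<ge> 0"
  shows "\<exists>C\<ge>0. \<forall>w d m. w \<ge> 0 \<longrightarrow> d \<ge> 1 \<longrightarrow> m \<ge> 1 \<longrightarrow>
     exp (R * w) * exp (- (\<alpha> * d * exp w + \<beta> * m * exp (- w))) \<le> C * (1 / (d\<^sup>2 * m\<^sup>2)) * exp (- w)"
proof -
  define K where "K = nat \<lceil>R\<rceil> + 3"
  have K: "real K \<ge> R + 3" "K \<ge> 2" by (auto simp: K_def) linarith+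
  define C where "C = fact K * 2 / (\<alpha> ^ K * \<beta>\<^sup>2)"
  have "exp (R * w) * exp (- (\<alpha> * d * exp w + \<beta> * m * exp (- w))) \<le> C * (1 / (d\<^sup>2 * m\<^sup>2)) * exp (- w)"
    if w: "w \<ge> 0" and d: "d \<ge> 1" and m: "m \<ge> 1" for w d m
  proof -
    have "exp (- (\<alpha> * d * exp w)) \<le> fact K / (\<alpha> * d * exp w) ^ K"
      using assms d by (intro exp_minus_le_fact_div_power) auto
    also have "\<dots> = fact K / (\<alpha> ^ K * d ^ K) * exp (- (real K * w))"
      by (simp add: power_mult_distrib exp_of_nat_mult[symmetric] exp_minus field_simps)
    also have "\<dots> \<le> fact K / (\<alpha> ^ K * d\<^sup>2) * exp (- (real K * w))"
      using assms d K by (intro mult_right_mono divide_left_mono mult_left_mono power_increasing) auto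
    finally have 1: "exp (- (\<alpha> * d * exp w)) \<le> fact K / (\<alpha> ^ K * d\<^sup>2) * exp (- (real K * w))" .
    have "exp (- (\<beta> * m * exp (- w))) \<le> fact 2 / (\<beta> * m * exp (- w)) ^ 2"
      using assms m by (intro exp_minus_le_fact_div_power) auto
    also have "\<dots> = 2 / (\<beta>\<^sup>2 * m\<^sup>2) * exp (2 * w)"
      by (simp add: power_mult_distrib exp_double[symmetric] exp_minus field_simps)
    finally have 2: "exp (- (\<beta> * m * exp (- w))) \<le> 2 / (\<beta>\<^sup>2 * m\<^sup>2) * exp (2 * w)" .
    have "exp (R * w) * exp (- (\<alpha> * d * exp w + \<beta> * m * exp (- w))) =
        exp (R * w) * (exp (- (\<alpha> * d * exp w)) * exp (- (\<beta> * m * exp (- w))))"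
      by (simp add: exp_add[symmetric])
    also have "\<dots> \<le> exp (R * w) * ((fact K / (\<alpha> ^ K * d\<^sup>2) * exp (- (real K * w))) * (2 / (\<beta>\<^sup>2 * m\<^sup>2) * exp (2 * w)))"
      using assms d m by (intro mult_left_mono mult_mono 1 2) auto
    also have "\<dots> = C * (1 / (d\<^sup>2 * m\<^sup>2)) * (exp (R * w) * exp (- (real K * w)) * exp (2 * w))"
      by (simp add: C_def ac_simps)
    also have "exp (R * w) * exp (- (real K * w)) * exp (2 * w) = exp ((R + 2 - real K) * w)"
      by (simp add: exp_add[symmetric] algebra_simps)
    also have "C * (1 / (d\<^sup>2 * m\<^sup>2)) * exp ((R + 2 - real K) * w) \<le> C * (1 / (d\<^sup>2 * m\<^sup>2)) * exp (- w)"
    proof (intro mult_left_mono)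
      have "(R + 2 - real K) * w \<le> (- 1) * w" using w K by (intro mult_right_mono) auto
      thus "exp ((R + 2 - real K) * w) \<le> exp (- w)" by simp
    qed (use assms in \<open>auto simp: C_def\<close>)
    finally show ?thesis .
  qed
  moreover have "C \<ge> 0" using assms by (simp add: C_def)
  ultimately show ?thesis by blast
qed

text \<open>Negative \<open>w\<close> is reduced to positive \<open>w\<close> by exchanging
  \<open>\<alpha>, d\<close> with \<open>\<beta>, m\<close>.\<close>

lemma exp_two_sided_bound:
  fixes \<alpha> \<beta> R :: real
  assumes "\<alpha> > 0" "\<beta> > 0" "R \<ge> 0"
  shows "\<exists>C\<ge>0. \<forall>w d m. d \<ge> 1 \<longrightarrow> m \<ge> 1 \<longrightarrow>
     exp (R * \<bar>w\<bar>) * exp (- (\<alpha> * d * exp w + \<beta> * m * exp (- w))) \<le> C * (1 / (d\<^sup>2 * m\<^sup>2)) * exp (- \<bar>w\<bar>)"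
proof -
  obtain C1 where C1: "C1 \<ge> 0" "\<And>w d m. w \<ge> 0 \<Longrightarrow> d \<ge> 1 \<Longrightarrow> m \<ge> 1 \<Longrightarrow>
     exp (R * w) * exp (- (\<alpha> * d * exp w + \<beta> * m * exp (- w))) \<le> C1 * (1 / (d\<^sup>2 * m\<^sup>2)) * exp (- w)"
    using exp_two_sided_bound_half[OF assms] by blast
  obtain C2 where C2: "C2 \<ge> 0" "\<And>w d m. w \<ge> 0 \<Longrightarrow> d \<ge> 1 \<Longrightarrow> m \<ge> 1 \<Longrightarrow>
     exp (R * w) * exp (- (\<beta> * d * exp w + \<alpha> * m * exp (- w))) \<le> C2 * (1 / (d\<^sup>2 * m\<^sup>2)) * exp (- w)"
    using exp_two_sided_bound_half[OF assms(2,1,3)] by blast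
  have "exp (R * \<bar>w\<bar>) * exp (- (\<alpha> * d * exp w + \<beta> * m * exp (- w))) \<le> (C1 + C2) * (1 / (d\<^sup>2 * m\<^sup>2)) * exp (- \<bar>w\<bar>)"
    if d: "d \<ge> 1" and m: "m \<ge> 1" for w d m
  proof (cases "w \<ge> 0")
    case True
    have "C1 * (1 / (d\<^sup>2 * m\<^sup>2)) * exp (- w) \<le> (C1 + C2) * (1 / (d\<^sup>2 * m\<^sup>2)) * exp (- w)"
      using C2 by (intro mult_right_mono) auto
    thus ?thesis using C1(2)[OF True d m] True by simp
  next
    case False
    have "C2 * (1 / (m\<^sup>2 * d\<^sup>2)) * exp (- \<bar>w\<bar>) \<le> (C1 + C2) * (1 / (m\<^sup>2 * d\<^sup>2)) * exp (- \<bar>w\<bar>)"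
      using C1 by (intro mult_right_mono) auto
    with C2(2)[of "\<bar>w\<bar>" m d] False d m
    have "exp (R * \<bar>w\<bar>) * exp (- (\<beta> * m * exp \<bar>w\<bar> + \<alpha> * d * exp (- \<bar>w\<bar>))) \<le> (C1 + C2) * (1 / (m\<^sup>2 * d\<^sup>2)) * exp (- \<bar>w\<bar>)"
      by simp
    thus ?thesis using False by (simp add: add.commute mult.commute[of "m\<^sup>2"])
  qed
  thus ?thesis using C1(1) C2(1) by (intro exI[of _ "C1 + C2"]) auto
qed

lemma integrable_exp_two_sided:
  fixes \<nu> :: complex and a b :: real
  assumes "a > 0" "b > 0"
  shows "integrable lborel (\<lambda>w::real. exp (\<nu> * of_real w) * of_real (exp (- (a * exp w + b * exp (- w)))))"
proof -
  obtain C where C': "\<forall>w d m. d \<ge> 1 \<longrightarrow> m \<ge> 1 \<longrightarrow>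
     exp (norm \<nu> * \<bar>w\<bar>) * exp (- (a * d * exp w + b * m * exp (- w))) \<le> C * (1 / (d\<^sup>2 * m\<^sup>2)) * exp (- \<bar>w\<bar>)"
    using exp_two_sided_bound[OF assms, of "norm \<nu>"] by auto
  have C: "exp (norm \<nu> * \<bar>w\<bar>) * exp (- (a * 1 * exp w + b * 1 * exp (- w))) \<le> C * (1 / (1\<^sup>2 * 1\<^sup>2)) * exp (- \<bar>w\<bar>)" for w
    using C'[rule_format, of 1 1 w] by simp
  show ?thesis
  proof (rule Bochner_Integration.integrable_bound[OF integrable_mult_right[OF integrable_exp_neg_abs[of 1], of C]])
    show "AE w in lborel. norm (exp (\<nu> * of_real w) * of_real (exp (- (a * exp w + b * exp (- w))))) \<le> norm (C * exp (- (1 * \<bar>w\<bar>)))"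
    proof (rule AE_I2)
      fix w :: real
      have "Re \<nu> * w \<le> norm \<nu> * \<bar>w\<bar>"
        using abs_ge_self[of "Re \<nu> * w"] mult_right_mono[OF abs_Re_le_cmod[of \<nu>], of "\<bar>w\<bar>"]
        by (simp add: abs_mult)
      hence "norm (exp (\<nu> * of_real w) * of_real (exp (- (a * exp w + b * exp (- w))))) \<le>
         exp (norm \<nu> * \<bar>w\<bar>) * exp (- (a * exp w + b * exp (- w)))"
        unfolding norm_mult norm_of_real by (intro mult_mono) auto
      also have "\<dots> \<le> norm (C * exp (- (1 * \<bar>w\<bar>)))"
        using C[of w] by simp
      finally show "norm (exp (\<nu> * of_real w) * of_real (exp (- (a * exp w + b * exp (- w))))) \<le> norm (C * exp (- (1 * \<bar>w\<bar>)))" .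
    qed
  qed auto
qed

text \<open>The exponential splits into cosh and sinh. The even part contributes twice the half-line
  integral that defines \<open>besselK\<close>, the odd part contributes 0.\<close>

lemma integral_exp_cosh_eq_besselK:
  fixes \<nu> :: complex and z :: real
  assumes "z > 0"
  shows "(\<integral>t. exp (\<nu> * of_real t) * of_real (exp (- z * cosh t)) \<partial>lborel) = 2 * besselK \<nu> z"
proof -
  define F where "F \<mu> t = exp (\<mu> * of_real t) * of_real (exp (- z * cosh t))" for \<mu> :: complex and t :: real
  have int: "integrable lborel (F \<mu>)" for \<mu>
    using integrable_exp_two_sided[of "z/2" "z/2" \<mu>] assms
    by (simp add: F_def[abs_def] cosh_def algebra_simps)
  define G where "G t = of_real (exp (- z * cosh t)) * cosh (\<nu> * of_real t)" for t :: real
  define H where "H t = of_real (exp (- z * cosh t)) * sinh (\<nu> * of_real t)" for t :: real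
  have G: "G t = (F \<nu> t + F (-\<nu>) t) / 2" for t by (simp add: G_def F_def cosh_def scaleR_conv_of_real field_simps)
  have H: "H t = (F \<nu> t - F (-\<nu>) t) / 2" for t by (simp add: H_def F_def sinh_def scaleR_conv_of_real field_simps)
  have intG: "integrable lborel G" unfolding G[abs_def] by (intro integrable_divide Bochner_Integration.integrable_add int)
  have intH: "integrable lborel H" unfolding H[abs_def] by (intro integrable_divide Bochner_Integration.integrable_diff int)
  have setG: "set_integrable lborel {0..} G"
    unfolding set_integrable_def using intG by (intro integrable_mult_indicator) auto
  have setH: "set_integrable lborel {0..} H"
    unfolding set_integrable_def using intH by (intro integrable_mult_indicator) auto
  have K: "besselK \<nu> z = (\<integral>t. indicator {0..} t *\<^sub>R G t \<partial>lborel)"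
    using set_borel_integral_eq_integral(2)[OF setG] unfolding besselK_def G_def[abs_def] set_lebesgue_integral_def by simp
  have "has_bochner_integral lborel G (2 *\<^sub>R (\<integral>t. indicator {0..} t *\<^sub>R G t \<partial>lborel))"
    using setG unfolding set_integrable_def
    by (intro has_bochner_integral_even_function has_bochner_integral_integrable) (auto simp: G_def)
  moreover have "has_bochner_integral lborel H 0"
    using setH unfolding set_integrable_def
    by (intro has_bochner_integral_odd_function[OF has_bochner_integral_integrable]) (auto simp: H_def)
  ultimately have "has_bochner_integral lborel (\<lambda>t. G t + H t) (2 * besselK \<nu> z)"
    unfolding K by (drule_tac has_bochner_integral_add) (assumption, simp add: scaleR_conv_of_real)
  moreover have "G t + H t = F \<nu> t" for t unfolding G H by (simp add: field_simps)
  ultimately show ?thesis by (simp add: F_def has_bochner_integral_iff)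
qed

lemma integral_exp_two_sided_eq_besselK:
  fixes \<nu> :: complex and a b :: real
  assumes "a > 0" "b > 0"
  shows "(\<integral>w. exp (\<nu> * of_real w) * of_real (exp (- (a * exp w + b * exp (- w)))) \<partial>lborel) =
           2 * of_real (b / a) powr (\<nu> / 2) * besselK \<nu> (2 * sqrt (a * b))"
proof -
  \<comment> \<open>The translation that balances the two exponentials: both
    \<open>a * exp c\<close> and \<open>b * exp (- c)\<close> become
    \<open>sqrt (a * b)\<close>.\<close>
  define c where "c = ln (b / a) / 2"
  have "exp (2 * c) = b / a" using assms by (simp add: c_def)
  hence ec: "exp c ^ 2 = b / a" by (simp add: exp_double)
  hence ec': "exp c = sqrt (b / a)" by (metis exp_ge_zero real_sqrt_unique)
  have A: "a * exp c = sqrt (a * b)" using assms unfolding ec'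
    by (simp add: real_sqrt_divide real_sqrt_mult) (metis real_div_sqrt less_imp_le mult.commute times_divide_eq_left)
  have B: "b * exp (- c) = sqrt (a * b)" using assms unfolding exp_minus ec'
    by (simp add: real_sqrt_divide real_sqrt_mult field_simps)
  have "(\<integral>w. exp (\<nu> * of_real w) * of_real (exp (- (a * exp w + b * exp (- w)))) \<partial>lborel) =
     (\<integral>t. exp (\<nu> * of_real (c + 1 * t)) * of_real (exp (- (a * exp (c + 1 * t) + b * exp (- (c + 1 * t))))) \<partial>lborel)"
    by (subst lborel_integral_real_affine[of 1 _ c]) auto
  also have "\<dots> = (\<integral>t. exp (\<nu> * of_real c) * (exp (\<nu> * of_real t) * of_real (exp (- (2 * sqrt (a * b)) * cosh t))) \<partial>lborel)"
  proof (rule Bochner_Integration.integral_cong[OF refl])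
    fix t :: real
    have "a * exp (c + 1 * t) + b * exp (- (c + 1 * t)) = (a * exp c) * exp t + (b * exp (- c)) * exp (- t)"
      using exp_add[of c t] exp_add[of "- c" "- t"] by (simp add: algebra_simps)
    also have "\<dots> = 2 * sqrt (a * b) * cosh t" unfolding A B by (simp add: cosh_def field_simps)
    finally have *: "a * exp (c + 1 * t) + b * exp (- (c + 1 * t)) = 2 * sqrt (a * b) * cosh t" .
    show "exp (\<nu> * of_real (c + 1 * t)) * of_real (exp (- (a * exp (c + 1 * t) + b * exp (- (c + 1 * t))))) =
      exp (\<nu> * of_real c) * (exp (\<nu> * of_real t) * of_real (exp (- (2 * sqrt (a * b)) * cosh t)))"
      unfolding * by (simp add: exp_add ring_distribs)
  qed
  also have "\<dots> = exp (\<nu> * of_real c) * (2 * besselK \<nu> (2 * sqrt (a * b)))"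
    using assms by (simp only: integral_mult_right_zero) (subst integral_exp_cosh_eq_besselK, auto)
  also have "exp (\<nu> * of_real c) = of_real (b / a) powr (\<nu> / 2)"
  proof -
    have "Ln (complex_of_real (b / a)) = of_real (ln (b / a))" using assms by (intro Ln_of_real) auto
    thus ?thesis using assms unfolding powr_def c_def by (simp add: field_simps)
  qed
  finally show ?thesis by simp
qed

section \<open>The Beta integral and the integral of the rational kernel\<close>

lemma set_integrable_Beta:
  fixes a b :: real
  assumes "a > 0" "b > 0"
  shows "set_integrable lborel {0<..<1} (\<lambda>t. t powr (a - 1) * (1 - t) powr (b - 1))"
    and "(LINT t:{0<..<1}|lborel. t powr (a - 1) * (1 - t) powr (b - 1)) = Beta a b"
proof -
  define f where "f t = t powr (a - 1) * (1 - t) powr (b - 1)" for t :: real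
  have "(f has_integral Beta a b) {0<..<1}"
    using has_integral_Beta_real[OF assms] unfolding f_def by (simp add: has_integral_Icc_iff_Ioo)
  hence hi: "((\<lambda>t. indicator {0<..<1} t *\<^sub>R f t) has_integral Beta a b) UNIV"
    by (subst (asm) has_integral_restrict_UNIV[symmetric])
       (erule has_integral_eq[rotated], simp add: indicator_def)
  have meas: "(\<lambda>t. indicator {0<..<1} t *\<^sub>R f t) \<in> borel_measurable borel" unfolding f_def by measurable
  have nn: "indicator {0<..<1} t *\<^sub>R f t \<ge> 0" for t by (simp add: f_def)
  have nni: "integral\<^sup>N lborel (\<lambda>t. indicator {0<..<1} t *\<^sub>R f t) = ennreal (Beta a b)"
    using nn_integral_has_integral_lborel[OF meas nn hi] .
  show si: "set_integrable lborel {0<..<1} (\<lambda>t. t powr (a - 1) * (1 - t) powr (b - 1))"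
    unfolding set_integrable_def f_def[symmetric]
    by (rule integrableI_nonneg) (use meas nn nni in auto)
  show "(LINT t:{0<..<1}|lborel. t powr (a - 1) * (1 - t) powr (b - 1)) = Beta a b"
    using has_integral_integral_lborel[OF si[unfolded set_integrable_def]] hi has_integral_unique
    unfolding set_lebesgue_integral_def f_def by blast
qed

text \<open>The substitution w = ln (t / (1 - t)) turns the integrand into that of Beta (s, 1 - s),
  which the reflection formula evaluates.\<close>

lemma logistic_integral:
  fixes s :: real
  assumes s: "0 < s" "s < 1"
  shows "has_bochner_integral lborel (\<lambda>w. exp (s * w) / (1 + exp w)) (pi / sin (pi * s))"
proof -
  define f where "f w = exp (s * w) / (1 + exp w)" for w :: real
  define g where "g t = ln t - ln (1 - t)" for t :: real
  define g' where "g' t = 1 / (t * (1 - t))" for t :: real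
  have fg: "f (g t) * g' t = t powr (s - 1) * (1 - t) powr (- s)" if t: "0 < t" "t < 1" for t
  proof -
    have e: "exp (g t) = t / (1 - t)" using t by (simp add: g_def exp_diff)
    have "exp (s * g t) = t powr s * (1 - t) powr (- s)"
      using t by (simp add: g_def powr_def exp_add[symmetric] algebra_simps)
    hence "f (g t) = t powr s * (1 - t) powr (- s) * (1 - t)"
      unfolding f_def e using t by (simp add: field_simps)
    thus ?thesis using t by (simp add: g'_def powr_diff)
  qed
  have ein: "einterval (ereal 0) (ereal 1) = {0<..<1::real}" by (auto simp: einterval_def)
  have UN: "einterval (-\<infinity>) \<infinity> = (UNIV :: real set)" by (auto simp: einterval_def)
  have si: "set_integrable lborel (einterval (ereal 0) (ereal 1)) (\<lambda>t. f (g t) * g' t)"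
    unfolding ein using set_integrable_Beta(1)[of s "1 - s"] s
    by (subst set_integrable_cong[OF refl refl, of _ _ "\<lambda>t. t powr (s - 1) * (1 - t) powr (- s)"]) (auto simp: fg)
  have lim0: "((ereal \<circ> g \<circ> real_of_ereal) \<longlongrightarrow> -\<infinity>) (at_right (ereal 0))"
  proof -
    have "filterlim g at_bot (at_right 0)" unfolding g_def by real_asymp
    thus ?thesis by (simp only: ereal_tendsto_simps)
  qed
  have lim1: "((ereal \<circ> g \<circ> real_of_ereal) \<longlongrightarrow> \<infinity>) (at_left (ereal 1))"
  proof -
    have "filterlim g at_top (at_left 1)" unfolding g_def by real_asymp
    thus ?thesis by (simp only: ereal_tendsto_simps)
  qed
  note sub = interval_integral_substitution_nonneg[of "ereal 0" "ereal 1" g g' f "-\<infinity>" \<infinity>, OF _ _ _ _ _ _ lim0 lim1 si]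
  have der: "DERIV g t :> g' t" if "ereal 0 < ereal t" "ereal t < ereal 1" for t
    using that unfolding g_def g'_def by (auto intro!: derivative_eq_intros simp: field_simps)
  have nz: "1 + exp w \<noteq> (0::real)" for w using exp_gt_zero[of w] by linarith
  have cf: "isCont f w" for w unfolding f_def[abs_def] using nz by (intro continuous_intros) auto
  have cg: "isCont g' t" if "0 < t" "t < 1" for t
    unfolding g'_def[abs_def] using that by (intro continuous_intros) auto
  have nn: "f w \<ge> 0" for w unfolding f_def using exp_gt_zero[of w] by simp
  have A: "set_integrable lborel (einterval (-\<infinity>) \<infinity>) f"
    by (rule sub(1)[OF _ der]) (auto simp: g'_def cf nn intro!: cg)
  have B: "(LBINT x=-\<infinity>..\<infinity>. f x) = (LBINT x=ereal 0..ereal 1. f (g x) * g' x)"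
    by (rule sub(2)[OF _ der]) (auto simp: g'_def cf nn intro!: cg)
  have "(LBINT x=ereal 0..ereal 1. f (g x) * g' x) = (LINT t:{0<..<1}|lborel. t powr (s - 1) * (1 - t) powr (- s))"
    unfolding interval_lebesgue_integral_def using ein by (auto intro!: set_lebesgue_integral_cong simp: fg)
  also have "\<dots> = Beta s (1 - s)" using set_integrable_Beta(2)[of s "1 - s"] s by simp
  also have "\<dots> = pi / sin (pi * s)"
  proof -
    have "complex_of_real (Gamma s * Gamma (1 - s)) = of_real (pi / sin (pi * s))"
      using Gamma_reflection_complex[of "of_real s"]
      by (simp add: Gamma_complex_of_real[symmetric] sin_of_real[symmetric])
    hence "Gamma s * Gamma (1 - s) = pi / sin (pi * s)" by (simp only: of_real_eq_iff)
    thus ?thesis by (simp add: Beta_def)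
  qed
  finally have "(LBINT x=-\<infinity>..\<infinity>. f x) = pi / sin (pi * s)" using B by simp
  hence "(\<integral>x. f x \<partial>lborel) = pi / sin (pi * s)"
    by (simp add: interval_lebesgue_integral_def UN set_lebesgue_integral_def)
  moreover have "integrable lborel f" using A by (simp add: UN set_integrable_def)
  ultimately show ?thesis by (simp add: has_bochner_integral_iff f_def[abs_def])
qed

lemma logistic_integral_scaled:
  fixes \<nu> a :: real
  assumes \<nu>: "0 < \<nu>" "\<nu> < 2" and a: "a > 0"
  shows "has_bochner_integral lborel (\<lambda>w. exp (\<nu> * w) * (a\<^sup>2 / (exp (2 * w) + a\<^sup>2)))
           (a powr \<nu> * (pi / (2 * sin (pi * \<nu> / 2))))"
proof -
  define f where "f w = exp (\<nu> / 2 * w) / (1 + exp w)" for w :: real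
  have f: "has_bochner_integral lborel f (pi / sin (pi * (\<nu> / 2)))"
    unfolding f_def using logistic_integral[of "\<nu> / 2"] \<nu> by simp
  define t where "t = - 2 * ln a"
  have "has_bochner_integral lborel (\<lambda>w. f (t + 2 * w)) ((pi / sin (pi * (\<nu> / 2))) /\<^sub>R \<bar>2\<bar>)"
    using f by (subst lborel_has_bochner_integral_real_affine_iff[of 2 f _ t, symmetric]) auto
  hence "has_bochner_integral lborel (\<lambda>w. a powr \<nu> * f (t + 2 * w)) (a powr \<nu> * ((pi / sin (pi * (\<nu> / 2))) /\<^sub>R \<bar>2\<bar>))"
    by (rule has_bochner_integral_mult_right)
  moreover have "a powr \<nu> * f (t + 2 * w) = exp (\<nu> * w) * (a\<^sup>2 / (exp (2 * w) + a\<^sup>2))" for w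
  proof -
    have 1: "exp (\<nu> / 2 * (t + 2 * w)) = exp (\<nu> * w) / a powr \<nu>"
      using a by (simp add: t_def powr_def exp_diff[symmetric] algebra_simps)
    have "exp t = 1 / a\<^sup>2"
      using a by (simp add: t_def exp_minus exp_double[of "ln a"] inverse_eq_divide)
    hence 2: "exp (t + 2 * w) = exp (2 * w) / a\<^sup>2" by (simp add: exp_add)
    have "1 + exp (2 * w) / a\<^sup>2 = (exp (2 * w) + a\<^sup>2) / a\<^sup>2" using a by (simp add: field_simps)
    thus ?thesis unfolding f_def 1 2 using a by simp
  qed
  ultimately show ?thesis by (simp add: field_simps)
qed

text \<open>Partial fractions in \<open>E = exp (2 * w)\<close>: the kernel is the difference of b^2
  / (E + b^2) and a^2 / (E + a^2), divided by b^2 - a^2. Each part is a rescaled logistic integral,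
  which is where \<open>0 < \<nu> < 2\<close> comes from.\<close>

lemma kernel_integral:
  fixes \<nu> a b :: real
  assumes \<nu>: "0 < \<nu>" "\<nu> < 2" and a: "a > 0" and b: "b > 0" and ab: "a \<noteq> b"
  shows "has_bochner_integral lborel (\<lambda>w. exp (\<nu> * w) * (exp (2 * w) / ((exp (2 * w) + a\<^sup>2) * (exp (2 * w) + b\<^sup>2))))
           (pi / (2 * sin (pi * \<nu> / 2)) * ((b powr \<nu> - a powr \<nu>) / (b\<^sup>2 - a\<^sup>2)))"
proof -
  have ne: "b\<^sup>2 - a\<^sup>2 \<noteq> 0" using a b ab by (simp add: power2_eq_iff_nonneg)
  have "has_bochner_integral lborel
     (\<lambda>w. (exp (\<nu> * w) * (b\<^sup>2 / (exp (2 * w) + b\<^sup>2)) - exp (\<nu> * w) * (a\<^sup>2 / (exp (2 * w) + a\<^sup>2))) / (b\<^sup>2 - a\<^sup>2))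
     ((b powr \<nu> * (pi / (2 * sin (pi * \<nu> / 2))) - a powr \<nu> * (pi / (2 * sin (pi * \<nu> / 2)))) / (b\<^sup>2 - a\<^sup>2))"
    by (intro has_bochner_integral_divide_zero has_bochner_integral_diff logistic_integral_scaled assms)
  moreover have "(e * (b\<^sup>2 / (E + b\<^sup>2)) - e * (a\<^sup>2 / (E + a\<^sup>2))) / (b\<^sup>2 - a\<^sup>2) = e * (E / ((E + a\<^sup>2) * (E + b\<^sup>2)))"
    if "E > 0" for e E :: real
  proof -
    have p: "E + a\<^sup>2 > 0" "E + b\<^sup>2 > 0" using that by (auto intro: add_pos_nonneg)
    have "b\<^sup>2 / (E + b\<^sup>2) - a\<^sup>2 / (E + a\<^sup>2) = (b\<^sup>2 - a\<^sup>2) * (E / ((E + a\<^sup>2) * (E + b\<^sup>2)))"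
      using p by (simp add: divide_simps) (simp add: algebra_simps)
    hence "e * (b\<^sup>2 / (E + b\<^sup>2)) - e * (a\<^sup>2 / (E + a\<^sup>2)) = (b\<^sup>2 - a\<^sup>2) * (e * (E / ((E + a\<^sup>2) * (E + b\<^sup>2))))"
      by (simp only: right_diff_distrib[symmetric] mult.left_commute)
    thus ?thesis using ne by simp
  qed
  moreover have "(b powr \<nu> * c - a powr \<nu> * c) / (b\<^sup>2 - a\<^sup>2) = c * ((b powr \<nu> - a powr \<nu>) / (b\<^sup>2 - a\<^sup>2))" for c
    by (simp add: algebra_simps)
  ultimately show ?thesis by (simp only: exp_gt_zero)
qed

section \<open>The Bessel series as an entire function\<close>

lemma of_real_powr_eq_exp: "r > 0 \<Longrightarrow> complex_of_real r powr s = exp (s * of_real (ln r))"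
  by (simp add: powr_def Ln_of_real)

lemma summable_on_inverse_powr_Suc:
  assumes "e > 1" shows "(\<lambda>n::nat. real (Suc n) powr (- e)) summable_on UNIV"
  using assms summable_real_powr_iff[of "- e"] summable_Suc_iff[of "\<lambda>n. real n powr (- e)"]
  by (intro summable_nonneg_imp_summable_on) auto

lemma summable_on_pairs_powr:
  assumes "e > 1" "e' > 1"
  shows "(\<lambda>(a,b). K * (real (Suc a) powr (- e) * real (Suc b) powr (- e'))) summable_on UNIV"
proof -
  have "(\<lambda>(a,b). norm (complex_of_real (real (Suc a) powr (- e))) * norm (complex_of_real (real (Suc b) powr (- e')))) summable_on UNIV"
    using assms by (intro has_sum_product(2)) (simp_all add: summable_on_inverse_powr_Suc del: of_nat_Suc)
  hence "(\<lambda>(a,b). real (Suc a) powr (- e) * real (Suc b) powr (- e')) summable_on UNIV" by simp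
  from summable_on_cmult_right[OF this, of K] show ?thesis by (simp add: case_prod_unfold)
qed

lemma norm_exp_mult_real_le:
  fixes \<nu> :: complex
  shows "norm (exp (\<nu> * of_real w)) \<le> exp (norm \<nu> * \<bar>w\<bar>)"
  using abs_ge_self[of "Re \<nu> * w"] mult_right_mono[OF abs_Re_le_cmod[of \<nu>], of "\<bar>w\<bar>"] by (simp add: abs_mult)

text \<open>Order and \<open>N\<close> are deliberately absent: the identities are statements about
  functions of \<open>\<nu>\<close>, to be continued analytically with characters and
  \<open>x\<close> fixed.\<close>

locale even_char_pair =
  fixes p q :: nat and chi1 chi2 :: "nat \<Rightarrow> complex" and x :: real
  assumes prim1: "primitive_char p chi1" and even1: "even_char p chi1" and p1: "p > 1"
    and prim2: "primitive_char q chi2" and even2: "even_char q chi2" and q1: "q > 1"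
    and x0: "x > 0" and nonint: "\<forall>m::nat. m > 0 \<longrightarrow> real (p * q) * x \<noteq> real m"
begin

lemma dchar1: "dirichlet_char p chi1" and dchar2: "dirichlet_char q chi2"
  using prim1 prim2 by (auto simp: primitive_char_def)

lemma norm_chi1_le: "norm (chi1 n) \<le> 1" and norm_chi2_le: "norm (chi2 n) \<le> 1"
  using norm_dirichlet_char_le dchar1 dchar2 by auto

lemma mean0_chi1: "periodic_mean0 p chi1"
  using sum_primitive_char[OF prim1 p1] dchar1 by (auto simp: periodic_mean0_def dirichlet_char_def)

lemma mean0_chi2: "periodic_mean0 q chi2"
  using sum_primitive_char[OF prim2 q1] dchar2 by (auto simp: periodic_mean0_def dirichlet_char_def)

definition exp_term :: "nat \<times> nat \<Rightarrow> real \<Rightarrow> complex" where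
  "exp_term = (\<lambda>(a,b) w. cnj (chi1 (Suc a)) * cnj (chi2 (Suc b)) *
          of_real (exp (- (2 * pi * real (Suc a) * exp w + 2 * pi * x * real (Suc b) * exp (- w)))))"

definition exp_double_sum :: "real \<Rightarrow> complex" where "exp_double_sum w = (\<Sum>\<^sub>\<infinity>i. exp_term i w)"

lemma exp_term_bound:
  assumes "R \<ge> 0"
  obtains C where "C \<ge> 0"
    "\<And>i w. exp (R * \<bar>w\<bar>) * norm (exp_term i w) \<le> (\<lambda>(a,b). C * (real (Suc a) powr (- 2) * real (Suc b) powr (- 2))) i * exp (- \<bar>w\<bar>)"
proof -
  obtain C where C: "C \<ge> 0" "\<forall>w d m. d \<ge> 1 \<longrightarrow> m \<ge> 1 \<longrightarrow>
     exp (R * \<bar>w\<bar>) * exp (- ((2 * pi) * d * exp w + (2 * pi * x) * m * exp (- w))) \<le> C * (1 / (d\<^sup>2 * m\<^sup>2)) * exp (- \<bar>w\<bar>)"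
    using exp_two_sided_bound[of "2 * pi" "2 * pi * x" R] x0 assms by auto
  have "exp (R * \<bar>w\<bar>) * norm (exp_term (a, b) w) \<le> C * (real (Suc a) powr (- 2) * real (Suc b) powr (- 2)) * exp (- \<bar>w\<bar>)" for a b w
  proof -
    have "norm (exp_term (a, b) w) \<le> 1 * exp (- (2 * pi * real (Suc a) * exp w + 2 * pi * x * real (Suc b) * exp (- w)))"
      unfolding exp_term_def prod.case norm_mult norm_of_real abs_exp_cancel complex_mod_cnj
      using mult_mono[OF norm_chi1_le norm_chi2_le, of "Suc b" "Suc a"] by (intro mult_right_mono) auto
    hence "exp (R * \<bar>w\<bar>) * norm (exp_term (a, b) w) \<le>
       exp (R * \<bar>w\<bar>) * exp (- (2 * pi * real (Suc a) * exp w + 2 * pi * x * real (Suc b) * exp (- w)))"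
      by (intro mult_left_mono) auto
    also have "\<dots> \<le> C * (1 / ((real (Suc a))\<^sup>2 * (real (Suc b))\<^sup>2)) * exp (- \<bar>w\<bar>)"
      by (rule C(2)[rule_format]) auto
    finally show ?thesis by (simp add: powr_minus powr_realpow divide_inverse del: of_nat_Suc)
  qed
  thus thesis using C(1) by (intro that[of C]) auto
qed

lemma exp_term_measurable [measurable]: "exp_term i \<in> borel_measurable borel"
  unfolding exp_term_def by (cases i) simp

lemma exp_double_sum_measurable: "exp_double_sum \<in> borel_measurable lborel"
  and exp_double_sum_integrable: "R > 0 \<Longrightarrow> integrable lborel (\<lambda>w. exp (R * \<bar>w\<bar>) * norm (exp_double_sum w))"
proof -
  have *: "exp_double_sum \<in> borel_measurable lborel \<and> integrable lborel (\<lambda>w. exp (R * \<bar>w\<bar>) * norm (exp_double_sum w))" if R: "R \<ge> 0" for R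
  proof -
    obtain C where C: "C \<ge> 0"
      "\<And>i w. exp (R * \<bar>w\<bar>) * norm (exp_term i w) \<le> (\<lambda>(a,b). C * (real (Suc a) powr (- 2) * real (Suc b) powr (- 2))) i * exp (- \<bar>w\<bar>)"
      using exp_term_bound[OF R] by blast
    define A where "A = (\<lambda>(a,b). C * (real (Suc a) powr (- 2) * real (Suc b) powr (- 2)))"
    have Asum: "A summable_on UNIV" unfolding A_def by (rule summable_on_pairs_powr) auto
    have A0: "A i \<ge> 0" for i unfolding A_def using C(1) by (auto simp: case_prod_unfold)
    have int: "integrable lborel (\<lambda>w::real. exp (- \<bar>w\<bar>))" using integrable_exp_neg_abs[of 1] by simp
    define f where "f i w = of_real (exp (R * \<bar>w\<bar>)) * exp_term i w" for i w
    have fm: "f i \<in> borel_measurable lborel" for i unfolding f_def by measurable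
    have fb: "norm (f i w) \<le> A i * exp (- \<bar>w\<bar>)" for i w
      using C(2)[of w i] by (simp add: f_def A_def norm_mult)
    note dom = has_sum_integral_dominated[OF fm fb Asum A0 int exp_ge_zero]
    have fH: "(\<Sum>\<^sub>\<infinity>i. f i w) = of_real (exp (R * \<bar>w\<bar>)) * exp_double_sum w" for w
      unfolding f_def exp_double_sum_def by (rule infsum_cmult_right')
    have m: "(\<lambda>w. of_real (exp (R * \<bar>w\<bar>)) * exp_double_sum w) \<in> borel_measurable lborel"
      using dom(2) unfolding fH .
    have "(\<lambda>w. of_real (exp (- (R * \<bar>w\<bar>))) * (of_real (exp (R * \<bar>w\<bar>)) * exp_double_sum w)) \<in> borel_measurable lborel"
      using m by measurable
    moreover have "of_real (exp (- (R * \<bar>w\<bar>))) * (of_real (exp (R * \<bar>w\<bar>)) * exp_double_sum w) = exp_double_sum w" for w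
      by (simp add: exp_minus)
    ultimately have Hm: "exp_double_sum \<in> borel_measurable lborel" by simp
    moreover have "integrable lborel (\<lambda>w. exp (R * \<bar>w\<bar>) * norm (exp_double_sum w))"
    proof (rule Bochner_Integration.integrable_bound[OF integrable_mult_right[OF int, of "\<Sum>\<^sub>\<infinity>i. A i"]])
      show "AE w in lborel. norm (exp (R * \<bar>w\<bar>) * norm (exp_double_sum w)) \<le> norm ((\<Sum>\<^sub>\<infinity>i. A i) * exp (- \<bar>w\<bar>))"
        using order.trans[OF dom(3) abs_ge_self] unfolding fH by (intro AE_I2) (simp add: norm_mult)
    qed (use Hm in measurable)
    ultimately show ?thesis by blast
  qed
  show "exp_double_sum \<in> borel_measurable lborel" using *[of 0] by blast
  show "R > 0 \<Longrightarrow> integrable lborel (\<lambda>w. exp (R * \<bar>w\<bar>) * norm (exp_double_sum w))" using *[of R] by simp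
qed

text \<open>A two-sided Laplace transform in which the order is the transform variable; this is what
  makes the Bessel side visibly entire in \<open>\<nu>\<close>.\<close>

definition bessel_transform :: "complex \<Rightarrow> complex" where
  "bessel_transform \<nu> = (\<integral>w. exp (\<nu> * of_real w) * exp_double_sum w \<partial>lborel)"

lemma bessel_transform_entire: "bessel_transform holomorphic_on UNIV"
  unfolding bessel_transform_def[abs_def] by (rule entire_exp_integral[OF exp_double_sum_measurable exp_double_sum_integrable])

text \<open>Each exponential term integrates to a Bessel value. With a = 2 pi d and b = 2 pi x m,
  the argument 2 sqrt(ab) = 4 pi sqrt(nx) depends only on n = dm, and (b/a)^(nu/2) = x^(nu/2)
  d^(-nu) n^(nu/2) supplies precisely the weights of \<open>sigma_chi\<close>.\<close>

lemma besselK_series_sums: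
  fixes \<nu> :: complex
  shows "(\<lambda>n. 2 * of_real x powr (\<nu> / 2) *
      (sigma_chi (- \<nu>) (\<lambda>k. cnj (chi1 k)) (\<lambda>k. cnj (chi2 k)) (Suc n)
         * of_nat (Suc n) powr (\<nu> / 2) * besselK \<nu> (4 * pi * sqrt (real (Suc n) * x)))) sums bessel_transform \<nu>"
proof -
  obtain C where C: "C \<ge> 0"
    "\<And>i w. exp (norm \<nu> * \<bar>w\<bar>) * norm (exp_term i w) \<le> (\<lambda>(a,b). C * (real (Suc a) powr (- 2) * real (Suc b) powr (- 2))) i * exp (- \<bar>w\<bar>)"
    using exp_term_bound[OF norm_ge_zero] by blast
  define A where "A = (\<lambda>(a,b). C * (real (Suc a) powr (- 2) * real (Suc b) powr (- 2)))"
  have Asum: "A summable_on UNIV" unfolding A_def by (rule summable_on_pairs_powr) auto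
  have A0: "A i \<ge> 0" for i unfolding A_def using C(1) by (auto simp: case_prod_unfold)
  have int: "integrable lborel (\<lambda>w::real. exp (- \<bar>w\<bar>))" using integrable_exp_neg_abs[of 1] by simp
  define f where "f i w = exp (\<nu> * of_real w) * exp_term i w" for i w
  have fm: "f i \<in> borel_measurable lborel" for i unfolding f_def by measurable
  have fb: "norm (f i w) \<le> A i * exp (- \<bar>w\<bar>)" for i w
    using order.trans[OF mult_right_mono[OF norm_exp_mult_real_le[of \<nu> w] norm_ge_zero[of "exp_term i w"]] C(2)[of w i]]
    by (simp add: f_def A_def norm_mult)
  have fH: "(\<Sum>\<^sub>\<infinity>i. f i w) = exp (\<nu> * of_real w) * exp_double_sum w" for w
    unfolding f_def exp_double_sum_def by (rule infsum_cmult_right')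
  have hs: "((\<lambda>i. \<integral>w. f i w \<partial>lborel) has_sum bessel_transform \<nu>) UNIV"
    using has_sum_integral_dominated(1)[OF fm fb Asum A0 int exp_ge_zero] unfolding fH bessel_transform_def .
  define g where "g d m = cnj (chi1 d) * cnj (chi2 m) *
      (2 * of_real (2 * pi * x * real m / (2 * pi * real d)) powr (\<nu> / 2) *
        besselK \<nu> (2 * sqrt ((2 * pi * real d) * (2 * pi * x * real m))))" for d m
  have fg: "(\<integral>w. f (a, b) w \<partial>lborel) = g (Suc a) (Suc b)" for a b
  proof -
    have "(\<integral>w. f (a, b) w \<partial>lborel) = (\<integral>w. cnj (chi1 (Suc a)) * cnj (chi2 (Suc b)) *
       (exp (\<nu> * of_real w) * of_real (exp (- (2 * pi * real (Suc a) * exp w + 2 * pi * x * real (Suc b) * exp (- w))))) \<partial>lborel)"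
      unfolding f_def exp_term_def by (intro Bochner_Integration.integral_cong refl) (simp only: prod.case mult_ac)
    also have "\<dots> = g (Suc a) (Suc b)"
      unfolding g_def integral_mult_right_zero using x0 by (subst integral_exp_two_sided_eq_besselK) auto
    finally show ?thesis .
  qed
  have "((\<lambda>(a,b). g (Suc a) (Suc b)) has_sum bessel_transform \<nu>) UNIV"
    using hs by (simp add: fg[symmetric] case_prod_unfold)
  from has_sum_pairs_imp_divisor_sums[OF this]
  have "(\<lambda>n. \<Sum>d | d dvd Suc n. g d (Suc n div d)) sums bessel_transform \<nu>" .
  moreover have "(\<Sum>d | d dvd Suc n. g d (Suc n div d)) = 2 * of_real x powr (\<nu> / 2) *
      (sigma_chi (- \<nu>) (\<lambda>k. cnj (chi1 k)) (\<lambda>k. cnj (chi2 k)) (Suc n)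
         * of_nat (Suc n) powr (\<nu> / 2) * besselK \<nu> (4 * pi * sqrt (real (Suc n) * x)))" for n
  proof -
    have "g d (Suc n div d) = 2 * of_real x powr (\<nu> / 2) * ((of_nat d powr (- \<nu>) * cnj (chi1 d) * cnj (chi2 (Suc n div d)))
         * of_nat (Suc n) powr (\<nu> / 2) * besselK \<nu> (4 * pi * sqrt (real (Suc n) * x)))" if "d dvd Suc n" for d
    proof -
      from that obtain m where m: "Suc n = d * m" by auto
      have d0: "d > 0" and m0: "m > 0" using m by (auto intro!: Nat.gr0I)
      have dm: "Suc n div d = m" using m d0 by simp
      have n: "real (Suc n) = real d * real m" unfolding m by simp
      have "sqrt ((2 * pi * real d) * (2 * pi * x * real m)) = sqrt ((2 * pi)\<^sup>2 * (real (Suc n) * x))"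
        unfolding n by (simp add: power2_eq_square algebra_simps)
      hence sq: "2 * sqrt ((2 * pi * real d) * (2 * pi * x * real m)) = 4 * pi * sqrt (real (Suc n) * x)"
        by (simp add: real_sqrt_mult)
      have "complex_of_real (2 * pi * x * real m / (2 * pi * real d)) powr (\<nu> / 2) =
         of_real x powr (\<nu> / 2) * (of_nat d powr (- \<nu>) * of_nat (Suc n) powr (\<nu> / 2))"
      proof -
        have l1: "ln (2 * pi * x * real m / (2 * pi * real d)) = ln x + ln (real m) - ln (real d)"
          using x0 m0 d0 by (simp add: ln_div ln_mult)
        have l2: "ln (real (Suc n)) = ln (real d) + ln (real m)" unfolding n using m0 d0 by (simp add: ln_mult)
        have e1: "of_nat d powr (- \<nu>) = exp (- \<nu> * of_real (ln (real d)))"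
          using of_real_powr_eq_exp[of "real d" "- \<nu>"] d0 by simp
        have e2: "of_nat (Suc n) powr (\<nu> / 2) = exp (\<nu> / 2 * of_real (ln (real (Suc n))))"
          using of_real_powr_eq_exp[of "real (Suc n)" "\<nu> / 2"] by simp
        have "2 * pi * x * real m / (2 * pi * real d) > 0" using x0 m0 d0 by simp
        thus ?thesis unfolding e1 e2 using x0
          by (simp only: of_real_powr_eq_exp l1 l2 exp_add[symmetric]) (simp add: field_simps)
      qed
      thus ?thesis unfolding g_def dm sq by simp
    qed
    hence "(\<Sum>d | d dvd Suc n. g d (Suc n div d)) = (\<Sum>d | d dvd Suc n. 2 * of_real x powr (\<nu> / 2) * ((of_nat d powr (- \<nu>) * cnj (chi1 d) * cnj (chi2 (Suc n div d)))
         * of_nat (Suc n) powr (\<nu> / 2) * besselK \<nu> (4 * pi * sqrt (real (Suc n) * x))))"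
      by (intro sum.cong) auto
    thus ?thesis unfolding sigma_chi_def by (simp only: sum_distrib_left sum_distrib_right)
  qed
  ultimately show ?thesis by simp
qed

lemma besselK_series_eq:
  fixes \<nu> :: complex
  shows "8 * pi * of_real x powr (\<nu> / 2) *
     (\<Sum>n. sigma_chi (- \<nu>) (\<lambda>k. cnj (chi1 k)) (\<lambda>k. cnj (chi2 k)) (Suc n)
        * of_nat (Suc n) powr (\<nu> / 2) * besselK \<nu> (4 * pi * sqrt (real (Suc n) * x))) = 4 * pi * bessel_transform \<nu>"
proof -
  define c where "c = 2 * of_real x powr (\<nu> / 2)"
  define t where "t n = sigma_chi (- \<nu>) (\<lambda>k. cnj (chi1 k)) (\<lambda>k. cnj (chi2 k)) (Suc n)
        * of_nat (Suc n) powr (\<nu> / 2) * besselK \<nu> (4 * pi * sqrt (real (Suc n) * x))" for n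
  have c0: "c \<noteq> 0" using x0 by (simp add: c_def)
  have "(\<lambda>n. c * t n) sums bessel_transform \<nu>" using besselK_series_sums[of \<nu>] unfolding c_def t_def .
  from sums_mult[OF this, of "1 / c"] c0 have "t sums (bessel_transform \<nu> / c)" by simp
  hence "c * suminf t = bessel_transform \<nu>" using c0 by (simp add: sums_iff)
  thus ?thesis unfolding t_def[symmetric] by (simp add: c_def ac_simps)
qed

end

section \<open>Small positive order\<close>

lemma even_char_exp_infsum:
  assumes prim: "primitive_char q chi" and ev: "even_char q chi" and q1: "q > 1" and u: "u > 0"
  shows "(\<lambda>n. norm (cnj (chi (Suc n)) * of_real (exp (- (2 * pi * real (Suc n) * u))))) summable_on UNIV"
    and "(\<lambda>m. norm (chi (Suc m) * of_real ((q * u) / ((q * u)\<^sup>2 + real (Suc m) ^ 2)))) summable_on UNIV"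
    and "(\<Sum>\<^sub>\<infinity>n. cnj (chi (Suc n)) * of_real (exp (- (2 * pi * real (Suc n) * u)))) =
           of_nat q / (pi * gauss_sum q chi) *
             (\<Sum>\<^sub>\<infinity>m. chi (Suc m) * of_real ((q * u) / ((q * u)\<^sup>2 + real (Suc m) ^ 2)))"
proof -
  have dc: "dirichlet_char q chi" using prim by (simp add: primitive_char_def)
  note le = norm_dirichlet_char_le[OF dc]
  define r where "r = exp (- (2 * pi * u))"
  have r: "norm r < 1" using u by (simp add: r_def)
  have rn: "exp (- (2 * pi * real (Suc n) * u)) = r * r ^ n" for n
    by (simp add: r_def exp_of_nat_mult[symmetric] exp_add[symmetric] algebra_simps)
  have s1: "summable (\<lambda>n. norm (cnj (chi (Suc n)) * of_real (exp (- (2 * pi * real (Suc n) * u)))))"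
  proof (rule summable_comparison_test'[OF summable_mult[OF summable_geometric[OF r]], of 0])
    fix n :: nat
    have "norm (chi (Suc n)) * (r * r ^ n) \<le> 1 * (r * r ^ n)"
      by (intro mult_right_mono le) (simp add: r_def)
    thus "norm (norm (cnj (chi (Suc n)) * of_real (exp (- (2 * pi * real (Suc n) * u))))) \<le> r * r ^ n"
      unfolding rn norm_mult norm_of_real complex_mod_cnj by (simp add: r_def)
  qed
  have "summable (\<lambda>m. norm (chi m * of_real ((q * u) / ((q * u)\<^sup>2 + real m ^ 2))))"
    using u q1 by (intro summable_inverse_square_shift le) auto
  hence s2: "summable (\<lambda>m. norm (chi (Suc m) * of_real ((q * u) / ((q * u)\<^sup>2 + real (Suc m) ^ 2))))"
    by (subst summable_Suc_iff)
  show a1: "(\<lambda>n. norm (cnj (chi (Suc n)) * of_real (exp (- (2 * pi * real (Suc n) * u))))) summable_on UNIV"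
    by (rule summable_nonneg_imp_summable_on[OF s1]) simp
  show a2: "(\<lambda>m. norm (chi (Suc m) * of_real ((q * u) / ((q * u)\<^sup>2 + real (Suc m) ^ 2)))) summable_on UNIV"
    by (rule summable_nonneg_imp_summable_on[OF s2]) simp
  have conv: "infsum f UNIV = suminf f" if "summable (\<lambda>n. norm (f n))" for f :: "nat \<Rightarrow> complex"
    using norm_summable_imp_has_sum[OF that summable_sums[OF summable_norm_cancel[OF that]]] by (rule infsumI)
  show "(\<Sum>\<^sub>\<infinity>n. cnj (chi (Suc n)) * of_real (exp (- (2 * pi * real (Suc n) * u)))) =
           of_nat q / (pi * gauss_sum q chi) *
             (\<Sum>\<^sub>\<infinity>m. chi (Suc m) * of_real ((q * u) / ((q * u)\<^sup>2 + real (Suc m) ^ 2)))"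
    unfolding conv[OF s1] conv[OF s2] by (rule sums_unique[OF even_char_exp_sum[OF assms], symmetric])
qed

section \<open>Domination and evaluation of the kernel\<close>

lemma powr_mean_le_sum_squares:
  fixes A B :: real assumes "A > 0" "B > 0"
  shows "A powr (1/2) * B powr (3/2) \<le> A\<^sup>2 + B\<^sup>2"
proof -
  define M where "M = max A B"
  have M: "M > 0" "A \<le> M" "B \<le> M" using assms by (auto simp: M_def)
  have "A powr (1/2) * B powr (3/2) \<le> M powr (1/2) * M powr (3/2)"
    using assms M by (intro mult_mono powr_mono2) auto
  also have "\<dots> = M powr 2" by (simp add: powr_add[symmetric])
  also have "\<dots> = M\<^sup>2" using M by (simp add: powr_realpow)
  also have "\<dots> \<le> A\<^sup>2 + B\<^sup>2" by (auto simp: M_def max_def)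
  finally show ?thesis .
qed

text \<open>The exponent 3/2 lies strictly between 1, needed for summability, and 2, where no power
  of \<open>exp w\<close> would remain for decay. For \<open>w \<ge> 0\<close> the mean inequality
  is used on \<open>exp (2 * w) + k\<^sup>2\<close>, leaving \<open>exp (- w / 2)\<close>, of which
  \<open>\<nu> < 1/4\<close> uses up at most half. For \<open>w < 0\<close> it is used on the other
  factor, leaving \<open>exp (w / 2)\<close>.\<close>

lemma kernel_bound:
  fixes y m k \<nu> w :: real
  assumes y: "y > 0" and m: "m \<ge> 1" and k: "k \<ge> 1" and \<nu>: "0 < \<nu>" "\<nu> < 1/4"
  shows "exp (\<nu> * w) * (y * exp (2 * w) / ((exp (2 * w) + k\<^sup>2) * (m\<^sup>2 * exp (2 * w) + y\<^sup>2)))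
     \<le> (y + y powr (1/2)) * (m powr (- (3/2)) * k powr (- (3/2))) * exp (- (1/4 * \<bar>w\<bar>))"
proof -
  define u where "u = exp w"
  have u: "u > 0" by (simp add: u_def)
  have u2: "exp (2 * w) = u\<^sup>2" by (simp add: u_def exp_double)
  have uh: "u powr a = exp (a * w)" for a by (simp add: u_def powr_def)
  have c2: "z powr (3/2) \<le> z\<^sup>2" if "z \<ge> 1" for z :: real
    using powr_mono[of "3/2" 2 z] that by (simp add: powr_realpow)
  have "u\<^sup>2 + k\<^sup>2 > 0" using u by (intro add_pos_nonneg) auto
  moreover have "m\<^sup>2 * u\<^sup>2 + y\<^sup>2 > 0" using y by (intro add_nonneg_pos) auto
  ultimately have p1: "u\<^sup>2 + k\<^sup>2 > 0" "m\<^sup>2 * u\<^sup>2 + y\<^sup>2 > 0" .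
  have main: "\<exists>c\<ge>0. c \<le> y + y powr (1/2) \<and> exp (\<nu> * w) * (y * u\<^sup>2 / ((u\<^sup>2 + k\<^sup>2) * (m\<^sup>2 * u\<^sup>2 + y\<^sup>2))) \<le>
      c * (m powr (- (3/2)) * k powr (- (3/2))) * exp (- (1/4 * \<bar>w\<bar>))"
  proof (cases "w \<ge> 0")
    case True
    have "(u powr (1/2) * k powr (3/2)) * (m powr (3/2) * u\<^sup>2) \<le> (u\<^sup>2 + k\<^sup>2) * (m\<^sup>2 * u\<^sup>2 + y\<^sup>2)"
      using u k m powr_mean_le_sum_squares[of u k] mult_right_mono[OF c2[OF m], of "u\<^sup>2"]
      by (intro mult_mono) (auto intro: add_increasing2)
    hence "y * u\<^sup>2 / ((u\<^sup>2 + k\<^sup>2) * (m\<^sup>2 * u\<^sup>2 + y\<^sup>2)) \<le> y * u\<^sup>2 / ((u powr (1/2) * k powr (3/2)) * (m powr (3/2) * u\<^sup>2))"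
      using u k m y p1 by (intro divide_left_mono) auto
    also have "\<dots> = y * (m powr (- (3/2)) * k powr (- (3/2))) * u powr (- (1/2))"
      using u k m by (simp add: powr_minus field_simps)
    finally have "exp (\<nu> * w) * (y * u\<^sup>2 / ((u\<^sup>2 + k\<^sup>2) * (m\<^sup>2 * u\<^sup>2 + y\<^sup>2))) \<le>
       exp (1/4 * w) * (y * (m powr (- (3/2)) * k powr (- (3/2))) * u powr (- (1/2)))"
      using \<nu> True y p1 mult_right_mono[of \<nu> "1/4" w] by (intro mult_mono) auto
    also have "\<dots> = y * (m powr (- (3/2)) * k powr (- (3/2))) * (exp (1/4 * w) * exp (- (1/2) * w))"
      by (simp add: uh)
    also have "exp (1/4 * w) * exp (- (1/2) * w) = exp (- (1/4 * \<bar>w\<bar>))"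
      using True by (simp add: exp_add[symmetric])
    finally show ?thesis using y by (intro exI[of _ y]) auto
  next
    case False
    have "k powr (3/2) * (y powr (1/2) * (m * u) powr (3/2)) \<le> (u\<^sup>2 + k\<^sup>2) * (m\<^sup>2 * u\<^sup>2 + y\<^sup>2)"
      using u y m powr_mean_le_sum_squares[of y "m * u"] c2[OF k]
      by (intro mult_mono) (auto intro: add_increasing add_increasing2 simp: power_mult_distrib add.commute)
    hence "y * u\<^sup>2 / ((u\<^sup>2 + k\<^sup>2) * (m\<^sup>2 * u\<^sup>2 + y\<^sup>2)) \<le> y * u\<^sup>2 / (k powr (3/2) * (y powr (1/2) * (m * u) powr (3/2)))"
      using u k m y p1 by (intro divide_left_mono) auto
    also have "\<dots> = (y / y powr (1/2)) * (m powr (- (3/2)) * k powr (- (3/2))) * (u\<^sup>2 / u powr (3/2))"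
      using u k m y by (simp add: powr_minus powr_mult field_simps)
    also have "y / y powr (1/2) = y powr (1/2)"
      using y powr_diff[of y 1 "1/2"] by simp
    also have "u\<^sup>2 / u powr (3/2) = u powr (1/2)"
      using u powr_diff[of u 2 "3/2"] by (simp add: powr_realpow)
    finally have "exp (\<nu> * w) * (y * u\<^sup>2 / ((u\<^sup>2 + k\<^sup>2) * (m\<^sup>2 * u\<^sup>2 + y\<^sup>2))) \<le>
       1 * (y powr (1/2) * (m powr (- (3/2)) * k powr (- (3/2))) * u powr (1/2))"
      using \<nu> False y p1 by (intro mult_mono) (auto simp: mult_le_0_iff)
    also have "\<dots> \<le> y powr (1/2) * (m powr (- (3/2)) * k powr (- (3/2))) * exp (- (1/4 * \<bar>w\<bar>))"
      using False unfolding uh mult_1 by (intro mult_left_mono) auto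
    finally show ?thesis using y by (intro exI[of _ "y powr (1/2)"]) auto
  qed
  then obtain c where c: "c \<le> y + y powr (1/2)" "exp (\<nu> * w) * (y * u\<^sup>2 / ((u\<^sup>2 + k\<^sup>2) * (m\<^sup>2 * u\<^sup>2 + y\<^sup>2))) \<le>
      c * (m powr (- (3/2)) * k powr (- (3/2))) * exp (- (1/4 * \<bar>w\<bar>))" by blast
  have "c * (m powr (- (3/2)) * k powr (- (3/2))) * exp (- (1/4 * \<bar>w\<bar>)) \<le>
     (y + y powr (1/2)) * (m powr (- (3/2)) * k powr (- (3/2))) * exp (- (1/4 * \<bar>w\<bar>))"
    by (intro mult_right_mono c) auto
  with c(2) show ?thesis unfolding u2 by (rule order.trans)
qed

text \<open>Pulling \<open>m\<^sup>2\<close> out of the second factor reduces this to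
  \<open>kernel_integral\<close> with parameters \<open>k\<close> and \<open>y / m\<close>; they
  differ exactly when \<open>y \<noteq> m * k\<close>.\<close>

lemma kernel_integral_scaled:
  fixes y m k \<nu> :: real
  assumes y: "y > 0" and m: "m > 0" and k: "k > 0" and \<nu>: "0 < \<nu>" "\<nu> < 2" and ne: "y \<noteq> m * k"
  shows "(\<integral>w. exp (\<nu> * w) * (y * exp (2 * w) / ((exp (2 * w) + k\<^sup>2) * (m\<^sup>2 * exp (2 * w) + y\<^sup>2))) \<partial>lborel) =
     y * (pi / (2 * sin (pi * \<nu> / 2))) * (m powr (- \<nu>) * (((m * k) powr \<nu> - y powr \<nu>) / ((m * k)\<^sup>2 - y\<^sup>2)))"
proof -
  have ne': "k \<noteq> y / m" using ne m by (simp add: field_simps)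
  have eq: "exp (\<nu> * w) * (y * exp (2 * w) / ((exp (2 * w) + k\<^sup>2) * (m\<^sup>2 * exp (2 * w) + y\<^sup>2))) =
     y / m\<^sup>2 * (exp (\<nu> * w) * (exp (2 * w) / ((exp (2 * w) + k\<^sup>2) * (exp (2 * w) + (y / m)\<^sup>2))))" for w
  proof -
    have "m\<^sup>2 * exp (2 * w) + y\<^sup>2 = m\<^sup>2 * (exp (2 * w) + (y / m)\<^sup>2)" using m by (simp add: field_simps)
    thus ?thesis by (simp add: mult_ac)
  qed
  have "(\<integral>w. exp (\<nu> * w) * (y * exp (2 * w) / ((exp (2 * w) + k\<^sup>2) * (m\<^sup>2 * exp (2 * w) + y\<^sup>2))) \<partial>lborel) =
     y / m\<^sup>2 * (pi / (2 * sin (pi * \<nu> / 2)) * (((y / m) powr \<nu> - k powr \<nu>) / ((y / m)\<^sup>2 - k\<^sup>2)))"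
    unfolding eq integral_mult_right_zero
    using kernel_integral[OF \<nu> k _ ne'] y m by (simp add: has_bochner_integral_iff)
  also have "((y / m) powr \<nu> - k powr \<nu>) / ((y / m)\<^sup>2 - k\<^sup>2) =
     m\<^sup>2 * (m powr (- \<nu>) * (((m * k) powr \<nu> - y powr \<nu>) / ((m * k)\<^sup>2 - y\<^sup>2)))"
  proof -
    have 1: "(y / m) powr \<nu> - k powr \<nu> = - (m powr (- \<nu>) * ((m * k) powr \<nu> - y powr \<nu>))"
      using y m k by (simp add: powr_divide powr_mult powr_minus field_simps)
    have 2: "(y / m)\<^sup>2 - k\<^sup>2 = - (((m * k)\<^sup>2 - y\<^sup>2) / m\<^sup>2)"
      using m by (simp add: field_simps)
    show ?thesis unfolding 1 2 using m by simp
  qed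
  finally show ?thesis using m by simp
qed

context even_char_pair begin

definition y :: real where "y = real (p * q) * x"

lemma y_pos: "y > 0" using p1 q1 x0 by (simp add: y_def)

text \<open>The contribution of the divisor \<open>m\<close> of \<open>n = m * k\<close> to the
  series on the right-hand side of the claim. Unlike the divisor sum itself, it can be dominated and
  split by factors in \<open>m\<close> and \<open>k\<close>.\<close>

definition frac_term :: "nat \<Rightarrow> complex \<Rightarrow> nat \<Rightarrow> nat \<Rightarrow> complex" where
  "frac_term N \<nu> m k = of_nat m powr (- \<nu>) * chi2 m * chi1 k *
     ((of_nat (m * k) powr (\<nu> - of_nat (2 * N)) - of_real y powr (\<nu> - of_nat (2 * N)))
        / (of_nat (m * k) ^ 2 - of_real y ^ 2))"

definition frac_sum :: "nat \<Rightarrow> complex \<Rightarrow> complex" where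
  "frac_sum N \<nu> = (\<Sum>\<^sub>\<infinity>(a,b). frac_term N \<nu> (Suc a) (Suc b))"

text \<open>The product of one partial fraction term from each factor once \<open>w\<close> is
  translated. The order of the pair is opposite to that in \<open>exp_term\<close>: the first index
  now belongs to \<open>chi2\<close>, since it has to become the divisor in
  \<open>sigma_chi (- \<nu>) chi2 chi1\<close>.\<close>

definition kernel :: "nat \<times> nat \<Rightarrow> real \<Rightarrow> real" where
  "kernel = (\<lambda>(a,b) w. y * exp (2 * w) / ((exp (2 * w) + (real (Suc b))\<^sup>2) * ((real (Suc a))\<^sup>2 * exp (2 * w) + y\<^sup>2)))"

text \<open>At \<open>v = w - ln p\<close> the scaled arguments become
  \<open>p * exp v = exp w\<close> and \<open>q * x * exp (- v) = y * exp (- w)\<close>, so both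
  moduli enter the kernel only through \<open>y\<close>.\<close>

lemma exp_double_sum_shift_eq_kernel_sum:
  "exp_double_sum (w - ln (real p)) = of_nat (p * q) / (pi ^ 2 * gauss_sum p chi1 * gauss_sum q chi2) *
      (\<Sum>\<^sub>\<infinity>i. (\<lambda>(a,b). chi2 (Suc a) * chi1 (Suc b)) i * of_real (kernel i w))"
proof -
  define v where "v = w - ln (real p)"
  define u2 where "u2 = x * exp (- v)"
  have ev: "exp v > 0" "u2 > 0" using x0 by (auto simp: u2_def)
  note F1 = even_char_exp_infsum[OF prim1 even1 p1 ev(1)]
  note F2 = even_char_exp_infsum[OF prim2 even2 q1 ev(2)]
  have "((\<lambda>(a,b). (cnj (chi1 (Suc a)) * of_real (exp (- (2 * pi * real (Suc a) * exp v)))) *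
          (cnj (chi2 (Suc b)) * of_real (exp (- (2 * pi * real (Suc b) * u2))))) has_sum
        ((\<Sum>\<^sub>\<infinity>a. cnj (chi1 (Suc a)) * of_real (exp (- (2 * pi * real (Suc a) * exp v)))) *
         (\<Sum>\<^sub>\<infinity>b. cnj (chi2 (Suc b)) * of_real (exp (- (2 * pi * real (Suc b) * u2)))))) UNIV"
    by (rule has_sum_product(1)[OF F1(1) F2(1)])
  moreover have "(\<lambda>(a,b). (cnj (chi1 (Suc a)) * of_real (exp (- (2 * pi * real (Suc a) * exp v)))) *
          (cnj (chi2 (Suc b)) * of_real (exp (- (2 * pi * real (Suc b) * u2))))) = (\<lambda>i. exp_term i v)"
    by (auto simp: fun_eq_iff exp_term_def u2_def exp_add[symmetric] exp_of_real[symmetric] algebra_simps)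
  ultimately have "exp_double_sum v = (\<Sum>\<^sub>\<infinity>a. cnj (chi1 (Suc a)) * of_real (exp (- (2 * pi * real (Suc a) * exp v)))) *
         (\<Sum>\<^sub>\<infinity>b. cnj (chi2 (Suc b)) * of_real (exp (- (2 * pi * real (Suc b) * u2))))"
    unfolding exp_double_sum_def by (simp add: infsumI)
  also have "\<dots> = of_nat (p * q) / (pi ^ 2 * gauss_sum p chi1 * gauss_sum q chi2) *
      ((\<Sum>\<^sub>\<infinity>m. chi2 (Suc m) * of_real ((q * u2) / ((q * u2)\<^sup>2 + real (Suc m) ^ 2))) *
       (\<Sum>\<^sub>\<infinity>k. chi1 (Suc k) * of_real ((p * exp v) / ((p * exp v)\<^sup>2 + real (Suc k) ^ 2))))"
  proof -
    have "(of_nat p / (pi * g1) * X) * (of_nat q / (pi * g2) * Y) = of_nat (p * q) / (pi ^ 2 * g1 * g2) * (Y * X)"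
      for g1 g2 X Y :: complex by (simp add: power2_eq_square mult_ac)
    thus ?thesis unfolding F1(3) F2(3) .
  qed
  also have "(\<Sum>\<^sub>\<infinity>m. chi2 (Suc m) * of_real ((q * u2) / ((q * u2)\<^sup>2 + real (Suc m) ^ 2))) *
       (\<Sum>\<^sub>\<infinity>k. chi1 (Suc k) * of_real ((p * exp v) / ((p * exp v)\<^sup>2 + real (Suc k) ^ 2))) =
     (\<Sum>\<^sub>\<infinity>(m,k). (chi2 (Suc m) * of_real ((q * u2) / ((q * u2)\<^sup>2 + real (Suc m) ^ 2))) *
         (chi1 (Suc k) * of_real ((p * exp v) / ((p * exp v)\<^sup>2 + real (Suc k) ^ 2))))"
    by (rule infsumI[symmetric, OF has_sum_product(1)[OF F2(2) F1(2)]])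
  also have "\<dots> = (\<Sum>\<^sub>\<infinity>i. (\<lambda>(a,b). chi2 (Suc a) * chi1 (Suc b)) i * of_real (kernel i w))"
  proof (rule infsum_cong, clarify)
    fix a b :: nat
    define U where "U = exp w"
    have U: "U > 0" by (simp add: U_def)
    have pv: "p * exp v = U" using p1 by (simp add: v_def U_def exp_diff)
    have "exp (- v) = p / U" using p1 by (simp add: v_def U_def exp_diff)
    hence qu: "q * u2 = y / U" by (simp add: u2_def y_def)
    have pos: "(y / U)\<^sup>2 + real (Suc a) ^ 2 > 0" "y\<^sup>2 + (real (Suc a))\<^sup>2 * U\<^sup>2 > 0"
      using y_pos by (auto intro!: add_pos_nonneg simp: U_def)
    have "(y / U) / ((y / U)\<^sup>2 + real (Suc a) ^ 2) = y * U / ((real (Suc a))\<^sup>2 * U\<^sup>2 + y\<^sup>2)"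
    proof -
      have "(y / U)\<^sup>2 + real (Suc a) ^ 2 = ((real (Suc a))\<^sup>2 * U\<^sup>2 + y\<^sup>2) / U\<^sup>2"
        using U by (simp add: field_simps del: of_nat_Suc)
      thus ?thesis using U by (simp add: power2_eq_square del: of_nat_Suc)
    qed
    hence "(y / U) / ((y / U)\<^sup>2 + real (Suc a) ^ 2) * (U / (U\<^sup>2 + real (Suc b) ^ 2)) =
       y * U\<^sup>2 / ((U\<^sup>2 + real (Suc b) ^ 2) * ((real (Suc a))\<^sup>2 * U\<^sup>2 + y\<^sup>2))"
      by (simp add: power2_eq_square mult_ac del: of_nat_Suc)
    also have "\<dots> = kernel (a, b) w" by (simp add: kernel_def U_def exp_double)
    finally have k: "kernel (a, b) w = (q * u2) / ((q * u2)\<^sup>2 + real (Suc a) ^ 2) * ((p * exp v) / ((p * exp v)\<^sup>2 + real (Suc b) ^ 2))"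
      unfolding pv qu ..
    show "chi2 (Suc a) * of_real ((q * u2) / ((q * u2)\<^sup>2 + real (Suc a) ^ 2)) *
         (chi1 (Suc b) * of_real ((p * exp v) / ((p * exp v)\<^sup>2 + real (Suc b) ^ 2))) =
         chi2 (Suc a) * chi1 (Suc b) * of_real (kernel (a, b) w)"
      unfolding k of_real_mult by (simp only: mult_ac)
  qed
  finally show ?thesis by (simp add: v_def)
qed

lemma y_neq: "y \<noteq> real (Suc a) * real (Suc b)"
  using nonint[rule_format, of "Suc a * Suc b"] by (simp add: y_def algebra_simps)

lemma bessel_transform_eq_frac_sum_0:
  fixes \<nu> :: real
  assumes \<nu>: "0 < \<nu>" "\<nu> < 1/4"
  shows "bessel_transform (of_real \<nu>) = of_nat p powr (- of_real \<nu>) * (of_nat (p * q) / (pi ^ 2 * gauss_sum p chi1 * gauss_sum q chi2)) *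
      (y * (pi / (2 * sin (pi * \<nu> / 2)))) * frac_sum 0 (of_real \<nu>)"
proof -
  define c where "c = of_nat (p * q) / (pi ^ 2 * gauss_sum p chi1 * gauss_sum q chi2)"
  define P where "P = complex_of_nat p powr (- of_real \<nu>)"
  define f where "f i w = (\<lambda>(a,b). chi2 (Suc a) * chi1 (Suc b)) i * of_real (exp (\<nu> * w) * kernel i w)" for i w
  define A where "A = (\<lambda>(a,b). (y + y powr (1/2)) * (real (Suc a) powr (- (3/2)) * real (Suc b) powr (- (3/2))))"
  have Asum: "A summable_on UNIV" unfolding A_def by (rule summable_on_pairs_powr) auto
  have A0: "A i \<ge> 0" for i unfolding A_def using y_pos by (auto simp: case_prod_unfold)
  have int: "integrable lborel (\<lambda>w::real. exp (- (1/4 * \<bar>w\<bar>)))" by (rule integrable_exp_neg_abs) simp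
  have fm: "f i \<in> borel_measurable lborel" for i unfolding f_def kernel_def by (cases i) simp
  have fb: "norm (f i w) \<le> A i * exp (- (1/4 * \<bar>w\<bar>))" for i w
  proof (cases i)
    case (Pair a b)
    have k0: "exp (\<nu> * w) * kernel (a, b) w \<ge> 0" using y_pos by (auto simp: kernel_def intro!: divide_nonneg_nonneg mult_nonneg_nonneg add_nonneg_nonneg)
    have "norm (f i w) \<le> 1 * (exp (\<nu> * w) * kernel (a, b) w)"
      unfolding f_def Pair prod.case norm_mult norm_of_real abs_of_nonneg[OF k0]
      using mult_mono[OF norm_chi2_le norm_chi1_le, of "Suc b" "Suc a"] by (intro mult_right_mono k0) auto
    also have "\<dots> \<le> A i * exp (- (1/4 * \<bar>w\<bar>))"
      unfolding Pair kernel_def A_def prod.case mult_1 by (rule kernel_bound) (use y_pos \<nu> in auto)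
    finally show ?thesis .
  qed
  have hs: "((\<lambda>i. \<integral>w. f i w \<partial>lborel) has_sum (\<integral>w. (\<Sum>\<^sub>\<infinity>i. f i w) \<partial>lborel)) UNIV"
    by (rule has_sum_integral_dominated(1)[OF fm fb Asum A0 int exp_ge_zero])
  have fi: "(\<integral>w. f (a, b) w \<partial>lborel) = y * (pi / (2 * sin (pi * \<nu> / 2))) * frac_term 0 (of_real \<nu>) (Suc a) (Suc b)" for a b
  proof -
    define m k where "m = real (Suc a)" and "k = real (Suc b)"
    have m: "m > 0" and k: "k > 0" by (auto simp: m_def k_def)
    have "(\<integral>w. f (a, b) w \<partial>lborel) = chi2 (Suc a) * chi1 (Suc b) * of_real (\<integral>w. exp (\<nu> * w) * kernel (a, b) w \<partial>lborel)"
      unfolding f_def prod.case integral_mult_right_zero integral_complex_of_real ..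
    also have "(\<integral>w. exp (\<nu> * w) * kernel (a, b) w \<partial>lborel) =
       y * (pi / (2 * sin (pi * \<nu> / 2))) * (m powr (- \<nu>) * (((m * k) powr \<nu> - y powr \<nu>) / ((m * k)\<^sup>2 - y\<^sup>2)))"
      unfolding kernel_def prod.case m_def k_def
      by (rule kernel_integral_scaled) (use y_pos \<nu> y_neq in auto)
    finally have *: "(\<integral>w. f (a, b) w \<partial>lborel) = chi2 (Suc a) * chi1 (Suc b) * of_real (y * (pi / (2 * sin (pi * \<nu> / 2))) *
        (m powr (- \<nu>) * (((m * k) powr \<nu> - y powr \<nu>) / ((m * k)\<^sup>2 - y\<^sup>2))))" .
    have r1: "complex_of_real (m powr (- \<nu>)) = of_nat (Suc a) powr (- of_real \<nu>)"
      using powr_of_real[of m "- \<nu>"] m by (simp add: m_def)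
    have r4: "complex_of_real (m * k) = of_nat (Suc a * Suc b)" by (simp add: m_def k_def algebra_simps)
    have r2: "complex_of_real ((m * k) powr \<nu>) = of_nat (Suc a * Suc b) powr (of_real \<nu>)"
      unfolding r4[symmetric] using powr_of_real[of "m * k" \<nu>] m k by simp
    have r3: "complex_of_real (y powr \<nu>) = of_real y powr of_real \<nu>"
      using powr_of_real[of y \<nu>] y_pos by simp
    show ?thesis unfolding * frac_term_def
      unfolding of_real_mult[of "y * _"] of_real_mult[of "m powr _"] of_real_divide[of "_ - _" "_ - _"] of_real_diff of_real_power r1 r2 r3 r4
      by simp
  qed
  have "((\<lambda>i. y * (pi / (2 * sin (pi * \<nu> / 2))) * (\<lambda>(a,b). frac_term 0 (of_real \<nu>) (Suc a) (Suc b)) i) has_sum (\<integral>w. (\<Sum>\<^sub>\<infinity>i. f i w) \<partial>lborel)) UNIV"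
    using hs by (rule has_sum_cong[THEN iffD1, rotated]) (auto simp: fi)
  hence "(\<integral>w. (\<Sum>\<^sub>\<infinity>i. f i w) \<partial>lborel) = (\<Sum>\<^sub>\<infinity>i. y * (pi / (2 * sin (pi * \<nu> / 2))) * (\<lambda>(a,b). frac_term 0 (of_real \<nu>) (Suc a) (Suc b)) i)"
    by (rule infsumI[symmetric])
  also have "\<dots> = y * (pi / (2 * sin (pi * \<nu> / 2))) * frac_sum 0 (of_real \<nu>)"
    unfolding frac_sum_def by (rule infsum_cmult_right')
  finally have I: "(\<integral>w. (\<Sum>\<^sub>\<infinity>i. f i w) \<partial>lborel) = y * (pi / (2 * sin (pi * \<nu> / 2))) * frac_sum 0 (of_real \<nu>)" .
  \<comment> \<open>The translation by \<open>- ln p\<close> prepares the kernel expansion and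
    produces the factor \<open>p powr (- \<nu>)\<close>.\<close>
  have "bessel_transform (of_real \<nu>) = (\<integral>w. exp (of_real \<nu> * of_real (- ln (real p) + 1 * w)) * exp_double_sum (- ln (real p) + 1 * w) \<partial>lborel)"
    unfolding bessel_transform_def by (subst lborel_integral_real_affine[of 1 _ "- ln (real p)"]) auto
  also have "\<dots> = (\<integral>w. P * c * (\<Sum>\<^sub>\<infinity>i. f i w) \<partial>lborel)"
  proof (rule Bochner_Integration.integral_cong[OF refl])
    fix w :: real
    have P: "P = exp (- of_real \<nu> * of_real (ln (real p)))"
      using of_real_powr_eq_exp[of "real p" "- of_real \<nu>"] p1 by (simp add: P_def)
    have "exp (complex_of_real \<nu> * of_real (- ln (real p) + 1 * w)) = P * of_real (exp (\<nu> * w))"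
      unfolding P exp_of_real[symmetric] exp_add[symmetric] by (simp add: algebra_simps)
    moreover have "exp_double_sum (- ln (real p) + 1 * w) = c * (\<Sum>\<^sub>\<infinity>i. (\<lambda>(a,b). chi2 (Suc a) * chi1 (Suc b)) i * of_real (kernel i w))"
      using exp_double_sum_shift_eq_kernel_sum[of w] by (simp add: c_def)
    moreover have "(\<Sum>\<^sub>\<infinity>i. f i w) = of_real (exp (\<nu> * w)) * (\<Sum>\<^sub>\<infinity>i. (\<lambda>(a,b). chi2 (Suc a) * chi1 (Suc b)) i * of_real (kernel i w))"
      unfolding f_def infsum_cmult_right'[symmetric] by (intro infsum_cong) (simp add: case_prod_unfold)
    ultimately show "exp (complex_of_real \<nu> * of_real (- ln (real p) + 1 * w)) * exp_double_sum (- ln (real p) + 1 * w) = P * c * (\<Sum>\<^sub>\<infinity>i. f i w)"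
      by (simp only: mult_ac)
  qed
  also have "\<dots> = P * c * (y * (pi / (2 * sin (pi * \<nu> / 2))) * frac_sum 0 (of_real \<nu>))"
    unfolding integral_mult_right_zero I ..
  finally show ?thesis by (simp add: P_def c_def mult_ac)
qed

end

section \<open>Continuation in the order\<close>

lemma dirichlet_L_infsum:
  assumes mean: "periodic_mean0 q chi" and s: "Re s > 1"
  shows "(\<lambda>n. norm (chi (Suc n) * of_nat (Suc n) powr (- s))) summable_on UNIV"
    and "dirichlet_L chi s = (\<Sum>\<^sub>\<infinity>n. chi (Suc n) * of_nat (Suc n) powr (- s))"
proof -
  let ?C = "\<Sum>j<q. norm (chi j)"
  have "norm (chi (Suc n) * of_nat (Suc n) powr (- s)) \<le> ?C * real (Suc n) powr (- Re s)" for n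
    unfolding norm_mult using norm_powr_real_powr[of "of_nat (Suc n)" "- s"]
    by (intro mult_mono periodic_mean0_bounded[OF mean]) (auto intro!: sum_nonneg)
  thus 1: "(\<lambda>n. norm (chi (Suc n) * of_nat (Suc n) powr (- s))) summable_on UNIV"
    by (intro summable_on_comparison_test[OF summable_on_cmult_right[OF summable_on_inverse_powr_Suc[OF s], of ?C]]) auto
  have "(\<Sum>\<^sub>\<infinity>n. chi (Suc n) * of_nat (Suc n) powr (- s)) = (\<Sum>n. chi (Suc n) * of_nat (Suc n) powr (- s))"
    using has_sum_imp_sums[OF has_sum_infsum[OF abs_summable_summable[OF 1]]] by (simp add: sums_iff)
  thus "dirichlet_L chi s = (\<Sum>\<^sub>\<infinity>n. chi (Suc n) * of_nat (Suc n) powr (- s))"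
    using dirichlet_L_props(2)[OF mean s] by simp
qed

text \<open>The quotient of \<open>n\<^sup>2\<close> by \<open>n\<^sup>2 - y\<^sup>2\<close> tends
  to 1, hence is bounded; as no positive integer hits \<open>y\<close>, the bound can be multiplied
  out. It lets the denominators be replaced by squares of \<open>n\<close>.\<close>

lemma square_le_const_mult_diff:
  fixes y :: real
  assumes "\<And>n::nat. n > 0 \<Longrightarrow> y \<noteq> real n" "y > 0"
  obtains K where "K > 0" "\<And>n::nat. n > 0 \<Longrightarrow> (real n)\<^sup>2 \<le> K * \<bar>(real n)\<^sup>2 - y\<^sup>2\<bar>"
proof -
  have "(\<lambda>n::nat. (real n)\<^sup>2 / ((real n)\<^sup>2 - y\<^sup>2)) \<longlonglongrightarrow> 1" by real_asymp
  hence "Bseq (\<lambda>n::nat. (real n)\<^sup>2 / ((real n)\<^sup>2 - y\<^sup>2))"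
    by (intro convergent_imp_Bseq) (auto simp: convergent_def)
  then obtain K where K: "K > 0" "\<And>n. norm ((real n)\<^sup>2 / ((real n)\<^sup>2 - y\<^sup>2)) \<le> K"
    by (auto simp: Bseq_def)
  have "(real n)\<^sup>2 \<le> K * \<bar>(real n)\<^sup>2 - y\<^sup>2\<bar>" if n: "n > 0" for n :: nat
  proof -
    have "(real n)\<^sup>2 - y\<^sup>2 \<noteq> 0" using assms(1)[OF n] assms(2) by (auto simp: power2_eq_iff)
    thus ?thesis using K(2)[of n] by (simp add: abs_divide field_simps)
  qed
  thus thesis using K(1) that by blast
qed

context even_char_pair begin

text \<open>The left edge is where the part carrying the power of \<open>y\<close> stops converging
  in the divisor, the right edge where the part carrying the power of \<open>n\<close> stops
  converging in the codivisor.\<close>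

definition strip :: "nat \<Rightarrow> complex set" where
  "strip N = {\<nu>. - 1 < Re \<nu>} \<inter> {\<nu>. Re \<nu> < 2 * real N + 1}"

text \<open>The two powers in the numerator are estimated separately. In the first, m^(-nu) cancels
  against (mk)^nu and only \<open>k\<close> feels the order; in the second, only \<open>m\<close>
  does. The bracket \<open>\<alpha>, \<beta>\<close> makes the bound uniform on vertical strips, as
  the M-test requires.\<close>

lemma frac_term_bound:
  obtains K where "K > 0" "\<And>N \<nu> \<alpha> \<beta> a b. \<alpha> \<le> Re \<nu> \<Longrightarrow> Re \<nu> \<le> \<beta> \<Longrightarrow> norm (frac_term N \<nu> (Suc a) (Suc b)) \<le>
     K * (real (Suc a) powr (- (2 * real N + 2)) * real (Suc b) powr (- (2 * real N + 2 - \<beta>))) +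
     K * (y powr (\<alpha> - 2 * real N) + y powr (\<beta> - 2 * real N)) * (real (Suc a) powr (- (\<alpha> + 2)) * real (Suc b) powr (- 2))"
proof -
  obtain K where K: "K > 0" "\<And>n::nat. n > 0 \<Longrightarrow> (real n)\<^sup>2 \<le> K * \<bar>(real n)\<^sup>2 - y\<^sup>2\<bar>"
    using square_le_const_mult_diff[of y] nonint y_pos unfolding y_def by blast
  have "norm (frac_term N \<nu> (Suc a) (Suc b)) \<le>
     K * (real (Suc a) powr (- (2 * real N + 2)) * real (Suc b) powr (- (2 * real N + 2 - \<beta>))) +
     K * (y powr (\<alpha> - 2 * real N) + y powr (\<beta> - 2 * real N)) * (real (Suc a) powr (- (\<alpha> + 2)) * real (Suc b) powr (- 2))"
    if \<alpha>: "\<alpha> \<le> Re \<nu>" and \<beta>: "Re \<nu> \<le> \<beta>" for N \<nu> \<alpha> \<beta> a b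
  proof -
    define m k s where "m = real (Suc a)" and "k = real (Suc b)" and "s = Re \<nu>"
    have m: "m \<ge> 1" and k: "k \<ge> 1" by (auto simp: m_def k_def)
    have mk: "m * k = real (Suc a * Suc b)" by (simp add: m_def k_def algebra_simps)
    have Kmk: "(m * k)\<^sup>2 \<le> K * \<bar>(m * k)\<^sup>2 - y\<^sup>2\<bar>" unfolding mk by (rule K(2)) simp
    have D0: "\<bar>(m * k)\<^sup>2 - y\<^sup>2\<bar> > 0"
    proof (rule ccontr)
      assume "\<not> \<bar>(m * k)\<^sup>2 - y\<^sup>2\<bar> > 0"
      hence "(m * k)\<^sup>2 \<le> 0" using Kmk by simp
      thus False using m k by (simp add: zero_less_mult_iff)
    qed
    have n1: "norm (of_nat (Suc a) powr (- \<nu>)) = m powr (- s)"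
      using norm_powr_real_powr[of "of_nat (Suc a)" "- \<nu>"] by (simp add: m_def s_def)
    have n2: "norm (of_nat (Suc a * Suc b) powr (\<nu> - of_nat (2 * N))) = (m * k) powr (s - 2 * real N)"
      using norm_powr_real_powr[of "of_nat (Suc a * Suc b)" "\<nu> - of_nat (2 * N)"] unfolding mk by (simp add: s_def)
    have n3: "norm (of_real y powr (\<nu> - of_nat (2 * N))) = y powr (s - 2 * real N)"
      using norm_powr_real_powr[of "of_real y" "\<nu> - of_nat (2 * N)"] y_pos by (simp add: s_def)
    have n4: "norm (of_nat (Suc a * Suc b) ^ 2 - complex_of_real y ^ 2) = \<bar>(m * k)\<^sup>2 - y\<^sup>2\<bar>"
    proof -
      have "of_nat (Suc a * Suc b) ^ 2 - complex_of_real y ^ 2 = of_real ((m * k)\<^sup>2 - y\<^sup>2)" unfolding mk by simp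
      thus ?thesis by (simp only: norm_of_real)
    qed
    have "norm (frac_term N \<nu> (Suc a) (Suc b)) \<le> m powr (- s) * 1 * 1 * (((m * k) powr (s - 2 * real N) + y powr (s - 2 * real N)) / \<bar>(m * k)\<^sup>2 - y\<^sup>2\<bar>)"
      unfolding frac_term_def norm_mult norm_divide n1 n4
      by (intro mult_mono norm_chi1_le norm_chi2_le divide_right_mono order.trans[OF norm_triangle_ineq4])
         (auto simp: n2[simplified] n2 n3[simplified] n3)
    also have "\<dots> \<le> m powr (- s) * 1 * 1 * (((m * k) powr (s - 2 * real N) + y powr (s - 2 * real N)) * (K / (m * k)\<^sup>2))"
    proof (intro mult_left_mono)
      have "1 / \<bar>(m * k)\<^sup>2 - y\<^sup>2\<bar> \<le> K / (m * k)\<^sup>2"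
        using Kmk D0 m k by (simp add: field_simps zero_less_mult_iff)
      from mult_left_mono[OF this, of "(m * k) powr (s - 2 * real N) + y powr (s - 2 * real N)"]
      show "((m * k) powr (s - 2 * real N) + y powr (s - 2 * real N)) / \<bar>(m * k)\<^sup>2 - y\<^sup>2\<bar> \<le>
        ((m * k) powr (s - 2 * real N) + y powr (s - 2 * real N)) * (K / (m * k)\<^sup>2)" by simp
    qed auto
    also have "\<dots> = K * (m powr (- (2 * real N + 2)) * k powr (- (2 * real N + 2 - s))) +
       K * y powr (s - 2 * real N) * (m powr (- (s + 2)) * k powr (- 2))"
    proof -
      have sq: "1 / (m * k)\<^sup>2 = (m * k) powr (- 2)" using m k by (simp add: powr_minus powr_realpow divide_inverse)
      have e1: "m powr (- s) * (m * k) powr (s - 2 * real N) * (m * k) powr (- 2) = m powr (- (2 * real N + 2)) * k powr (- (2 * real N + 2 - s))"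
        using m k by (simp add: powr_mult powr_add[symmetric] mult_ac) (simp add: powr_def exp_add[symmetric] algebra_simps)
      have e2: "m powr (- s) * (m * k) powr (- 2) = m powr (- (s + 2)) * k powr (- 2)"
        using m k by (simp add: powr_mult) (simp add: powr_def exp_add[symmetric] algebra_simps)
      have "m powr (- s) * 1 * 1 * (((m * k) powr (s - 2 * real N) + y powr (s - 2 * real N)) * (K / (m * k)\<^sup>2)) =
        K * (m powr (- s) * (m * k) powr (s - 2 * real N) * (1 / (m * k)\<^sup>2)) + K * y powr (s - 2 * real N) * (m powr (- s) * (1 / (m * k)\<^sup>2))"
        by (simp add: algebra_simps add_divide_distrib)
      thus ?thesis unfolding sq e1 e2 .
    qed
    also have "\<dots> \<le> K * (m powr (- (2 * real N + 2)) * k powr (- (2 * real N + 2 - \<beta>))) +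
       K * (y powr (\<alpha> - 2 * real N) + y powr (\<beta> - 2 * real N)) * (m powr (- (\<alpha> + 2)) * k powr (- 2))"
    proof (intro add_mono mult_mono mult_left_mono powr_mono)
      \<comment> \<open>Whether the power increases or decreases with \<open>s\<close> depends on
        \<open>y \<ge> 1\<close>; the sum of both endpoint values covers either case.\<close>
      show "y powr (s - 2 * real N) \<le> y powr (\<alpha> - 2 * real N) + y powr (\<beta> - 2 * real N)"
      proof (cases "y \<ge> 1")
        case True
        have "y powr (s - 2 * real N) \<le> y powr (\<beta> - 2 * real N)" using True \<beta> by (intro powr_mono) (auto simp: s_def)
        thus ?thesis by (intro add_increasing) auto
      next
        case False
        have "y powr (s - 2 * real N) \<le> y powr (\<alpha> - 2 * real N)"
          using False \<alpha> y_pos by (intro powr_mono') (auto simp: s_def)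
        thus ?thesis by (intro add_increasing2) auto
      qed
    qed (use m k \<alpha> \<beta> K(1) in \<open>auto simp: s_def\<close>)
    finally show ?thesis by (simp only: m_def k_def)
  qed
  thus thesis using K(1) that by blast
qed

lemma frac_term_summable_bound:
  assumes "- 1 < \<alpha>" "\<alpha> \<le> \<beta>" "\<beta> < 2 * real N + 1"
  obtains M where "M summable_on UNIV"
    "\<And>\<nu> i. \<alpha> \<le> Re \<nu> \<Longrightarrow> Re \<nu> \<le> \<beta> \<Longrightarrow> norm ((\<lambda>(a,b). frac_term N \<nu> (Suc a) (Suc b)) i) \<le> M i"
proof -
  obtain K where K: "\<And>\<nu> a b. \<alpha> \<le> Re \<nu> \<Longrightarrow> Re \<nu> \<le> \<beta> \<Longrightarrow> norm (frac_term N \<nu> (Suc a) (Suc b)) \<le>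
     K * (real (Suc a) powr (- (2 * real N + 2)) * real (Suc b) powr (- (2 * real N + 2 - \<beta>))) +
     K * (y powr (\<alpha> - 2 * real N) + y powr (\<beta> - 2 * real N)) * (real (Suc a) powr (- (\<alpha> + 2)) * real (Suc b) powr (- 2))"
    using frac_term_bound by metis
  define M where "M = (\<lambda>i. (\<lambda>(a,b). K * (real (Suc a) powr (- (2 * real N + 2)) * real (Suc b) powr (- (2 * real N + 2 - \<beta>)))) i +
     (\<lambda>(a,b). K * (y powr (\<alpha> - 2 * real N) + y powr (\<beta> - 2 * real N)) * (real (Suc a) powr (- (\<alpha> + 2)) * real (Suc b) powr (- 2))) i)"
  show thesis
  proof (rule that[of M])
    show "M summable_on UNIV" unfolding M_def
      using assms by (intro summable_on_add summable_on_pairs_powr) auto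
    show "norm ((\<lambda>(a,b). frac_term N \<nu> (Suc a) (Suc b)) i) \<le> M i" if "\<alpha> \<le> Re \<nu>" "Re \<nu> \<le> \<beta>" for \<nu> i
      using K[OF that] unfolding M_def by (simp only: case_prod_unfold)
  qed
qed

lemma frac_sum_holomorphic: "frac_sum N holomorphic_on strip N"
  unfolding frac_sum_def[abs_def]
proof (rule holomorphic_on_infsum)
  show "open (strip N)" unfolding strip_def by (intro open_Int open_halfspace_Re_gt open_halfspace_Re_lt)
  show "(\<lambda>\<nu>. case i of (a, b) \<Rightarrow> frac_term N \<nu> (Suc a) (Suc b)) holomorphic_on strip N" for i
    by (cases i) (simp only: prod.case frac_term_def divide_inverse, intro holomorphic_intros holomorphic_on_powr_exponent)
  fix z assume "z \<in> strip N"
  hence z: "- 1 < Re z" "Re z < 2 * real N + 1" by (auto simp: strip_def)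
  define r where "r = min (Re z + 1) (2 * real N + 1 - Re z) / 2"
  have r: "r > 0" using z by (simp add: r_def)
  have rb: "- 1 < Re z - r" "Re z + r < 2 * real N + 1" using z by (auto simp: r_def min_def field_simps)
  obtain M where M: "M summable_on UNIV"
    "\<And>\<nu> i. Re z - r \<le> Re \<nu> \<Longrightarrow> Re \<nu> \<le> Re z + r \<Longrightarrow> norm ((\<lambda>(a,b). frac_term N \<nu> (Suc a) (Suc b)) i) \<le> M i"
    using frac_term_summable_bound[of "Re z - r" "Re z + r" N] rb r by auto
  have Re: "Re z - r \<le> Re w \<and> Re w \<le> Re z + r" if "w \<in> cball z r" for w
    using abs_Re_le_cmod[of "z - w"] that by (auto simp: dist_norm)
  show "\<exists>r>0. \<exists>M. cball z r \<subseteq> strip N \<and> M summable_on UNIV \<and>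
      (\<forall>i\<in>UNIV. \<forall>w\<in>cball z r. norm (case i of (a, b) \<Rightarrow> frac_term N w (Suc a) (Suc b)) \<le> M i)"
  proof (intro exI[of _ r] exI[of _ M] conjI ballI)
    show "cball z r \<subseteq> strip N" using Re rb unfolding strip_def by fastforce
    show "norm (case i of (a, b) \<Rightarrow> frac_term N w (Suc a) (Suc b)) \<le> M i" if "w \<in> cball z r" for i w
      using M(2)[of w i] Re[OF that] by simp
  qed (use r M(1) in auto)
qed

lemma frac_term_has_sum:
  assumes "\<nu> \<in> strip N"
  shows "((\<lambda>(a,b). frac_term N \<nu> (Suc a) (Suc b)) has_sum frac_sum N \<nu>) UNIV"
proof -
  have "- 1 < Re \<nu>" "Re \<nu> < 2 * real N + 1" using assms by (auto simp: strip_def)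
  then obtain M where M: "M summable_on UNIV" "\<And>i. norm ((\<lambda>(a,b). frac_term N \<nu> (Suc a) (Suc b)) i) \<le> M i"
    using frac_term_summable_bound[of "Re \<nu>" "Re \<nu>" N] by (metis order_refl)
  have "(\<lambda>i. norm ((\<lambda>(a,b). frac_term N \<nu> (Suc a) (Suc b)) i)) summable_on UNIV"
    by (rule summable_on_comparison_test[OF M(1)]) (use M(2) in auto)
  from has_sum_infsum[OF abs_summable_summable[OF this]] show ?thesis by (simp only: frac_sum_def)
qed

definition lfun_sum :: "nat \<Rightarrow> complex \<Rightarrow> complex" where
  "lfun_sum N \<nu> = (\<Sum>j=1..N. dirichlet_L chi2 (of_nat (2 * j)) * dirichlet_L chi1 (of_nat (2 * j) - \<nu>)
                  * of_real (y ^ (2 * j - 1)))"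

definition lfun_frac_sum :: "nat \<Rightarrow> complex \<Rightarrow> complex" where
  "lfun_frac_sum N \<nu> = lfun_sum N \<nu> + of_real (y ^ (2 * N + 1)) * frac_sum N \<nu>"

text \<open>For \<open>1 \<le> j \<le> N\<close> the point \<open>2 * j - \<nu>\<close> crosses the
  line of real part 1 as \<open>\<nu>\<close> runs through the strip, so the series for
  \<open>chi1\<close> is not enough here and its entire continuation is used.\<close>

lemma lfun_frac_sum_holomorphic: "lfun_frac_sum N holomorphic_on strip N"
proof -
  have "dirichlet_L chi1 holomorphic_on A" for A
    using dirichlet_L_props(1)[OF mean0_chi1] holomorphic_on_subset by blast
  hence "(\<lambda>\<nu>. dirichlet_L chi1 (c - \<nu>)) holomorphic_on strip N" for c
    by (intro holomorphic_on_compose_gen[unfolded o_def, of "\<lambda>\<nu>. c - \<nu>" _ "dirichlet_L chi1" UNIV] holomorphic_intros) auto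
  thus ?thesis unfolding lfun_frac_sum_def[abs_def] lfun_sum_def by (intro holomorphic_intros frac_sum_holomorphic)
qed

text \<open>With A and B the powers of n and Y belonging to \<open>Suc N\<close>, the numerators
  combine to (A n^2 - B Y^2) - Y^2 (A - B) = A (n^2 - Y^2). The pole cancels, and the remaining pure
  power of n = mk factors into a term in \<open>m\<close> and a term in \<open>k\<close>.\<close>

lemma frac_term_recursion:
  assumes "m > 0" "k > 0"
  shows "of_real (y ^ (2 * N + 1)) * frac_term N \<nu> m k - of_real (y ^ (2 * Suc N + 1)) * frac_term (Suc N) \<nu> m k =
     of_real (y ^ (2 * N + 1)) * ((chi2 m * of_nat m powr (- of_nat (2 * Suc N))) * (chi1 k * of_nat k powr (- (of_nat (2 * Suc N) - \<nu>))))"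
proof -
  define Y n where "Y = complex_of_real y" and "n = complex_of_nat (m * k)"
  have Y0: "Y \<noteq> 0" using y_pos by (simp add: Y_def)
  have n0: "n \<noteq> 0" using assms by (simp add: n_def)
  have ne: "n ^ 2 - Y ^ 2 \<noteq> 0"
  proof
    assume "n ^ 2 - Y ^ 2 = 0"
    hence "complex_of_real ((real (m * k))\<^sup>2) = of_real (y\<^sup>2)" by (simp add: n_def Y_def)
    hence "(real (m * k))\<^sup>2 = y\<^sup>2" by (simp only: of_real_eq_iff)
    hence "real (m * k) = y" using y_pos by (simp add: power2_eq_iff_nonneg)
    thus False using nonint[rule_format, of "m * k"] assms by (simp add: y_def)
  qed
  have pw: "z powr (\<nu> - of_nat (2 * N)) = z powr (\<nu> - of_nat (2 * Suc N)) * z ^ 2" if "z \<noteq> 0" for z :: complex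
  proof -
    have "\<nu> - of_nat (2 * N) = \<nu> - of_nat (2 * Suc N) + 2" by simp
    moreover have "z powr 2 = z ^ 2" using that by simp
    ultimately show ?thesis by (simp only: powr_add)
  qed
  define A B where "A = n powr (\<nu> - of_nat (2 * Suc N))" and "B = Y powr (\<nu> - of_nat (2 * Suc N))"
  define c where "c = of_nat m powr (- \<nu>) * chi2 m * chi1 k"
  have "of_real (y ^ (2 * N + 1)) * frac_term N \<nu> m k - of_real (y ^ (2 * Suc N + 1)) * frac_term (Suc N) \<nu> m k =
     Y ^ (2 * N + 1) * (c * ((A * n ^ 2 - B * Y ^ 2) / (n ^ 2 - Y ^ 2) - Y ^ 2 * ((A - B) / (n ^ 2 - Y ^ 2))))"
    unfolding frac_term_def c_def[symmetric] Y_def[symmetric] n_def[symmetric] pw[OF Y0] pw[OF n0] A_def[symmetric] B_def[symmetric] of_real_power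
    by (simp add: algebra_simps power2_eq_square)
  also have "(A * n ^ 2 - B * Y ^ 2) / (n ^ 2 - Y ^ 2) - Y ^ 2 * ((A - B) / (n ^ 2 - Y ^ 2)) = A"
  proof -
    have "(A * n ^ 2 - B * Y ^ 2) / D - Y ^ 2 * ((A - B) / D) = A * (n ^ 2 - Y ^ 2) / D" for D
      by (simp add: diff_divide_distrib[symmetric] algebra_simps)
    thus ?thesis using ne by simp
  qed
  also have "c * A = (chi2 m * of_nat m powr (- of_nat (2 * Suc N))) * (chi1 k * of_nat k powr (- (of_nat (2 * Suc N) - \<nu>)))"
  proof -
    have e: "of_nat j powr s = exp (s * of_real (ln (real j)))" if "j > 0" for j and s :: complex
      using of_real_powr_eq_exp[of "real j" s] that by simp
    have "of_nat m powr (- \<nu>) * A = of_nat m powr (- of_nat (2 * Suc N)) * of_nat k powr (- (of_nat (2 * Suc N) - \<nu>))"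
      unfolding A_def n_def using assms e[of "m * k"]
      by (simp only: e mult_pos_pos exp_add[symmetric]) (simp add: ln_mult algebra_simps)
    moreover have "c * A = chi2 m * chi1 k * (of_nat m powr (- \<nu>) * A)" by (simp add: c_def mult_ac)
    ultimately show ?thesis by (simp add: mult_ac)
  qed
  finally show ?thesis by (simp add: Y_def)
qed

text \<open>\<open>Re \<nu> < 1\<close> puts \<open>2 * Suc N - \<nu>\<close> in the half-plane of
  absolute convergence for every \<open>N\<close> at once, so the recursion can be iterated down to
  \<open>N = 0\<close> on one fixed strip.\<close>

lemma lfun_frac_sum_Suc:
  assumes "- 1 < Re \<nu>" "Re \<nu> < 1"
  shows "lfun_frac_sum (Suc N) \<nu> = lfun_frac_sum N \<nu>"
proof -
  let ?s2 = "complex_of_nat (2 * Suc N)" and ?s1 = "complex_of_nat (2 * Suc N) - \<nu>"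
  have s2: "Re ?s2 > 1" and s1: "Re ?s1 > 1" using assms by auto
  note L2 = dirichlet_L_infsum[OF mean0_chi2 s2] and L1 = dirichlet_L_infsum[OF mean0_chi1 s1]
  have str: "\<nu> \<in> strip N" "\<nu> \<in> strip (Suc N)" using assms by (auto simp: strip_def)
  have "((\<lambda>(a,b). (chi2 (Suc a) * of_nat (Suc a) powr (- ?s2)) * (chi1 (Suc b) * of_nat (Suc b) powr (- ?s1))) has_sum
      (dirichlet_L chi2 ?s2 * dirichlet_L chi1 ?s1)) UNIV"
    unfolding L1(2) L2(2) by (rule has_sum_product(1)[OF L2(1) L1(1)])
  from has_sum_cmult_right[OF this, of "of_real (y ^ (2 * N + 1))"]
  have 1: "((\<lambda>(a,b). of_real (y ^ (2 * N + 1)) * ((chi2 (Suc a) * of_nat (Suc a) powr (- ?s2)) * (chi1 (Suc b) * of_nat (Suc b) powr (- ?s1)))) has_sum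
      (of_real (y ^ (2 * N + 1)) * (dirichlet_L chi2 ?s2 * dirichlet_L chi1 ?s1))) UNIV"
    by (simp only: case_prod_unfold)
  have "((\<lambda>i. of_real (y ^ (2 * N + 1)) * (\<lambda>(a,b). frac_term N \<nu> (Suc a) (Suc b)) i
          + - of_real (y ^ (2 * Suc N + 1)) * (\<lambda>(a,b). frac_term (Suc N) \<nu> (Suc a) (Suc b)) i) has_sum
      (of_real (y ^ (2 * N + 1)) * frac_sum N \<nu> + - of_real (y ^ (2 * Suc N + 1)) * frac_sum (Suc N) \<nu>)) UNIV"
    by (intro has_sum_add has_sum_cmult_right frac_term_has_sum str)
  hence 2: "((\<lambda>(a,b). of_real (y ^ (2 * N + 1)) * ((chi2 (Suc a) * of_nat (Suc a) powr (- ?s2)) * (chi1 (Suc b) * of_nat (Suc b) powr (- ?s1)))) has_sum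
      (of_real (y ^ (2 * N + 1)) * frac_sum N \<nu> - of_real (y ^ (2 * Suc N + 1)) * frac_sum (Suc N) \<nu>)) UNIV"
    unfolding minus_mult_left[symmetric] add_uminus_conv_diff
    by (rule has_sum_cong[THEN iffD1, rotated]) (auto simp only: prod.case frac_term_recursion zero_less_Suc split: prod.splits)
  have "of_real (y ^ (2 * N + 1)) * frac_sum N \<nu> - of_real (y ^ (2 * Suc N + 1)) * frac_sum (Suc N) \<nu> =
     of_real (y ^ (2 * N + 1)) * (dirichlet_L chi2 ?s2 * dirichlet_L chi1 ?s1)"
    using 2 1 by (rule has_sum_unique)
  moreover have "lfun_sum (Suc N) \<nu> = lfun_sum N \<nu> + dirichlet_L chi2 ?s2 * dirichlet_L chi1 ?s1 * of_real (y ^ (2 * N + 1))"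
    by (simp add: lfun_sum_def)
  ultimately show ?thesis unfolding lfun_frac_sum_def by (simp add: algebra_simps)
qed

lemma lfun_frac_sum_indep: "- 1 < Re \<nu> \<Longrightarrow> Re \<nu> < 1 \<Longrightarrow> lfun_frac_sum N \<nu> = lfun_frac_sum 0 \<nu>"
  by (induction N) (simp_all add: lfun_frac_sum_Suc)

text \<open>Stated with denominators cleared: \<open>sin (pi * \<nu> / 2)\<close> vanishes at 0 and
  at the other even integers of the strip, whereas the product form is holomorphic
  throughout.\<close>

lemma bessel_transform_eq_lfun_frac_sum:
  fixes \<nu> :: complex
  assumes \<nu>: "\<nu> \<in> strip N"
  shows "4 * pi * bessel_transform \<nu> * (gauss_sum p chi1 * gauss_sum q chi2 * sin (pi * \<nu> / 2)) =
           2 * of_nat p powr (1 - \<nu>) * of_nat q * lfun_frac_sum N \<nu>"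
proof -
  define G where "G = gauss_sum p chi1 * gauss_sum q chi2"
  define f where "f \<nu> = 4 * pi * bessel_transform \<nu> * (G * sin (of_real pi * \<nu> / 2)) - 2 * of_nat p powr (1 - \<nu>) * of_nat q * lfun_frac_sum N \<nu>" for \<nu>
  define U where "U = complex_of_real ` {0<..<1/4}"
  have J_hol: "bessel_transform holomorphic_on strip N" using bessel_transform_entire holomorphic_on_subset by blast
  have "f \<nu> = 0"
  \<comment> \<open>The real segment on which the kernel evaluation holds accumulates at its
    midpoint 1/8, and the strip is connected.\<close>
  proof (rule analytic_continuation[of f "strip N" U "of_real (1/8)"])
    show "f holomorphic_on strip N" unfolding f_def
      by (intro holomorphic_intros J_hol lfun_frac_sum_holomorphic holomorphic_on_powr_exponent) auto
    show "open (strip N)" unfolding strip_def by (intro open_Int open_halfspace_Re_gt open_halfspace_Re_lt)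
    show "connected (strip N)" unfolding strip_def
      by (intro convex_connected convex_Int convex_halfspace_Re_gt convex_halfspace_Re_lt)
    show "U \<subseteq> strip N" by (auto simp: U_def strip_def)
    show "complex_of_real (1/8) \<in> strip N" by (auto simp: strip_def)
    show "complex_of_real (1/8) islimpt U" unfolding islimpt_approachable
    proof (intro allI impI)
      fix e :: real assume e: "e > 0"
      define d where "d = min (e / 2) (1/16)"
      have d: "d > 0" "d < e" "d < 1/8" using e by (auto simp: d_def)
      have "dist (complex_of_real (1/8 + d)) (of_real (1/8)) = d" using d unfolding dist_of_real by (simp add: dist_real_def)
      moreover have "complex_of_real (1/8 + d) \<noteq> of_real (1/8)" using d by (simp only: of_real_eq_iff)
      moreover have "complex_of_real (1/8 + d) \<in> U" unfolding U_def using d by (intro imageI) auto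
      ultimately show "\<exists>x'\<in>U. x' \<noteq> complex_of_real (1/8) \<and> dist x' (of_real (1/8)) < e"
        using d by (intro bexI[of _ "complex_of_real (1/8 + d)"] conjI; simp)
    qed
    fix z assume "z \<in> U"
    then obtain t where t: "0 < t" "t < 1/4" "z = of_real t" by (auto simp: U_def)
    have G0: "G \<noteq> 0" using gauss_sum_nonzero[OF prim1 p1] gauss_sum_nonzero[OF prim2 q1] by (simp add: G_def)
    have "0 < pi * t" using t by simp
    moreover have "pi * t < 2 * pi" using t by simp
    ultimately have sn: "sin (pi * t / 2) > 0" by (intro sin_gt_zero) auto
    have sc: "sin (complex_of_real pi * z / 2) = of_real (sin (pi * t / 2))"
      unfolding t(3) using sin_of_real[of "pi * t / 2", where ?'a = complex] by simp
    have pp: "of_nat p powr (1 - z) = of_nat p * of_nat p powr (- z)"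
      using p1 powr_add[of "of_nat p" 1 "- z"] by simp
    have "lfun_frac_sum N z = of_real y * frac_sum 0 z" using lfun_frac_sum_indep[of z N] t by (simp add: lfun_frac_sum_def lfun_sum_def)
    moreover have "bessel_transform z = of_nat p powr (- z) * (of_nat (p * q) / (pi ^ 2 * G)) * (y * (pi / (2 * sin (pi * t / 2)))) * frac_sum 0 z"
      using bessel_transform_eq_frac_sum_0[OF t(1,2)] unfolding t(3) G_def by (simp add: mult.assoc)
    ultimately show "f z = 0" unfolding f_def sc pp using G0 sn by (simp add: field_simps power2_eq_square)
  qed (rule \<nu>)
  thus ?thesis by (simp add: f_def G_def)
qed

lemma frac_sum_sums:
  fixes \<nu> :: complex
  assumes "\<nu> \<in> strip N"
  shows "(\<lambda>n. sigma_chi (- \<nu>) chi2 chi1 (Suc n) *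
           ((of_nat (Suc n) powr (\<nu> - of_nat (2 * N)) - of_real y powr (\<nu> - of_nat (2 * N)))
             / (of_nat (Suc n) ^ 2 - of_real y ^ 2))) sums frac_sum N \<nu>"
proof -
  have "(\<Sum>d | d dvd Suc n. frac_term N \<nu> d (Suc n div d)) = sigma_chi (- \<nu>) chi2 chi1 (Suc n) *
           ((of_nat (Suc n) powr (\<nu> - of_nat (2 * N)) - of_real y powr (\<nu> - of_nat (2 * N)))
             / (of_nat (Suc n) ^ 2 - of_real y ^ 2))" for n
    unfolding sigma_chi_def sum_distrib_right frac_term_def by (intro sum.cong refl) (simp only: mem_Collect_eq dvd_mult_div_cancel)
  thus ?thesis using has_sum_pairs_imp_divisor_sums[OF frac_term_has_sum[OF assms]] by (simp only:)
qed

end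

theorem theorem3p9:
  fixes \<nu> :: complex and chi1 chi2 :: "nat \<Rightarrow> complex" and p q N :: nat and x :: real
  assumes "\<nu> \<notin> \<int>" and "Re \<nu> \<ge> 0"
    and "primitive_char p chi1" and "\<not> principal_char p chi1" and "even_char p chi1"
    and "primitive_char q chi2" and "\<not> principal_char q chi2" and "even_char q chi2"
    and "int N \<ge> \<lfloor>(Re \<nu> + 1) / 2\<rfloor>"
    and "x > 0"
    and "\<forall>m::nat. m > 0 \<longrightarrow> real (p * q) * x \<noteq> real m"
  shows "8 * pi * of_real x powr (\<nu> / 2) *
           (\<Sum>n. sigma_chi (- \<nu>) (\<lambda>k. cnj (chi1 k)) (\<lambda>k. cnj (chi2 k)) (Suc n)
                  * of_nat (Suc n) powr (\<nu> / 2) * besselK \<nu> (4 * pi * sqrt (real (Suc n) * x)))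
         = 2 * of_nat p powr (1 - \<nu>) * of_nat q
             / (gauss_sum p chi1 * gauss_sum q chi2 * sin (pi * \<nu> / 2))
           * ((\<Sum>j=1..N. dirichlet_L chi2 (of_nat (2 * j)) * dirichlet_L chi1 (of_nat (2 * j) - \<nu>)
                  * of_real ((real (p * q) * x) ^ (2 * j - 1)))
              + of_real ((real (p * q) * x) ^ (2 * N + 1)) *
                (\<Sum>n. sigma_chi (- \<nu>) chi2 chi1 (Suc n) *
                   ((of_nat (Suc n) powr (\<nu> - of_nat (2 * N))
                       - of_real (real (p * q) * x) powr (\<nu> - of_nat (2 * N)))
                    / (of_nat (Suc n) ^ 2 - of_real (real (p * q) * x) ^ 2))))"
proof -
  have "p > 1" "q > 1" using nonprincipal_modulus_gt_1 assms by (auto simp: primitive_char_def)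
  then interpret even_char_pair p q chi1 chi2 x
    using assms by unfold_locales auto
  \<comment> \<open>The floor is at most \<open>N\<close> exactly when
    \<open>(Re \<nu> + 1) / 2 < N + 1\<close>, that is, when \<open>Re \<nu>\<close> lies left of
    the right edge.\<close>
  have \<nu>: "\<nu> \<in> strip N"
    using assms(2,9) unfolding strip_def by (auto simp: floor_le_iff)
  define D where "D = gauss_sum p chi1 * gauss_sum q chi2 * sin (pi * \<nu> / 2)"
  \<comment> \<open>The zeros are the even integers, so the cleared factor may be divided out
    again.\<close>
  have "sin (pi * \<nu> / 2) \<noteq> 0"
  proof
    assume "sin (pi * \<nu> / 2) = 0"
    then obtain n :: int where "pi * \<nu> / 2 = of_real (of_int n * pi)"
      unfolding sin_eq_0 by blast
    hence "\<nu> = of_int (2 * n)" by (simp add: field_simps)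
    thus False using assms(1) by (metis Ints_of_int)
  qed
  hence D0: "D \<noteq> 0"
    using gauss_sum_nonzero[OF prim1 p1] gauss_sum_nonzero[OF prim2 q1] by (simp add: D_def)
  have "4 * pi * bessel_transform \<nu> * D = 2 * of_nat p powr (1 - \<nu>) * of_nat q * lfun_frac_sum N \<nu>"
    using bessel_transform_eq_lfun_frac_sum[OF \<nu>] unfolding D_def .
  hence "4 * pi * bessel_transform \<nu> = 2 * of_nat p powr (1 - \<nu>) * of_nat q / D * lfun_frac_sum N \<nu>"
    using D0 by (simp add: field_simps)
  thus ?thesis
    unfolding besselK_series_eq lfun_frac_sum_def lfun_sum_def D_def sums_unique[OF frac_sum_sums[OF \<nu>]] y_def .
qed

end
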